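(* Let $\Sigma$ be an LPV-SSA representation and $x_\mathrm{o}\in\mathbb{R}^{n_\mathrm{x}}$ an initial state of $\Sigma$, $n_\mathrm{x}=\dim(\Sigma)$. Then $\Sigma$ is minimal with respect to $x_\mathrm{o}$ if and only if $\Sigma$ is span-reachable from $x_\mathrm{o}$ and $\Sigma$ is observable. Moreover, if $\Sigma$ is an LPV-SSA representation that is minimal with respect to some initial state $x_0$, $\Sigma'$ is an LPV-SSA representation that is minimal with respect to some initial state $x_0'$, and $\Sigma,\Sigma'$ are weakly input-output equivalent with respect to $x_0$ and $x_0'$ (that is, $\mathfrak{Y}_{\Sigma,x_0}=\mathfrak{Y}_{\Sigma',x_0'}$), then $\Sigma$ and $\Sigma'$ are isomorphic.
   Context: Time is either continuous (CT: $\mathbb{T}=[0,\infty)$, $\xi=\frac{d}{dt}$) or discrete (DT: $\mathbb{T}=\mathbb{N}=\{0,1,\ldots\}$, $(\xi z)(t)=z(t+1)$); the statement is asserted in each of the two cases. The scheduling set $\mathbb{P}\subseteq\mathbb{R}^{n_\mathrm{p}}$ is fixed and its affine hull is $\mathbb{R}^{n_\mathrm{p}}$; $n_\mathrm{u},n_\mathrm{y}$ are fixed. In CT, $\mathcal{U},\mathcal{P},\mathcal{Y}$ are the sets of piecewise-continuous functions from $[0,\infty)$ to $\mathbb{R}^{n_\mathrm{u}}$, $\mathbb{P}$, $\mathbb{R}^{n_\mathrm{y}}$ respectively (finitely many discontinuities on each compact interval, with finite one-sided limits there); in DT they are the sets of all functions from $\mathbb{N}$ to these sets. An LPV-SSA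 representation $\Sigma=(\mathbb{P},\{A_i,B_i,C_i,0\}_{i=0}^{n_\mathrm{p}})$ of state dimension $\dim(\Sigma)=n_\mathrm{x}$ (a nonnegative integer) is the system $\xi x(t)=A(p(t))x(t)+B(p(t))u(t)$, $y(t)=C(p(t))x(t)$, where for $\mathbf{p}\in\mathbb{P}$, $A(\mathbf{p})=A_0+\sum_{i=1}^{n_\mathrm{p}}A_i\mathbf{p}_i$, $B(\mathbf{p})=B_0+\sum_{i=1}^{n_\mathrm{p}}B_i\mathbf{p}_i$, $C(\mathbf{p})=C_0+\sum_{i=1}^{n_\mathrm{p}}C_i\mathbf{p}_i$, with constant matrices $A_i\in\mathbb{R}^{n_\mathrm{x}\times n_\mathrm{x}}$, $B_i\in\mathbb{R}^{n_\mathrm{x}\times n_\mathrm{u}}$, $C_i\in\mathbb{R}^{n_\mathrm{y}\times n_\mathrm{x}}$. For $x_\mathrm{o}\in\mathbb{R}^{n_\mathrm{x}}$ and $(u,p)\in\mathcal{U}\times\mathcal{P}$, $\mathfrak{X}_{\Sigma,x_\mathrm{o}}(u,p)$ denotes the unique state trajectory $x$ with $x(0)=x_\mathrm{o}$ (in CT: locally absolutely continuous, satisfying the state equation for almost all $t$), and $\mathfrak{Y}_{\Sigma,x_\mathrm{o}}(u,p)(t)=C(p(t))x(t)$ is the corresponding output. $\Sigma$ is a realization of a function $\mathfrak{F}:\mathcal{U}\times\mathcal{P}\to\mathcal{Y}$ if $\mathfrak{F}=\mathfrak{Y}_{\Sigma,x_\mathrm{o}}$ for some initial state $x_\mathrm{o}$.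 It is a minimal realization of $\mathfrak{F}$ if it is a realization of $\mathfrak{F}$ and $\dim(\Sigma)\le\dim(\Sigma')$ for every LPV-SSA realization $\Sigma'$ of $\mathfrak{F}$ (with the same $\mathbb{P}$). $\Sigma$ is minimal with respect to $x_\mathrm{o}$ if it is a minimal realization of $\mathfrak{Y}_{\Sigma,x_\mathrm{o}}$. $\Sigma$ is span-reachable from $x_\mathrm{o}$ if $\mathrm{Span}\{\mathfrak{X}_{\Sigma,x_\mathrm{o}}(u,p)(t)\mid (u,p)\in\mathcal{U}\times\mathcal{P},\,t\in\mathbb{T}\}=\mathbb{R}^{n_\mathrm{x}}$. $\Sigma$ is observable if for all states $x_1,x_2$, $\mathfrak{Y}_{\Sigma,x_1}=\mathfrak{Y}_{\Sigma,x_2}$ implies $x_1=x_2$. $\Sigma=(\mathbb{P},\{A_i,B_i,C_i,0\})$ and $\Sigma'=(\mathbb{P},\{A_i',B_i',C_i',0\})$ of equal dimension $n_\mathrm{x}$ are isomorphic if there is a nonsingular $T\in\mathbb{R}^{n_\mathrm{x}\times n_\mathrm{x}}$ with $A_i'T=TA_i$, $B_i'=TB_i$, $C_i'T=C_i$ for all $i=0,\ldots,n_\mathrm{p}$. *)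

theory Defs
  imports "HOL-Analysis.Lebesgue_Measure" "Jordan_Normal_Form.VS_Connect"
begin

datatype time_kind = CT | DT

text \<open>Both time axes are regarded as subsets of the reals, so that one set of definitions
  covers continuous and discrete time.\<close>

definition time_axis :: "time_kind \<Rightarrow> real set" where
  "time_axis k = (case k of CT \<Rightarrow> {0..} | DT \<Rightarrow> \<nat>)"

text \<open>The data shared by all systems under consideration: the kind of time, the numbers of
  scheduling variables, inputs and outputs, and the scheduling set.\<close>

record lpv_setting =
  time :: time_kind
  n_p :: nat
  n_u :: nat
  n_y :: nat
  sched :: "real vec set"

text \<open>\<open>A\<^sub>0\<close> is \<open>mat_A \<Sigma> 0\<close>; only the indices up to \<open>n_p\<close> matter.\<close>

record lpv_ssa =
  dim_x :: nat
  mat_A :: "nat \<Rightarrow> real mat"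
  mat_B :: "nat \<Rightarrow> real mat"
  mat_C :: "nat \<Rightarrow> real mat"

definition is_lpv_ssa :: "lpv_setting \<Rightarrow> lpv_ssa \<Rightarrow> bool" where
  "is_lpv_ssa S \<Sigma> \<longleftrightarrow>
     (\<forall>i\<le>n_p S. mat_A \<Sigma> i \<in> carrier_mat (dim_x \<Sigma>) (dim_x \<Sigma>) \<and>
                 mat_B \<Sigma> i \<in> carrier_mat (dim_x \<Sigma>) (n_u S) \<and>
                 mat_C \<Sigma> i \<in> carrier_mat (n_y S) (dim_x \<Sigma>))"

definition vec_affine_hull :: "nat \<Rightarrow> real vec set \<Rightarrow> real vec set" where
  "vec_affine_hull n P =
     {vec n (\<lambda>i. \<Sum>v\<in>F. a v * v $ i) | a F. finite F \<and> F \<subseteq> P \<and> (\<Sum>v\<in>F. a v) = 1}"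

text \<open>Vector components are numbered from 0, so the \<open>i\<close>-th scheduling variable is
  \<open>q $ (i - 1)\<close>.\<close>

definition affine_mat :: "nat \<Rightarrow> (nat \<Rightarrow> real mat) \<Rightarrow> real vec \<Rightarrow> real mat" where
  "affine_mat n M q = mat (dim_row (M 0)) (dim_col (M 0))
     (\<lambda>(r, c). M 0 $$ (r, c) + (\<Sum>i=1..n. M i $$ (r, c) * q $ (i - 1)))"

definition piecewise_continuous :: "(real \<Rightarrow> real) \<Rightarrow> bool" where
  "piecewise_continuous f \<longleftrightarrow>
     (\<forall>b. finite {t \<in> {0..b}. \<not> continuous (at t within {0..}) f}) \<and>
     (\<forall>t\<ge>0. \<exists>l. (f \<longlongrightarrow> l) (at_right t)) \<and>
     (\<forall>t>0. \<exists>l. (f \<longlongrightarrow> l) (at_left t))"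

text \<open>Signals with values in \<open>V \<subseteq> \<real>\<^sup>n\<close>. They are extensional functions on the time axis, so
  that HOL equality of signals is equality on the time axis.\<close>

definition signals :: "time_kind \<Rightarrow> nat \<Rightarrow> real vec set \<Rightarrow> (real \<Rightarrow> real vec) set" where
  "signals k n V =
     {f \<in> time_axis k \<rightarrow>\<^sub>E V. k = CT \<longrightarrow> (\<forall>i<n. piecewise_continuous (\<lambda>t. f t $ i))}"

definition inputs :: "lpv_setting \<Rightarrow> (real \<Rightarrow> real vec) set" where
  "inputs S = signals (time S) (n_u S) (carrier_vec (n_u S))"

definition schedulings :: "lpv_setting \<Rightarrow> (real \<Rightarrow> real vec) set" where
  "schedulings S = signals (time S) (n_p S) (sched S)"

definition absolutely_continuous_upto :: "real \<Rightarrow> (real \<Rightarrow> real) \<Rightarrow> bool" where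
  "absolutely_continuous_upto b f \<longleftrightarrow>
     (\<forall>\<epsilon>>0. \<exists>\<delta>>0. \<forall>(N::nat) l r.
        (\<forall>j<N. 0 \<le> l j \<and> l j \<le> r j \<and> r j \<le> b) \<longrightarrow>
        disjoint_family_on (\<lambda>j. {l j<..<r j}) {..<N} \<longrightarrow>
        (\<Sum>j<N. r j - l j) < \<delta> \<longrightarrow> (\<Sum>j<N. \<bar>f (r j) - f (l j)\<bar>) < \<epsilon>)"

definition state_rhs ::
    "lpv_setting \<Rightarrow> lpv_ssa \<Rightarrow> real vec \<Rightarrow> real vec \<Rightarrow> real vec \<Rightarrow> real vec" where
  "state_rhs S \<Sigma> q x u =
     affine_mat (n_p S) (mat_A \<Sigma>) q *\<^sub>v x + affine_mat (n_p S) (mat_B \<Sigma>) q *\<^sub>v u"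

definition is_state_trajectory ::
    "lpv_setting \<Rightarrow> lpv_ssa \<Rightarrow> real vec \<Rightarrow> (real \<Rightarrow> real vec) \<Rightarrow> (real \<Rightarrow> real vec) \<Rightarrow>
     (real \<Rightarrow> real vec) \<Rightarrow> bool" where
  "is_state_trajectory S \<Sigma> x0 u p x \<longleftrightarrow>
     x \<in> time_axis (time S) \<rightarrow>\<^sub>E carrier_vec (dim_x \<Sigma>) \<and> x 0 = x0 \<and>
     (case time S of
        CT \<Rightarrow>
          (\<forall>i<dim_x \<Sigma>. \<forall>b. absolutely_continuous_upto b (\<lambda>t. x t $ i)) \<and>
          (AE t in lebesgue. t \<in> {0..} \<longrightarrow>
             (\<forall>i<dim_x \<Sigma>. ((\<lambda>s. x s $ i) has_real_derivative
                (state_rhs S \<Sigma> (p t) (x t) (u t) $ i)) (at t within {0..})))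
      | DT \<Rightarrow> (\<forall>t\<in>\<nat>. x (t + 1) = state_rhs S \<Sigma> (p t) (x t) (u t)))"

definition state_trajectory ::
    "lpv_setting \<Rightarrow> lpv_ssa \<Rightarrow> real vec \<Rightarrow> (real \<Rightarrow> real vec) \<Rightarrow> (real \<Rightarrow> real vec) \<Rightarrow>
     real \<Rightarrow> real vec" where
  "state_trajectory S \<Sigma> x0 u p = (THE x. is_state_trajectory S \<Sigma> x0 u p x)"

definition output_trajectory ::
    "lpv_setting \<Rightarrow> lpv_ssa \<Rightarrow> real vec \<Rightarrow> (real \<Rightarrow> real vec) \<Rightarrow> (real \<Rightarrow> real vec) \<Rightarrow>
     real \<Rightarrow> real vec" where
  "output_trajectory S \<Sigma> x0 u p =
     (\<lambda>t\<in>time_axis (time S).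
        affine_mat (n_p S) (mat_C \<Sigma>) (p t) *\<^sub>v state_trajectory S \<Sigma> x0 u p t)"

type_synonym io_map = "(real \<Rightarrow> real vec) \<Rightarrow> (real \<Rightarrow> real vec) \<Rightarrow> (real \<Rightarrow> real vec)"

text \<open>Equality of two functions with domain \<open>inputs S \<times> schedulings S\<close>.\<close>

definition io_equal :: "lpv_setting \<Rightarrow> io_map \<Rightarrow> io_map \<Rightarrow> bool" where
  "io_equal S F G \<longleftrightarrow> (\<forall>u\<in>inputs S. \<forall>p\<in>schedulings S. F u p = G u p)"

text \<open>No output signal space is needed here: a map that is \<open>io_equal\<close> to some
  \<open>output_trajectory\<close> inherits its values, which are extensional on the time axis and, in
  continuous time, piecewise continuous because the state is continuous.\<close>

definition is_realization :: "lpv_setting \<Rightarrow> lpv_ssa \<Rightarrow> io_map \<Rightarrow> bool" where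
  "is_realization S \<Sigma> F \<longleftrightarrow>
     is_lpv_ssa S \<Sigma> \<and>
     (\<exists>x0\<in>carrier_vec (dim_x \<Sigma>). io_equal S F (output_trajectory S \<Sigma> x0))"

definition is_minimal_realization :: "lpv_setting \<Rightarrow> lpv_ssa \<Rightarrow> io_map \<Rightarrow> bool" where
  "is_minimal_realization S \<Sigma> F \<longleftrightarrow>
     is_realization S \<Sigma> F \<and> (\<forall>\<Sigma>'. is_realization S \<Sigma>' F \<longrightarrow> dim_x \<Sigma> \<le> dim_x \<Sigma>')"

definition minimal_wrt :: "lpv_setting \<Rightarrow> lpv_ssa \<Rightarrow> real vec \<Rightarrow> bool" where
  "minimal_wrt S \<Sigma> x0 \<longleftrightarrow> is_minimal_realization S \<Sigma> (output_trajectory S \<Sigma> x0)"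

definition span_reachable :: "lpv_setting \<Rightarrow> lpv_ssa \<Rightarrow> real vec \<Rightarrow> bool" where
  "span_reachable S \<Sigma> x0 \<longleftrightarrow>
     LinearCombinations.module.span class_ring (module_vec TYPE(real) (dim_x \<Sigma>))
       {state_trajectory S \<Sigma> x0 u p t | u p t.
          u \<in> inputs S \<and> p \<in> schedulings S \<and> t \<in> time_axis (time S)}
     = carrier_vec (dim_x \<Sigma>)"

definition observable :: "lpv_setting \<Rightarrow> lpv_ssa \<Rightarrow> bool" where
  "observable S \<Sigma> \<longleftrightarrow>
     (\<forall>x1\<in>carrier_vec (dim_x \<Sigma>). \<forall>x2\<in>carrier_vec (dim_x \<Sigma>).
        io_equal S (output_trajectory S \<Sigma> x1) (output_trajectory S \<Sigma> x2) \<longrightarrow> x1 = x2)"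

definition weakly_io_equivalent ::
    "lpv_setting \<Rightarrow> lpv_ssa \<Rightarrow> real vec \<Rightarrow> lpv_ssa \<Rightarrow> real vec \<Rightarrow> bool" where
  "weakly_io_equivalent S \<Sigma> x0 \<Sigma>' x0' \<longleftrightarrow>
     io_equal S (output_trajectory S \<Sigma> x0) (output_trajectory S \<Sigma>' x0')"

definition isomorphic :: "lpv_setting \<Rightarrow> lpv_ssa \<Rightarrow> lpv_ssa \<Rightarrow> bool" where
  "isomorphic S \<Sigma> \<Sigma>' \<longleftrightarrow>
     dim_x \<Sigma> = dim_x \<Sigma>' \<and>
     (\<exists>T\<in>carrier_mat (dim_x \<Sigma>) (dim_x \<Sigma>). invertible_mat T \<and>
        (\<forall>i\<le>n_p S. mat_A \<Sigma>' i * T = T * mat_A \<Sigma> i \<and>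
                    mat_B \<Sigma>' i = T * mat_B \<Sigma> i \<and>
                    mat_C \<Sigma>' i * T = mat_C \<Sigma> i))"

end

theory Submission
  imports Defs "HOL-Analysis.Equivalence_Lebesgue_Henstock_Integration"
begin

text \<open>Both time axes are treated at once through the relation \<open>\<xi> f = g\<close>, read as \<open>f(t + 1) = g(t)\<close> in
  discrete time and as \<open>f(t) - f(0) = \<integral>\<^sub>0\<^sup>t g\<close> in continuous time; the Caratheodory solutions are exactly
  the solutions of the integral equation. If a linear map vanishes along all trajectories with constant
  input and scheduling that start in \<open>x\<close>, it vanishes on \<open>A(q) x + B(q) v\<close>. Hence the span of the
  reachable states and the set of unobservable states are invariant, and a system that is not span-reachable
  (not observable) can be restricted (factored) to a smaller one with the same output.

  Conversely, let two systems have the same input-output map. Running both with the same signals, all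
  pairs of reached states, and therefore all pairs in their linear span, have the same zero-input output.
  If the first system is span-reachable and observable, this span contains the graph of an
  injective linear map, so the second dimension is not smaller. If the second system is observable
  too and has the same dimension, the span is the graph of the isomorphism.\<close>

unbundle no vec_syntax

section \<open>Absolutely continuous functions\<close>

text \<open>The delicate case is continuous time, where the state equation holds only almost
  everywhere. Two devices keep exceptional sets out of the algebra. The integral relation is stable
  under linear maps and under concatenation, so superposition and restarting are proved for both
  kinds of time at once. And a vector field is read off only at the initial time of runs with
  constant signals: there the right-hand side is continuous, so the integral has exactly that
  derivative at 0; in discrete time one step gives the same. Zero input isolates
  \<open>A(q) x\<close>; subtracting it at the reachable state \<open>x0\<close> isolates
  \<open>B(q) v\<close>. Everything is extracted from trajectories and subspaces, without Markov
  parameters or rank conditions. Subspaces are accessed through pairs of matrices: inclusion and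
  projection, or quotient map and section. Identities at scheduling points become identities of
  coefficients because an affine function that vanishes on a set vanishes on its affine
  hull.\<close>

lemma absolutely_continuous_upto_finite:
  assumes "absolutely_continuous_upto b f" "e > 0"
  shows "\<exists>d>0. \<forall>D (l :: 'a \<Rightarrow> real) r. finite D \<longrightarrow> (\<forall>j\<in>D. 0 \<le> l j \<and> l j \<le> r j \<and> r j \<le> b) \<longrightarrow>
      disjoint_family_on (\<lambda>j. {l j<..<r j}) D \<longrightarrow> (\<Sum>j\<in>D. r j - l j) < d \<longrightarrow>
      (\<Sum>j\<in>D. \<bar>f (r j) - f (l j)\<bar>) < e"
proof -
  obtain d where d: "d > 0" and *: "\<And>(N::nat) l r. (\<forall>j<N. 0 \<le> l j \<and> l j \<le> r j \<and> r j \<le> b) \<Longrightarrow>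
        disjoint_family_on (\<lambda>j. {l j<..<r j}) {..<N} \<Longrightarrow>
        (\<Sum>j<N. r j - l j) < d \<Longrightarrow> (\<Sum>j<N. \<bar>f (r j) - f (l j)\<bar>) < e"
    using assms unfolding absolutely_continuous_upto_def by meson
  show ?thesis
  proof (rule exI[of _ d], intro conjI[OF d] allI impI)
    fix D and l r :: "'a \<Rightarrow> real"
    assume D: "finite D" "\<forall>j\<in>D. 0 \<le> l j \<and> l j \<le> r j \<and> r j \<le> b"
      "disjoint_family_on (\<lambda>j. {l j<..<r j}) D" "(\<Sum>j\<in>D. r j - l j) < d"
    \<comment> \<open>The definition numbers its intervals by naturals, while later sums run over
      the tagged pieces of a division; the same \<open>d\<close> is carried along an enumeration of
      \<open>D\<close>.\<close>
    obtain h where h: "bij_betw h {..<card D} D"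
      using ex_bij_betw_nat_finite[OF D(1)] by (auto simp: atLeast0LessThan)
    have "(\<Sum>j<card D. \<bar>f (r (h j)) - f (l (h j))\<bar>) < e"
    proof (rule *[of "card D" "\<lambda>j. l (h j)" "\<lambda>j. r (h j)"])
      show "\<forall>j<card D. 0 \<le> l (h j) \<and> l (h j) \<le> r (h j) \<and> r (h j) \<le> b"
        using h D(2) by (auto simp: bij_betw_def)
      show "disjoint_family_on (\<lambda>j. {l (h j)<..<r (h j)}) {..<card D}"
        using h D(3) unfolding disjoint_family_on_def bij_betw_def inj_on_def
        by (metis image_eqI)
      show "(\<Sum>j<card D. r (h j) - l (h j)) < d"
        using D(4) sum.reindex_bij_betw[OF h, of "\<lambda>j. r j - l j"] by simp
    qed
    then show "(\<Sum>j\<in>D. \<bar>f (r j) - f (l j)\<bar>) < e"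
      using sum.reindex_bij_betw[OF h, of "\<lambda>j. \<bar>f (r j) - f (l j)\<bar>"] by simp
  qed
qed

text \<open>Henstock-Kurzweil sums are compared with the telescoping increments of \<open>f\<close>.
  At a tag outside the null set \<open>N\<close> the derivative controls the increment. The pieces
  tagged in \<open>N\<close> have small total length, since the gauge keeps them in an open set of
  small measure, and absolute continuity bounds their increments.\<close>

lemma absolutely_continuous_upto_has_integral:
  assumes ac: "absolutely_continuous_upto b f" and b: "0 \<le> b"
    and ae: "AE t in lebesgue. t \<in> {0..} \<longrightarrow> (f has_real_derivative g t) (at t within {0..})"
  shows "(g has_integral (f b - f 0)) {0..b}"
proof -
  obtain N where N': "\<And>t. t \<in> space lebesgue - N \<Longrightarrow> t \<in> {0..} \<longrightarrow> (f has_real_derivative g t) (at t within {0..})"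
    and N0: "N \<in> null_sets lebesgue"
    by (rule AE_E3[OF ae], rule that) auto
  have N: "(f has_real_derivative g t) (at t within {0..})" if "t \<ge> 0" "t \<notin> N" for t
    using N'[of t] that by simp
  \<comment> \<open>Setting the integrand to 0 on \<open>N\<close> removes the Riemann terms of the
    tags there, so only increments of \<open>f\<close> remain; the change is undone at the end
    because \<open>N\<close> is negligible.\<close>
  define h where "h t = (if t \<in> N then 0 else g t)" for t
  have "(h has_integral (f b - f 0)) {0..b}"
    unfolding has_integral_real
  proof (intro allI impI)
    fix e :: real assume e: "e > 0"
    \<comment> \<open>Summed over all pieces, the derivative error is at most \<open>e1 * b\<close>,
      hence at most half of \<open>e\<close>; the \<open>+ 1\<close> covers
      \<open>b = 0\<close>.\<close>
    define e1 where "e1 = e / (2 * (b + 1))"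
    have e1: "e1 > 0" using e b by (simp add: e1_def)
    have e1b: "e1 * b \<le> e / 2"
      using e b by (simp add: e1_def field_simps)
    obtain d where d: "d > 0" and dP: "\<forall>D (l :: real \<times> real set \<Rightarrow> real) r. finite D \<longrightarrow>
        (\<forall>j\<in>D. 0 \<le> l j \<and> l j \<le> r j \<and> r j \<le> b) \<longrightarrow>
        disjoint_family_on (\<lambda>j. {l j<..<r j}) D \<longrightarrow> (\<Sum>j\<in>D. r j - l j) < d \<longrightarrow>
        (\<Sum>j\<in>D. \<bar>f (r j) - f (l j)\<bar>) < e / 2"
      using absolutely_continuous_upto_finite[OF ac half_gt_zero[OF e]] by (elim exE conjE) (rule that)
    \<comment> \<open>Outer regularity: as \<open>N\<close> is null, \<open>T\<close> has the
      measure of \<open>T - N\<close>, which is below the \<open>d\<close> of absolute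
      continuity.\<close>
    obtain T where T: "open T" "N \<subseteq> T" "(T - N) \<in> lmeasurable" "emeasure lebesgue (T - N) < ennreal d"
      using sets_lebesgue_outer_open[of N d] N0 d by blast
    have Tm: "T \<in> sets lebesgue" using T(1) by simp
    have "emeasure lebesgue T = emeasure lebesgue (T - N)"
      by (rule emeasure_Diff_null_set[OF N0 Tm, symmetric])
    then have Td: "emeasure lebesgue T < ennreal d" using T by simp
    then have "emeasure lebesgue T < \<infinity>"
      using order.strict_trans[OF _ ennreal_less_top] by (simp add: infinity_ennreal_def)
    with Tm have Tl: "T \<in> lmeasurable" by (rule fmeasurableI)
    have Tl2: "measure lebesgue T < d"
      using Td emeasure_eq_measure2[OF Tl] d by (simp add: ennreal_less_iff)
    have "\<exists>r>0. \<forall>y\<ge>0. \<bar>y - t\<bar> < r \<longrightarrow> \<bar>f y - f t - g t * (y - t)\<bar> \<le> e1 * \<bar>y - t\<bar>"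
      if "t \<ge> 0" "t \<notin> N" for t
      using N[OF that] e1 unfolding has_field_derivative_def has_derivative_within_alt by fastforce
    then obtain \<rho> where \<rho>: "\<And>t. t \<ge> 0 \<Longrightarrow> t \<notin> N \<Longrightarrow> \<rho> t > 0"
      "\<And>t y. t \<ge> 0 \<Longrightarrow> t \<notin> N \<Longrightarrow> y \<ge> 0 \<Longrightarrow> \<bar>y - t\<bar> < \<rho> t \<Longrightarrow>
        \<bar>f y - f t - g t * (y - t)\<bar> \<le> e1 * \<bar>y - t\<bar>"
      by metis
    \<comment> \<open>Tags in \<open>N\<close> are forced into \<open>T\<close>, other tags into
      their derivative radius; negative points are never tags of a division of
      \<open>{0..b}\<close>, so any open set will do for them.\<close>
    define \<gamma> where "\<gamma> t = (if t \<in> N then T else if t \<ge> 0 then ball t (\<rho> t) else UNIV)" for t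
    have "gauge \<gamma>"
      using T \<rho> by (auto simp: gauge_def \<gamma>_def)
    moreover have "norm ((\<Sum>(x, k)\<in>D. content k *\<^sub>R h x) - (f b - f 0)) < e"
      if tag: "D tagged_division_of {0..b}" and fine: "\<gamma> fine D" for D
    proof -
      note D = tagged_division_ofD[OF tag]
      have iv: "\<exists>u v. k = {u..v} \<and> u \<le> x \<and> x \<le> v \<and> 0 \<le> u \<and> v \<le> b" if xk: "(x, k) \<in> D" for x k
      proof -
        obtain u v where k: "k = {u..v}" using D(4)[OF xk] by auto
        with D(2)[OF xk] have "u \<le> x" "x \<le> v" by auto
        moreover from this D(3)[OF xk] k have "0 \<le> u" "v \<le> b" by auto
        ultimately show ?thesis using k by blast
      qed
      let ?F = "\<lambda>(x, k). content k *\<^sub>R h x - (f (Sup k) - f (Inf k))"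
      define D1 where "D1 = {j \<in> D. fst j \<notin> N}"
      define D2 where "D2 = {j \<in> D. fst j \<in> N}"
      have fin: "finite D" by (rule D(1))
      have fin2: "finite D1" "finite D2" using fin by (auto simp: D1_def D2_def)
      have "(\<Sum>(x, k)\<in>D. content k *\<^sub>R h x) - (f b - f 0) = (\<Sum>j\<in>D. ?F j)"
        using additive_tagged_division_1[OF b tag, of f]
        by (simp add: sum_subtractf case_prod_unfold)
      also have "\<dots> = (\<Sum>j\<in>D1. ?F j) + (\<Sum>j\<in>D2. ?F j)"
        by (subst sum.union_disjoint[symmetric]) (auto simp: D1_def D2_def fin intro!: sum.cong)
      finally have eq: "(\<Sum>(x, k)\<in>D. content k *\<^sub>R h x) - (f b - f 0) = \<dots>" .
      have "\<bar>\<Sum>j\<in>D1. ?F j\<bar> \<le> (\<Sum>j\<in>D1. e1 * content (snd j))"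
      proof (rule order_trans[OF sum_abs], rule sum_mono)
        fix j assume j: "j \<in> D1"
        obtain x k where jx: "j = (x, k)" by (cases j)
        with j have xk: "(x, k) \<in> D" "x \<notin> N" by (auto simp: D1_def)
        obtain u v where k: "k = {u..v}" "u \<le> x" "x \<le> v" "0 \<le> u" "v \<le> b"
          using iv[OF xk(1)] by blast
        have "k \<subseteq> ball x (\<rho> x)"
          using fineD[OF fine xk(1)] xk(2) k by (auto simp: \<gamma>_def)
        moreover have "u \<in> k" "v \<in> k" using k by auto
        ultimately have "\<bar>u - x\<bar> < \<rho> x" "\<bar>v - x\<bar> < \<rho> x" by (auto simp: dist_real_def)
        then have "\<bar>f u - f x - g x * (u - x)\<bar> \<le> e1 * (x - u)" "\<bar>f v - f x - g x * (v - x)\<bar> \<le> e1 * (v - x)"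
          using \<rho>(2)[of x u] \<rho>(2)[of x v] k xk(2) by auto
        \<comment> \<open>Straddle estimate: the tag lies between \<open>u\<close> and
          \<open>v\<close>, so the errors on its two sides add up to a multiple of the full
          length.\<close>
        then have "\<bar>(f v - f u) - g x * (v - u)\<bar> \<le> e1 * (v - u)"
        proof -
          have "(f v - f u) - g x * (v - u) = (f v - f x - g x * (v - x)) - (f u - f x - g x * (u - x))"
            by (simp add: algebra_simps)
          moreover have "e1 * (v - u) = e1 * (x - u) + e1 * (v - x)" by (simp add: algebra_simps)
          moreover assume "\<bar>f u - f x - g x * (u - x)\<bar> \<le> e1 * (x - u)" "\<bar>f v - f x - g x * (v - x)\<bar> \<le> e1 * (v - x)"
          ultimately show ?thesis by linarith
        qed
        then show "\<bar>?F j\<bar> \<le> e1 * content (snd j)"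
          using k xk(2) by (simp add: jx h_def abs_minus_commute mult.commute)
      qed
      also have "\<dots> \<le> (\<Sum>j\<in>D. e1 * content (snd j))"
        using e1 fin by (intro sum_mono2) (auto simp: D1_def)
      also have "\<dots> = e1 * b"
        using additive_content_tagged_division[of D 0 b] tag b
        by (simp add: sum_distrib_left[symmetric] case_prod_unfold)
      finally have 1: "\<bar>\<Sum>j\<in>D1. ?F j\<bar> \<le> e / 2" using e1b by simp
      have "\<bar>\<Sum>j\<in>D2. ?F j\<bar> \<le> (\<Sum>j\<in>D2. \<bar>f (Sup (snd j)) - f (Inf (snd j))\<bar>)"
        by (rule order_trans[OF sum_abs], rule sum_mono) (auto simp: D2_def h_def abs_minus_commute)
      also have "\<dots> < e / 2"
      proof (rule dP[rule_format])
        have iv2: "\<exists>x u v. j = (x, {u..v}) \<and> u \<le> x \<and> x \<le> v \<and> 0 \<le> u \<and> v \<le> b \<and> {u<..<v} \<subseteq> T \<and> Sup (snd j) = v \<and> Inf (snd j) = u" if "j \<in> D2" for j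
        proof -
          obtain x k where jx: "j = (x, k)" by (cases j)
          with that have xk: "(x, k) \<in> D" "x \<in> N" by (auto simp: D2_def)
          obtain u v where k: "k = {u..v}" "u \<le> x" "x \<le> v" "0 \<le> u" "v \<le> b"
            using iv[OF xk(1)] by blast
          have "k \<subseteq> T" using fineD[OF fine xk(1)] xk(2) by (auto simp: \<gamma>_def)
          then have "{u<..<v} \<subseteq> T" using k(1) by force
          then show ?thesis using k jx by auto
        qed
        show "finite D2" by (rule fin2)
        show bnd: "0 \<le> Inf (snd j) \<and> Inf (snd j) \<le> Sup (snd j) \<and> Sup (snd j) \<le> b" if "j \<in> D2" for j
          using iv2[OF that] by auto
        show disj: "disjoint_family_on (\<lambda>j. {Inf (snd j)<..<Sup (snd j)}) D2"
        proof (unfold disjoint_family_on_def, intro ballI impI)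
          fix i j assume ij: "i \<in> D2" "j \<in> D2" "i \<noteq> j"
          have "interior (snd i) \<inter> interior (snd j) = {}"
            using ij D(5)[of "fst i" "snd i" "fst j" "snd j"] by (auto simp: D2_def)
          moreover have "interior (snd l) = {Inf (snd l)<..<Sup (snd l)}" if l: "l \<in> D2" for l
          proof -
            obtain x u v where "l = (x, {u..v})" "Sup (snd l) = v" "Inf (snd l) = u"
              using iv2[OF l] by blast
            then show ?thesis by (metis interior_atLeastAtMost_real snd_conv)
          qed
          ultimately show "{Inf (snd i)<..<Sup (snd i)} \<inter> {Inf (snd j)<..<Sup (snd j)} = {}"
            using ij by metis
        qed
        \<comment> \<open>The open pieces are pairwise disjoint, so their total length is the
          measure of a union that lies inside \<open>T\<close>.\<close>
        have "(\<Sum>j\<in>D2. Sup (snd j) - Inf (snd j)) = (\<Sum>j\<in>D2. measure lebesgue {Inf (snd j)<..<Sup (snd j)})"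
        proof (rule sum.cong)
          fix j assume "j \<in> D2"
          then have "Inf (snd j) \<le> Sup (snd j)" using bnd by blast
          then show "Sup (snd j) - Inf (snd j) = measure lebesgue {Inf (snd j)<..<Sup (snd j)}" by simp
        qed simp
        also have "\<dots> = measure lebesgue (\<Union>j\<in>D2. {Inf (snd j)<..<Sup (snd j)})"
        proof (rule measure_finite_Union[symmetric, OF fin2(2) _ disj])
          fix j assume "j \<in> D2"
          then have "Inf (snd j) \<le> Sup (snd j)" using bnd by blast
          then show "emeasure lebesgue {Inf (snd j)<..<Sup (snd j)} \<noteq> \<infinity>" by simp
        qed auto
        also have "\<dots> \<le> measure lebesgue T"
          proof (rule measure_mono_fmeasurable[OF _ _ Tl])
          show "(\<Union>j\<in>D2. {Inf (snd j)<..<Sup (snd j)}) \<subseteq> T" using iv2 by blast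
          show "(\<Union>j\<in>D2. {Inf (snd j)<..<Sup (snd j)}) \<in> sets lebesgue"
            using fin2 by (intro sets.finite_UN) auto
        qed
        also have "\<dots> < d" by (rule Tl2)
        finally show "(\<Sum>j\<in>D2. Sup (snd j) - Inf (snd j)) < d" .
      qed
      finally show ?thesis unfolding eq using 1 by auto
    qed
    ultimately show "\<exists>\<gamma>. gauge \<gamma> \<and> (\<forall>D. D tagged_division_of {0..b} \<and> \<gamma> fine D \<longrightarrow>
        norm ((\<Sum>(x, k)\<in>D. content k *\<^sub>R h x) - (f b - f 0)) < e)"
      by (intro exI[of _ \<gamma>] conjI allI impI) (simp_all only:)
  qed
  then show ?thesis
    by (rule has_integral_spike[rotated 2]) (use N0 in \<open>auto simp: negligible_iff_null_sets h_def\<close>)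
qed

section \<open>Piecewise continuous functions\<close>

text \<open>Only values on the half line enter: left limits are taken at positive points, whose left
  neighbourhoods can be chosen positive. This lets an extensional signal be replaced by a formula
  valid for nonnegative times.\<close>

lemma piecewise_continuous_cong:
  assumes "piecewise_continuous f" "\<And>t. 0 \<le> t \<Longrightarrow> f t = g t"
  shows "piecewise_continuous g"
proof -
  have r: "(f \<longlongrightarrow> l) (at_right t) \<longleftrightarrow> (g \<longlongrightarrow> l) (at_right t)" if "t \<ge> 0" for t l
    by (rule filterlim_cong[OF refl refl]) (use that assms(2) in \<open>auto simp: eventually_at_filter\<close>)
  have l: "(f \<longlongrightarrow> l) (at_left t) \<longleftrightarrow> (g \<longlongrightarrow> l) (at_left t)" if "t > 0" for t l
  proof (rule filterlim_cong[OF refl refl])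
    show "\<forall>\<^sub>F x in at_left t. f x = g x"
      using eventually_at_left_real[OF that] by eventually_elim (use assms(2) in auto)
  qed
  have c: "continuous (at t within {0..}) f \<longleftrightarrow> continuous (at t within {0..}) g" if "t \<ge> 0" for t
    unfolding continuous_within
    by (rule filterlim_cong) (use that assms(2) in \<open>auto simp: eventually_at_filter\<close>)
  have "{t \<in> {0..b}. \<not> continuous (at t within {0..}) f} = {t \<in> {0..b}. \<not> continuous (at t within {0..}) g}" for b
    using c by auto
  then show ?thesis
    using assms(1) unfolding piecewise_continuous_def by (simp add: r l)
qed

text \<open>The hypothesis on \<open>h\<close> ranges over all filters, so it serves continuity
  points, right limits and left limits alike.\<close>

lemma piecewise_continuous_binop:
  assumes f: "piecewise_continuous f" and g: "piecewise_continuous g"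
    and h: "\<And>F l m. (f \<longlongrightarrow> l) F \<Longrightarrow> (g \<longlongrightarrow> m) F \<Longrightarrow> ((\<lambda>t. h (f t) (g t)) \<longlongrightarrow> h l m) F"
  shows "piecewise_continuous (\<lambda>t. h (f t) (g t))"
proof -
  have "finite {t \<in> {0..b}. \<not> continuous (at t within {0..}) (\<lambda>t. h (f t) (g t))}" for b
  proof (rule finite_subset)
    show "finite ({t \<in> {0..b}. \<not> continuous (at t within {0..}) f} \<union> {t \<in> {0..b}. \<not> continuous (at t within {0..}) g})"
      using f g unfolding piecewise_continuous_def by blast
  qed (use h in \<open>auto simp: continuous_within\<close>)
  moreover have "\<exists>l. ((\<lambda>t. h (f t) (g t)) \<longlongrightarrow> l) (at_right t)" if "t \<ge> 0" for t
    using f g h that unfolding piecewise_continuous_def by meson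
  moreover have "\<exists>l. ((\<lambda>t. h (f t) (g t)) \<longlongrightarrow> l) (at_left t)" if "t > 0" for t
    using f g h that unfolding piecewise_continuous_def by meson
  ultimately show ?thesis unfolding piecewise_continuous_def by blast
qed

lemma piecewise_continuous_add:
  "piecewise_continuous f \<Longrightarrow> piecewise_continuous g \<Longrightarrow> piecewise_continuous (\<lambda>t. f t + g t)"
  by (erule (1) piecewise_continuous_binop) (rule tendsto_add)

lemma piecewise_continuous_mult:
  "piecewise_continuous f \<Longrightarrow> piecewise_continuous g \<Longrightarrow> piecewise_continuous (\<lambda>t. f t * g t)"
  by (erule (1) piecewise_continuous_binop) (rule tendsto_mult)

lemma piecewise_continuous_continuous_on:
  assumes "continuous_on {0..} f"
  shows "piecewise_continuous f"
proof -
  have c: "continuous (at t within {0..}) f" if "t \<ge> 0" for t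
    using assms that by (simp add: continuous_on_eq_continuous_within)
  then have l: "(f \<longlongrightarrow> f t) (at t within {0..})" if "t \<ge> 0" for t
    using that by (simp add: continuous_within)
  have "(f \<longlongrightarrow> f t) (at_right t)" if "t \<ge> 0" for t
    by (rule tendsto_within_subset[OF l[OF that]]) (use that in auto)
  moreover have "(f \<longlongrightarrow> f t) (at_left t)" if "t > 0" for t
  proof -
    have "at t within {0..} = at t"
      using that by (intro at_within_interior) auto
    then show ?thesis using l[of t] that by (metis filterlim_at_split less_imp_le)
  qed
  ultimately show ?thesis
    unfolding piecewise_continuous_def using c by (auto simp: Collect_conv_if2 intro: finite_subset[of _ "{}"])
qed

lemma piecewise_continuous_const: "piecewise_continuous (\<lambda>t. c)"
  by (intro piecewise_continuous_continuous_on continuous_intros)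

lemma piecewise_continuous_sum:
  "(\<And>i. i \<in> I \<Longrightarrow> piecewise_continuous (f i)) \<Longrightarrow> piecewise_continuous (\<lambda>t. \<Sum>i\<in>I. f i t)"
  by (induction I rule: infinite_finite_induct)
    (auto intro: piecewise_continuous_const piecewise_continuous_add)

lemma filterlim_shift_within:
  fixes t s :: real
  assumes "\<forall>\<^sub>F r in at t within A. r - s \<in> B"
  shows "filterlim (\<lambda>r. r - s) (at (t - s) within B) (at t within A)"
  unfolding filterlim_at
proof
  show "\<forall>\<^sub>F r in at t within A. r - s \<in> B \<and> r - s \<noteq> t - s"
    using assms by (auto simp: eventually_at_filter elim: eventually_mono)
qed (auto intro!: tendsto_intros)

text \<open>Near every point other than \<open>s\<close> the function coincides with
  \<open>f\<close> or with a translate of \<open>g\<close>, so \<open>s\<close> is the only possible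
  new discontinuity.\<close>

lemma piecewise_continuous_concat:
  assumes f: "piecewise_continuous f" and g: "piecewise_continuous g" and s: "s \<ge> 0"
  shows "piecewise_continuous (\<lambda>t. if t < s then f t else g (t - s))"
proof -
  let ?F = "\<lambda>t. if t < s then f t else g (t - s)"
  have ev1: "\<forall>\<^sub>F r in at t within A. r < s" if "t < s" for t A
    using that by (intro order_tendstoD(2)[of _ t]) auto
  have ev2: "\<forall>\<^sub>F r in at t within A. s < r" if "t > s" for t A
    using that by (intro order_tendstoD(1)[of _ t]) auto
  have ev2': "\<forall>\<^sub>F r in at t within A. s \<le> r" if "t > s" for t A
    using ev2[OF that] by (rule eventually_mono) simp
  have lim1: "(?F \<longlongrightarrow> l) (at t within A)" if "(f \<longlongrightarrow> l) (at t within A)" "\<forall>\<^sub>F r in at t within A. r < s" for t l A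
    by (rule Lim_transform_eventually[OF that(1)]) (use that(2) in \<open>auto elim: eventually_mono\<close>)
  have lim2: "(?F \<longlongrightarrow> l) (at t within A)"
    if "(g \<longlongrightarrow> l) (at (t - s) within B)" "\<forall>\<^sub>F r in at t within A. s \<le> r" "\<forall>\<^sub>F r in at t within A. r - s \<in> B" for t l A B
    by (rule Lim_transform_eventually[OF filterlim_compose[OF that(1) filterlim_shift_within[OF that(3)]]])
      (use that(2) in \<open>auto elim: eventually_mono\<close>)
  have "finite {t \<in> {0..b}. \<not> continuous (at t within {0..}) ?F}" for b
  proof (rule finite_subset)
    \<comment> \<open>A discontinuity at \<open>t > s\<close> comes from one of \<open>g\<close> at
      \<open>t - s\<close>, which is still in \<open>{0..b}\<close> because \<open>s\<close> is
      nonnegative.\<close>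
    let ?S = "{t \<in> {0..b}. \<not> continuous (at t within {0..}) f} \<union> {s} \<union>
       (\<lambda>t. t + s) ` {t \<in> {0..b}. \<not> continuous (at t within {0..}) g}"
    show "finite ?S"
      using f g unfolding piecewise_continuous_def by blast
    show "{t \<in> {0..b}. \<not> continuous (at t within {0..}) ?F} \<subseteq> ?S"
    proof
      fix t assume t: "t \<in> {t \<in> {0..b}. \<not> continuous (at t within {0..}) ?F}"
      show "t \<in> ?S"
      proof (rule ccontr)
        assume n: "t \<notin> ?S"
        then have ts: "t \<noteq> s" by simp
        show False
        proof (cases "t < s")
          case True
          then have "(f \<longlongrightarrow> f t) (at t within {0..})" using n t by (auto simp: continuous_within)
          then have "(?F \<longlongrightarrow> f t) (at t within {0..})" by (rule lim1[OF _ ev1[OF True]])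
          then show False using t True by (auto simp: continuous_within)
        next
          case False
          with ts have l: "s < t" by simp
          have "t - s \<notin> {t \<in> {0..b}. \<not> continuous (at t within {0..}) g}"
            using n by (metis (no_types, lifting) UnI2 add.commute add_diff_cancel_left' diff_add_cancel image_eqI)
          then have "(g \<longlongrightarrow> g (t - s)) (at (t - s) within {0..})" using l t s by (auto simp: continuous_within)
          then have "(?F \<longlongrightarrow> g (t - s)) (at t within {0..})"
            by (rule lim2) (use ev2'[OF l] in simp_all)
          then show False using t l by (auto simp: continuous_within)
        qed
      qed
    qed
  qed
  moreover have "\<exists>l. (?F \<longlongrightarrow> l) (at_right t)" if t: "t \<ge> 0" for t
  proof (cases "t < s")
    case True
    obtain l where "(f \<longlongrightarrow> l) (at_right t)" using f t unfolding piecewise_continuous_def by blast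
    then show ?thesis using lim1[OF _ ev1[OF True]] by blast
  next
    case False
    then obtain l where "(g \<longlongrightarrow> l) (at_right (t - s))" using g unfolding piecewise_continuous_def by force
    then have "(?F \<longlongrightarrow> l) (at_right t)"
      by (rule lim2) (use False in \<open>auto simp: eventually_at_filter\<close>)
    then show ?thesis by blast
  qed
  moreover have "\<exists>l. (?F \<longlongrightarrow> l) (at_left t)" if t: "t > 0" for t
  proof (cases "t \<le> s")
    case True
    obtain l where "(f \<longlongrightarrow> l) (at_left t)" using f t unfolding piecewise_continuous_def by blast
    then have "(?F \<longlongrightarrow> l) (at_left t)"
      by (rule lim1) (use True in \<open>auto simp: eventually_at_filter\<close>)
    then show ?thesis by blast
  next
    case False
    then obtain l where "(g \<longlongrightarrow> l) (at_left (t - s))" using g unfolding piecewise_continuous_def by force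
    then have "(?F \<longlongrightarrow> l) (at_left t)"
      by (rule lim2) (use ev2'[of t "{..<t}"] False in \<open>auto simp: eventually_at_filter\<close>)
    then show ?thesis by blast
  qed
  ultimately show ?thesis unfolding piecewise_continuous_def by blast
qed

lemma tendsto_imp_eventually_bounded:
  fixes f :: "'a \<Rightarrow> real"
  assumes "(f \<longlongrightarrow> l) F"
  shows "\<forall>\<^sub>F x in F. \<bar>f x\<bar> \<le> \<bar>l\<bar> + 1"
  using tendstoD[OF assms, of 1] by (auto simp: dist_real_def elim!: eventually_mono)

text \<open>The one-sided limits bound the function near each point, whose own value is added
  separately; bisection (\<open>Bolzano\<close>) glues the local bounds together.\<close>

lemma piecewise_continuous_bounded:
  assumes f: "piecewise_continuous f"
  shows "\<exists>K\<ge>0. \<forall>t\<in>{0..b}. \<bar>f t\<bar> \<le> K"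
proof (cases "0 \<le> b")
  case True
  \<comment> \<open>The guard \<open>0 \<le> t\<close> is there because the small intervals that
    \<open>Bolzano\<close> offers around 0 may reach below 0.\<close>
  define P where "P a b \<longleftrightarrow> (\<exists>K. \<forall>t\<in>{a..b}. 0 \<le> t \<longrightarrow> \<bar>f t\<bar> \<le> K)" for a b
  have "P 0 b"
    using True
  proof (induction rule: Bolzano)
    case (trans a b c)
    then obtain K1 K2 where "\<forall>t\<in>{a..b}. 0 \<le> t \<longrightarrow> \<bar>f t\<bar> \<le> K1" "\<forall>t\<in>{b..c}. 0 \<le> t \<longrightarrow> \<bar>f t\<bar> \<le> K2"
      unfolding P_def by blast
    then have "\<forall>t\<in>{a..c}. 0 \<le> t \<longrightarrow> \<bar>f t\<bar> \<le> max K1 K2"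
      by (metis atLeastAtMost_iff le_cases max.coboundedI1 max.coboundedI2)
    then show ?case unfolding P_def by blast
  next
    case (local x)
    obtain l where l: "(f \<longlongrightarrow> l) (at_right x)"
      using f local unfolding piecewise_continuous_def by blast
    obtain d1 where d1: "d1 > 0" "\<And>y. x < y \<Longrightarrow> y < x + d1 \<Longrightarrow> \<bar>f y\<bar> \<le> \<bar>l\<bar> + 1"
    proof -
      obtain c where "c > x" "\<forall>y>x. y < c \<longrightarrow> \<bar>f y\<bar> \<le> \<bar>l\<bar> + 1"
        using tendsto_imp_eventually_bounded[OF l] by (auto simp: eventually_at_right_field)
      then show ?thesis using that[of "c - x"] by auto
    qed
    obtain m d2 where d2: "d2 > 0" "\<And>y. 0 \<le> y \<Longrightarrow> y < x \<Longrightarrow> x - d2 < y \<Longrightarrow> \<bar>f y\<bar> \<le> m"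
    proof (cases "x = 0")
      case True
      then show ?thesis using that[of 1 0] by auto
    next
      case False
      then obtain m where m: "(f \<longlongrightarrow> m) (at_left x)"
        using f local unfolding piecewise_continuous_def by force
      obtain c where "c < x" "\<forall>y>c. y < x \<longrightarrow> \<bar>f y\<bar> \<le> \<bar>m\<bar> + 1"
        using tendsto_imp_eventually_bounded[OF m] by (auto simp: eventually_at_left_field)
      then show ?thesis using that[of "x - c" "\<bar>m\<bar> + 1"] by auto
    qed
    show ?case
    proof (intro exI[of _ "min d1 d2"] conjI allI impI)
      fix a b assume ab: "a \<le> x \<and> x \<le> b \<and> b - a < min d1 d2"
      have "\<bar>f t\<bar> \<le> max (\<bar>f x\<bar>) (max (\<bar>l\<bar> + 1) m)" if "t \<in> {a..b}" "0 \<le> t" for t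
      proof (cases t x rule: linorder_cases)
        case less
        then have "\<bar>f t\<bar> \<le> m" using d2(2)[of t] that ab by auto
        then show ?thesis by auto
      next
        case greater
        then have "\<bar>f t\<bar> \<le> \<bar>l\<bar> + 1" using d1(2)[of t] that ab by auto
        then show ?thesis by auto
      qed auto
      then show "P a b" unfolding P_def by blast
    qed (use d1 d2 in auto)
  qed
  then obtain K where "\<forall>t\<in>{0..b}. \<bar>f t\<bar> \<le> K" unfolding P_def by auto
  then show ?thesis by (intro exI[of _ "max K 0"]) (auto simp: le_max_iff_disj)
qed auto

lemma piecewise_continuous_bounded_family:
  assumes "finite I" "\<And>i. i \<in> I \<Longrightarrow> piecewise_continuous (f i)"
  shows "\<exists>K\<ge>0. \<forall>i\<in>I. \<forall>t\<in>{0..b}. \<bar>f i t\<bar> \<le> K"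
proof -
  have "\<forall>i\<in>I. \<exists>K\<ge>0. \<forall>t\<in>{0..b}. \<bar>f i t\<bar> \<le> K"
    using assms(2) piecewise_continuous_bounded by blast
  then obtain K where K: "\<And>i. i \<in> I \<Longrightarrow> K i \<ge> 0" "\<And>i t. i \<in> I \<Longrightarrow> t \<in> {0..b} \<Longrightarrow> \<bar>f i t\<bar> \<le> K i"
    by metis
  have "\<bar>f i t\<bar> \<le> sum K I" if "i \<in> I" "t \<in> {0..b}" for i t
    using K(2)[OF that] member_le_sum[OF that(1), of K] K(1) assms(1) by force
  then show ?thesis using K(1) by (intro exI[of _ "sum K I"]) (auto intro: sum_nonneg)
qed

text \<open>Off the finite set of discontinuities the function is continuous, hence measurable, and
  dominated by a constant; the finite set is negligible.\<close>

lemma piecewise_continuous_integrable: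
  assumes f: "piecewise_continuous f"
  shows "f integrable_on {0..b}"
proof -
  let ?D = "{t \<in> {0..b}. \<not> continuous (at t within {0..}) f}"
  have fin: "finite ?D" using f unfolding piecewise_continuous_def by blast
  obtain K where K: "\<forall>t\<in>{0..b}. \<bar>f t\<bar> \<le> K" using piecewise_continuous_bounded[OF f] by blast
  have S: "{0..b} - ?D \<in> lmeasurable"
    by (rule fmeasurable.Diff[OF _ negligible_imp_measurable[OF negligible_finite[OF fin]]]) auto
  have "f integrable_on ({0..b} - ?D)"
  proof (rule measurable_bounded_by_integrable_imp_integrable)
    have "continuous_on ({0..b} - ?D) f"
      unfolding continuous_on_eq_continuous_within
      by (auto intro: continuous_within_subset)
    then show "f \<in> borel_measurable (lebesgue_on ({0..b} - ?D))"
      using S by (intro continuous_imp_measurable_on_sets_lebesgue) auto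
    show "(\<lambda>t. K) integrable_on ({0..b} - ?D)" using S by (rule integrable_on_const)
    show "{0..b} - ?D \<in> sets lebesgue" using S by auto
  qed (use K in auto)
  then show ?thesis
    by (rule integrable_spike_set) (use fin in \<open>auto intro: negligible_subset[OF negligible_finite[OF fin]]\<close>)
qed

section \<open>Linear differential equations with piecewise continuous coefficients\<close>

lemma has_integral_imp_continuous_on:
  fixes F g :: "real \<Rightarrow> real"
  assumes "\<And>t. t \<ge> 0 \<Longrightarrow> (g has_integral (F t - F 0)) {0..t}"
  shows "continuous_on {0..} F"
  unfolding continuous_on_eq_continuous_within
proof
  fix t :: real assume t: "t \<in> {0..}"
  \<comment> \<open>Going up to \<open>t + 1\<close> makes the compact interval a neighbourhood of
    \<open>t\<close> within the half line.\<close>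
  have "continuous_on {0..t + 1} (\<lambda>x. F 0 + integral {0..x} g)"
    using assms[of "t + 1"] t by (intro continuous_intros indefinite_integral_continuous_1) auto
  then have "continuous_on {0..t + 1} F"
    by (rule continuous_on_eq) (simp add: integral_unique[OF assms])
  then have "continuous (at t within {0..t + 1}) F"
    using t by (simp add: continuous_on_eq_continuous_within)
  moreover have "at t within {0..t + 1} = at t within {0..}"
    by (rule at_within_nhd[of _ "{..<t + 1}"]) auto
  ultimately show "continuous (at t within {0..}) F" by simp
qed

text \<open>Integration raises power and factorial together, so iterated integrals of a constant are
  the terms of an exponential series.\<close>

lemma has_integral_monomial:
  assumes "0 \<le> t"
  shows "((\<lambda>s. c * s ^ k / fact k) has_integral (c * t ^ Suc k / fact (Suc k))) {0..t::real}"
proof -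
  have "((\<lambda>s. c * s ^ k / fact k) has_integral (c * t ^ Suc k / fact (Suc k) - c * 0 ^ Suc k / fact (Suc k))) {0..t}"
  proof (rule fundamental_theorem_of_calculus[OF assms])
    fix s
    have "((\<lambda>s. c / fact (Suc k) * s ^ Suc k) has_real_derivative c / fact (Suc k) * (real (Suc k) * s ^ k)) (at s within {0..t})"
      using DERIV_cmult[OF DERIV_pow[of "Suc k" s "{0..t}"], of "c / fact (Suc k)"] by (simp only: diff_Suc_Suc diff_zero)
    moreover have "c / fact (Suc k) * (real (Suc k) * s ^ k) = c * s ^ k / fact k"
      by (simp add: fact_Suc del: of_nat_Suc)
    ultimately show "((\<lambda>s. c * s ^ Suc k / fact (Suc k)) has_vector_derivative c * s ^ k / fact k) (at s within {0..t})"
      by (simp only: has_real_derivative_iff_has_vector_derivative[symmetric] times_divide_eq_left)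
  qed
  then show ?thesis by simp
qed

text \<open>The estimate behind both the convergence of the Picard iteration and uniqueness.\<close>

lemma integral_linear_estimate:
  fixes a :: "nat \<Rightarrow> real \<Rightarrow> real"
  assumes "\<And>j. j < n \<Longrightarrow> piecewise_continuous (a j)" "\<And>j. j < n \<Longrightarrow> piecewise_continuous (y j)"
    and A: "\<And>j s. j < n \<Longrightarrow> s \<in> {0..b} \<Longrightarrow> \<bar>a j s\<bar> \<le> A"
    and y: "\<And>j s. j < n \<Longrightarrow> s \<in> {0..b} \<Longrightarrow> \<bar>y j s\<bar> \<le> M * (n * A) ^ k * s ^ k / fact k"
    and t: "t \<in> {0..b}"
  shows "\<bar>integral {0..t} (\<lambda>s. \<Sum>j<n. a j s * y j s)\<bar> \<le> M * (n * A) ^ Suc k * t ^ Suc k / fact (Suc k)"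
proof -
  let ?g = "\<lambda>s. (M * (n * A) ^ Suc k) * s ^ k / fact k"
  have int: "(?g has_integral (M * (n * A) ^ Suc k * t ^ Suc k / fact (Suc k))) {0..t}"
    using has_integral_monomial t by auto
  have "norm (integral {0..t} (\<lambda>s. \<Sum>j<n. a j s * y j s)) \<le> integral {0..t} ?g"
  proof (rule integral_norm_bound_integral)
    show "(\<lambda>s. \<Sum>j<n. a j s * y j s) integrable_on {0..t}"
      using assms(1,2) by (intro piecewise_continuous_integrable piecewise_continuous_sum piecewise_continuous_mult) auto
    show "?g integrable_on {0..t}" using int by blast
    fix s assume s: "s \<in> {0..t}"
    then have sb: "s \<in> {0..b}" using t by auto
    have "\<bar>a j s * y j s\<bar> \<le> A * (M * (n * A) ^ k * s ^ k / fact k)" if "j < n" for j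
      unfolding abs_mult using A[OF that sb] y[OF that sb] by (intro mult_mono) auto
    then have "\<bar>\<Sum>j<n. a j s * y j s\<bar> \<le> (\<Sum>j<n. A * (M * (n * A) ^ k * s ^ k / fact k))"
      by (intro order_trans[OF sum_abs] sum_mono) auto
    also have "\<dots> = ?g s" by simp
    finally show "norm (\<Sum>j<n. a j s * y j s) \<le> ?g s" by simp
  qed
  then show ?thesis unfolding integral_unique[OF int] by (simp only: real_norm_def)
qed

text \<open>Feeding a bound on \<open>{0..t}\<close> back into the integral equation again and again
  yields the terms of an exponential series, which tend to 0. This takes the place of a Gronwall
  inequality.\<close>

lemma linear_ode_unique:
  fixes z :: "nat \<Rightarrow> real \<Rightarrow> real"
  assumes a: "\<And>i j. i < n \<Longrightarrow> j < n \<Longrightarrow> piecewise_continuous (a i j)"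
    and z: "\<And>i t. i < n \<Longrightarrow> t \<ge> 0 \<Longrightarrow> ((\<lambda>s. \<Sum>j<n. a i j s * z j s) has_integral (z i t)) {0..t}"
    and "i < n" "t \<ge> 0"
  shows "z i t = 0"
proof -
  have z0: "z i 0 = 0" if "i < n" for i
    using integral_unique[OF z[OF that, of 0]] by simp
  have pc: "piecewise_continuous (z i)" if "i < n" for i
  proof (intro piecewise_continuous_continuous_on has_integral_imp_continuous_on)
    show "((\<lambda>s. \<Sum>j<n. a i j s * z j s) has_integral (z i t - z i 0)) {0..t}" if "t \<ge> 0" for t
      using z[OF \<open>i < n\<close> that] z0[OF \<open>i < n\<close>] by simp
  qed
  obtain A where A: "A \<ge> 0" "\<And>i j s. i < n \<Longrightarrow> j < n \<Longrightarrow> s \<in> {0..t} \<Longrightarrow> \<bar>a i j s\<bar> \<le> A"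
    using piecewise_continuous_bounded_family[of "{..<n} \<times> {..<n}" "\<lambda>(i, j). a i j" t] a by auto
  obtain M where M: "M \<ge> 0" "\<And>i s. i < n \<Longrightarrow> s \<in> {0..t} \<Longrightarrow> \<bar>z i s\<bar> \<le> M"
    using piecewise_continuous_bounded_family[of "{..<n}" z t] pc by auto
  have est: "\<forall>i<n. \<forall>s\<in>{0..t}. \<bar>z i s\<bar> \<le> M * (n * A) ^ k * s ^ k / fact k" for k
  proof (induction k)
    case 0
    then show ?case using M by simp
  next
    case (Suc k)
    show ?case
    proof (intro allI impI ballI)
      fix i s assume i: "i < n" and s: "s \<in> {0..t}"
      have "\<bar>integral {0..s} (\<lambda>s. \<Sum>j<n. a i j s * z j s)\<bar> \<le> M * (n * A) ^ Suc k * s ^ Suc k / fact (Suc k)"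
        by (rule integral_linear_estimate[where b = t]) (use a pc A Suc i s in auto)
      moreover have "integral {0..s} (\<lambda>s. \<Sum>j<n. a i j s * z j s) = z i s"
        using z[OF i, of s] s by (simp add: integral_unique)
      ultimately show "\<bar>z i s\<bar> \<le> M * (n * A) ^ Suc k * s ^ Suc k / fact (Suc k)" by simp
    qed
  qed
  have "(\<lambda>k. M * (inverse (fact k) * (n * A * t) ^ k)) \<longlonglongrightarrow> M * 0"
    by (intro tendsto_intros summable_LIMSEQ_zero summable_exp)
  moreover have "\<bar>z i t\<bar> \<le> M * (inverse (fact k) * (n * A * t) ^ k)" for k
    using est[rule_format, of i t k] assms(3,4) by (simp add: power_mult_distrib field_simps)
  ultimately have "\<bar>z i t\<bar> \<le> M * 0"
    by (intro LIMSEQ_le_const) auto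
  then show ?thesis by simp
qed

text \<open>Picard iteration from the constant initial value. On each \<open>{0..b}\<close> the
  successive differences are dominated by an exponential series; this gives pointwise limits and
  bounds uniform in the iteration count, and dominated convergence takes the limit inside the
  integral.\<close>

lemma linear_ode_exists:
  fixes x0 :: "nat \<Rightarrow> real"
  assumes a: "\<And>i j. i < n \<Longrightarrow> j < n \<Longrightarrow> piecewise_continuous (a i j)"
    and f: "\<And>i. i < n \<Longrightarrow> piecewise_continuous (f i)"
  shows "\<exists>x. \<forall>i<n. x i 0 = x0 i \<and>
    (\<forall>t\<ge>0. ((\<lambda>s. (\<Sum>j<n. a i j s * x j s) + f i s) has_integral (x i t - x0 i)) {0..t})"
proof -
  define rhs where "rhs y i s = (\<Sum>j<n. a i j s * y j s) + f i s" for y :: "nat \<Rightarrow> real \<Rightarrow> real" and i s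
  define X where "X = rec_nat (\<lambda>i t. x0 i) (\<lambda>_ y i t. x0 i + integral {0..t} (rhs y i))"
  have X0: "X 0 = (\<lambda>i t. x0 i)" and XS: "\<And>k. X (Suc k) = (\<lambda>i t. x0 i + integral {0..t} (rhs (X k) i))"
    by (simp_all add: X_def)
  have rhs_pc: "piecewise_continuous (rhs y i)" if "i < n" "\<And>j. j < n \<Longrightarrow> piecewise_continuous (y j)" for y i
    unfolding rhs_def using that a f
    by (intro piecewise_continuous_add piecewise_continuous_sum piecewise_continuous_mult) auto
  have X_pc: "\<forall>i<n. piecewise_continuous (X k i)" for k
  proof (induction k)
    case 0
    then show ?case by (simp add: X0 piecewise_continuous_const)
  next
    case (Suc k)
    show ?case
    proof (intro allI impI piecewise_continuous_continuous_on has_integral_imp_continuous_on)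
      fix i and t :: real assume "i < n" "t \<ge> 0"
      then show "(rhs (X k) i has_integral (X (Suc k) i t - X (Suc k) i 0)) {0..t}"
        using rhs_pc[of i "X k"] Suc by (auto simp: XS intro!: integrable_integral piecewise_continuous_integrable)
    qed
  qed
  have int: "rhs (X k) i integrable_on {0..t}" if "i < n" for k i t
    using rhs_pc X_pc that by (intro piecewise_continuous_integrable) auto
  have local: "\<exists>(A::real) (M::real). A \<ge> 0 \<and> M \<ge> 0 \<and> (\<forall>k. \<forall>i<n. \<forall>t\<in>{0..b::real}. \<bar>X (Suc k) i t - X k i t\<bar> \<le> M * (n * A) ^ k * t ^ k / fact k)" for b :: real
  proof -
    obtain A where A: "A \<ge> 0" "\<And>i j s. i < n \<Longrightarrow> j < n \<Longrightarrow> s \<in> {0..b} \<Longrightarrow> \<bar>a i j s\<bar> \<le> A"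
      using piecewise_continuous_bounded_family[of "{..<n} \<times> {..<n}" "\<lambda>(i, j). a i j" b] a by auto
    have pcd: "piecewise_continuous (\<lambda>t. X (Suc k) i t - X k i t)" if "i < n" for k i
      using piecewise_continuous_add[OF _ piecewise_continuous_mult[OF piecewise_continuous_const[of "-1"]]] X_pc[of k] X_pc[of "Suc k"] that
      by fastforce
    obtain M where M: "M \<ge> 0" "\<And>i s. i < n \<Longrightarrow> s \<in> {0..b} \<Longrightarrow> \<bar>X (Suc 0) i s - X 0 i s\<bar> \<le> M"
      using piecewise_continuous_bounded_family[of "{..<n}" "\<lambda>i t. X (Suc 0) i t - X 0 i t" b] pcd by auto
    have le: "\<forall>i<n. \<forall>t\<in>{0..b}. \<bar>X (Suc k) i t - X k i t\<bar> \<le> M * (n * A) ^ k * t ^ k / fact k" for k :: nat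
    proof (induction k)
      case 0
      then show ?case using M by simp
    next
      case (Suc k)
      show ?case
      proof (intro allI impI ballI)
        fix i and t :: real assume i: "i < n" and t: "t \<in> {0..b}"
        have "X (Suc (Suc k)) i t - X (Suc k) i t = integral {0..t} (\<lambda>s. rhs (X (Suc k)) i s - rhs (X k) i s)"
          unfolding XS[of "Suc k"] XS[of k] using integral_diff[OF int[OF i, of "Suc k"] int[OF i, of k]] by (simp add: XS)
        also have "\<dots> = integral {0..t} (\<lambda>s. \<Sum>j<n. a i j s * (X (Suc k) j s - X k j s))"
          by (simp add: rhs_def right_diff_distrib sum_subtractf)
        also have "\<bar>\<dots>\<bar> \<le> M * (n * A) ^ Suc k * t ^ Suc k / fact (Suc k)"
          by (rule integral_linear_estimate[where b = b]) (use a pcd A Suc i t in auto)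
        finally show "\<bar>X (Suc (Suc k)) i t - X (Suc k) i t\<bar> \<le> M * (n * A) ^ Suc k * t ^ Suc k / fact (Suc k)" .
      qed
    qed
    show ?thesis
      by (rule exI[of _ A], rule exI[of _ M], intro conjI A(1) M(1)) (rule allI, rule le)
  qed
  have local2: "\<exists>K. \<forall>i<n. \<forall>t\<in>{0..b}. convergent (\<lambda>k. X k i t) \<and> (\<forall>k. \<bar>X k i t\<bar> \<le> \<bar>x0 i\<bar> + K)" for b :: real
  proof -
    obtain A :: real and M :: real where AM: "A \<ge> 0" "M \<ge> 0"
      and le: "\<forall>k. \<forall>i<n. \<forall>t\<in>{0..b}. \<bar>X (Suc k) i t - X k i t\<bar> \<le> M * (n * A) ^ k * t ^ k / fact k"
      using local[of b] by (elim exE conjE) (rule that)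
    \<comment> \<open>Replacing \<open>t\<close> by \<open>b\<close> makes the majorant independent
      of \<open>t\<close>; up to the factor \<open>M\<close> it is an exponential series.\<close>
    let ?c = "\<lambda>k. M * (inverse (fact k) * (n * A * b) ^ k)"
    have sc: "summable ?c" by (intro summable_mult summable_exp)
    have "convergent (\<lambda>k. X k i t) \<and> (\<forall>k. \<bar>X k i t\<bar> \<le> \<bar>x0 i\<bar> + (\<Sum>k. ?c k))" if i: "i < n" and t: "t \<in> {0..b}" for i and t :: real
    proof -
      have le': "\<bar>X (Suc k) i t - X k i t\<bar> \<le> ?c k" for k
      proof -
        have "M * (n * A) ^ k * t ^ k / fact k \<le> M * (n * A) ^ k * b ^ k / fact k"
          using t AM by (intro divide_right_mono mult_left_mono power_mono) auto
        with le[rule_format, OF i t, of k] show ?thesis by (simp add: power_mult_distrib field_simps)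
      qed
      have tele: "(\<Sum>j<k. X (Suc j) i t - X j i t) = X k i t - x0 i" for k
        using sum_lessThan_telescope[of "\<lambda>k. X k i t" k] by (simp add: X0)
      have "summable (\<lambda>k. X (Suc k) i t - X k i t)"
        by (rule summable_comparison_test'[OF sc]) (use le' in auto)
      then have "convergent (\<lambda>k. X k i t - x0 i)"
        by (simp add: summable_iff_convergent tele)
      then have "convergent (\<lambda>k. X k i t)"
        using convergent_add_const_right_iff[of "\<lambda>k. X k i t" "- x0 i"] by simp
      moreover have "\<bar>X k i t\<bar> \<le> \<bar>x0 i\<bar> + (\<Sum>k. ?c k)" for k
      proof -
        have "\<bar>X k i t - x0 i\<bar> \<le> (\<Sum>j<k. ?c j)"
          unfolding tele[symmetric] by (rule order_trans[OF sum_abs sum_mono[OF le']])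
        also have "\<dots> \<le> (\<Sum>k. ?c k)"
          using AM t by (intro sum_le_suminf sc) auto
        finally show ?thesis by linarith
      qed
      ultimately show ?thesis by blast
    qed
    then show ?thesis by blast
  qed
  define x where "x i t = lim (\<lambda>k. X k i t)" for i and t :: real
  have lim: "(\<lambda>k. X k i t) \<longlonglongrightarrow> x i t" if "i < n" "t \<ge> 0" for i t
    using local2[of t] that unfolding x_def by (auto simp: convergent_LIMSEQ_iff)
  have "x i 0 = x0 i" if "i < n" for i
  proof -
    have "X k i 0 = x0 i" for k by (cases k) (simp_all add: X0 XS)
    then show ?thesis using LIMSEQ_unique[OF lim[OF that, of 0], of "x0 i"] by simp
  qed
  moreover have "(rhs x i has_integral (x i t - x0 i)) {0..t}" if i: "i < n" and t: "t \<ge> 0" for i t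
  proof -
    obtain K where K: "\<And>i s k. i < n \<Longrightarrow> s \<in> {0..t} \<Longrightarrow> \<bar>X k i s\<bar> \<le> \<bar>x0 i\<bar> + K"
      using local2[of t] by blast
    obtain A where A: "A \<ge> 0" "\<And>j s. j < n \<Longrightarrow> s \<in> {0..t} \<Longrightarrow> \<bar>a i j s\<bar> \<le> A"
      using piecewise_continuous_bounded_family[of "{..<n}" "a i" t] a i by auto
    obtain F where F: "\<And>s. s \<in> {0..t} \<Longrightarrow> \<bar>f i s\<bar> \<le> F"
      using piecewise_continuous_bounded[OF f[OF i], of t] by blast
    \<comment> \<open>The right-hand side does not depend on \<open>k\<close>, as dominated
      convergence requires.\<close>
    have bound: "norm (rhs (X k) i s) \<le> (\<Sum>j<n. A * (\<bar>x0 j\<bar> + K)) + F" if s: "s \<in> {0..t}" for k s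
    proof -
      have "\<bar>a i j s * X k j s\<bar> \<le> A * (\<bar>x0 j\<bar> + K)" if "j < n" for j
        unfolding abs_mult using A(1) A(2)[OF that s] K[OF that s] by (intro mult_mono) auto
      then have "\<bar>\<Sum>j<n. a i j s * X k j s\<bar> \<le> (\<Sum>j<n. A * (\<bar>x0 j\<bar> + K))"
        by (intro order_trans[OF sum_abs] sum_mono) auto
      then show ?thesis using F[OF s] by (simp add: rhs_def)
    qed
    have ptw: "(\<lambda>k. rhs (X k) i s) \<longlonglongrightarrow> rhs x i s" if "s \<in> {0..t}" for s
      unfolding rhs_def using lim that by (intro tendsto_intros) auto
    have dom: "rhs x i integrable_on {0..t}" "(\<lambda>k. integral {0..t} (rhs (X k) i)) \<longlonglongrightarrow> integral {0..t} (rhs x i)"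
      using dominated_convergence[where f = "\<lambda>k. rhs (X k) i", OF int[OF i] integrable_const_ivl bound, where g = "rhs x i"] ptw by auto
    have "(\<lambda>k. X (Suc k) i t - x0 i) \<longlonglongrightarrow> x i t - x0 i"
      using lim[OF i t] by (intro tendsto_intros LIMSEQ_Suc)
    then have "integral {0..t} (rhs x i) = x i t - x0 i"
      using LIMSEQ_unique[OF dom(2)] by (simp add: XS)
    then show ?thesis using dom(1) by (metis integrable_integral)
  qed
  ultimately show ?thesis unfolding rhs_def by blast
qed

section \<open>Evolution in continuous and discrete time\<close>

definition evolves :: "time_kind \<Rightarrow> (real \<Rightarrow> real) \<Rightarrow> (real \<Rightarrow> real) \<Rightarrow> bool" where
  "evolves k f g \<longleftrightarrow>
     (case k of CT \<Rightarrow> \<forall>t\<ge>0. (g has_integral (f t - f 0)) {0..t} | DT \<Rightarrow> \<forall>t\<in>\<nat>. f (t + 1) = g t)"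

lemma time_axis_simps: "time_axis CT = {0..}" "time_axis DT = \<nat>"
  by (simp_all add: time_axis_def)

lemma time_axis_nonneg: "t \<in> time_axis k \<Longrightarrow> 0 \<le> t"
  by (cases k) (auto simp: time_axis_simps elim: Nats_cases)

lemma time_axis_zero [simp]: "0 \<in> time_axis k"
  by (cases k) (auto simp: time_axis_simps)

lemma time_axis_add: "s \<in> time_axis k \<Longrightarrow> t \<in> time_axis k \<Longrightarrow> s + t \<in> time_axis k"
  by (cases k) (auto simp: time_axis_simps)

lemma time_axis_diff: "s \<in> time_axis k \<Longrightarrow> t \<in> time_axis k \<Longrightarrow> s \<le> t \<Longrightarrow> t - s \<in> time_axis k"
proof (cases k)
  case DT
  assume "s \<in> time_axis k" "t \<in> time_axis k" "s \<le> t"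
  with DT obtain m n where "s = real m" "t = real n" by (auto simp: time_axis_simps elim!: Nats_cases)
  with \<open>s \<le> t\<close> have "t - s = real (n - m)" by (simp add: of_nat_diff)
  then show ?thesis using DT by (simp add: time_axis_simps)
qed (auto simp: time_axis_simps)

lemma evolves_cong:
  assumes "\<And>t. t \<in> time_axis k \<Longrightarrow> f t = f' t" "\<And>t. t \<in> time_axis k \<Longrightarrow> g t = g' t"
  shows "evolves k f g \<longleftrightarrow> evolves k f' g'"
proof (cases k)
  case CT
  have "(g has_integral (f t - f 0)) {0..t} \<longleftrightarrow> (g' has_integral (f' t - f' 0)) {0..t}" if "t \<ge> 0" for t
  proof -
    have "f t = f' t" "f 0 = f' 0" using assms(1) that CT by (auto simp: time_axis_simps)
    moreover have "(g has_integral I) {0..t} \<longleftrightarrow> (g' has_integral I) {0..t}" for I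
      using assms(2) CT by (intro has_integral_cong) (auto simp: time_axis_simps)
    ultimately show ?thesis by simp
  qed
  then show ?thesis using CT by (simp add: evolves_def)
next
  case DT
  then show ?thesis using assms by (simp add: evolves_def time_axis_simps)
qed

lemma evolves_0: "evolves k (\<lambda>t. 0) (\<lambda>t. 0)"
  by (cases k) (auto simp: evolves_def)

lemma evolves_add: "evolves k f g \<Longrightarrow> evolves k f' g' \<Longrightarrow> evolves k (\<lambda>t. f t + f' t) (\<lambda>t. g t + g' t)"
  by (cases k) (auto simp: evolves_def add_diff_add intro!: has_integral_add)

lemma evolves_cmult: "evolves k f g \<Longrightarrow> evolves k (\<lambda>t. c * f t) (\<lambda>t. c * g t)"
  by (cases k) (auto simp: evolves_def right_diff_distrib[symmetric] intro!: has_integral_mult_right)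

lemma evolves_sum:
  "(\<And>i. i \<in> I \<Longrightarrow> evolves k (f i) (g i)) \<Longrightarrow> evolves k (\<lambda>t. \<Sum>i\<in>I. f i t) (\<lambda>t. \<Sum>i\<in>I. g i t)"
  by (induction I rule: infinite_finite_induct) (auto intro: evolves_0 evolves_add)

text \<open>The matching value at the junction ties the second run to the first: in continuous time
  it cancels in the sum of the two integrals, in discrete time it covers the step that arrives at
  \<open>s\<close>.\<close>

lemma evolves_concat:
  assumes s: "s \<in> time_axis k" and 1: "evolves k f1 g1" and 2: "evolves k f2 g2" and eq: "f2 0 = f1 s"
  shows "evolves k (\<lambda>t. if t < s then f1 t else f2 (t - s)) (\<lambda>t. if t < s then g1 t else g2 (t - s))"
    (is "evolves k ?f ?g")
proof (cases k)
  case CT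
  have s0: "s \<ge> 0" using s by (rule time_axis_nonneg)
  have i1: "(?g has_integral (f1 t - f1 0)) {0..t}" if "0 \<le> t" "t \<le> s" for t
  \<comment> \<open>At \<open>s\<close> itself the concatenation already takes the value of
    \<open>g2\<close>; a single point does not affect the integral.\<close>
  proof (rule has_integral_spike_finite[of "{s}"])
    show "(g1 has_integral (f1 t - f1 0)) {0..t}" using 1 CT that by (simp add: evolves_def)
  qed (use that in auto)
  have i2: "(?g has_integral (f2 (t - s) - f2 0)) {s..t}" if "s \<le> t" for t
  proof -
    have "(g2 has_integral (f2 (t - s) - f2 0)) {0..t - s}" using 2 CT that by (simp add: evolves_def)
    then have "((\<lambda>x. g2 (x - s)) has_integral (f2 (t - s) - f2 0)) {s..t}"
      using has_integral_affinity'[of g2 "f2 (t - s) - f2 0" 0 "t - s" 1 "- s"] by simp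
    then show ?thesis by (rule has_integral_eq[rotated]) simp
  qed
  have "(?g has_integral (?f t - ?f 0)) {0..t}" if t: "0 \<le> t" for t
  proof (cases "t < s")
    case True
    then show ?thesis using i1[of t] t eq s0 by auto
  next
    case False
    then have "(?g has_integral ((f1 s - f1 0) + (f2 (t - s) - f2 0))) {0..t}"
      by (intro has_integral_combine[OF s0 _ i1[OF s0 order_refl] i2]) auto
    moreover have "?f 0 = f1 0" using eq s0 by (cases "s = 0") auto
    ultimately show ?thesis using False eq by simp
  qed
  then show ?thesis using CT by (simp add: evolves_def)
next
  case DT
  have "?f (t + 1) = ?g t" if t: "t \<in> \<nat>" for t
  proof (cases "t < s")
    case True
    obtain m n where "s = real m" "t = real n" using s t DT by (auto simp: time_axis_simps elim!: Nats_cases)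
    with True have "n + 1 \<le> m" by simp
    then have "real (n + 1) \<le> real m" by (simp only: of_nat_le_iff)
    \<comment> \<open>Times are integers here: after \<open>t < s\<close> the next time is either
      still before the junction or the junction itself, where \<open>f2 0 = f1 s\<close>
      applies.\<close>
    then have "t + 1 < s \<or> t + 1 = s" using \<open>s = real m\<close> \<open>t = real n\<close> by auto
    then show ?thesis using True 1 DT t eq by (auto simp: evolves_def)
  next
    case False
    then have "t - s \<in> \<nat>" using time_axis_diff[of s DT t] s t DT by (simp add: time_axis_simps)
    then have "f2 (t - s + 1) = g2 (t - s)" using 2 DT by (simp add: evolves_def)
    then show ?thesis using False by (simp add: algebra_simps)
  qed
  then show ?thesis using DT by (simp add: evolves_def)
qed

text \<open>The integral of a continuous \<open>g\<close> has the one-sided derivative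
  \<open>g 0\<close> at 0; as the integral is constantly zero, so is this derivative.\<close>

lemma evolves_CT_tangent:
  assumes "evolves CT f g" "continuous_on {0..} g" "\<And>t. t \<ge> 0 \<Longrightarrow> f t = 0"
  shows "g 0 = 0"
proof -
  have "((\<lambda>t. integral {0..t} g) has_real_derivative g 0) (at 0 within {0..1})"
    by (rule integral_has_real_derivative) (auto intro: continuous_on_subset[OF assms(2)])
  moreover have z: "integral {0..t} g = 0" if "t \<ge> 0" for t
  proof -
    have "(g has_integral (f t - f 0)) {0..t}" using assms(1) that by (simp add: evolves_def)
    then show ?thesis using assms(3) that by (simp add: integral_unique)
  qed
  ultimately have "((\<lambda>t. 0) has_real_derivative g 0) (at 0 within {0..1})"
    by (elim has_field_derivative_transform_within[of _ _ _ _ 1]) auto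
  moreover have "((\<lambda>t. 0) has_real_derivative 0) (at 0 within {0..1})" by (rule DERIV_const)
  moreover have "at (0::real) within {0..1} \<noteq> bot" by (simp add: at_within_Icc_at_right)
  ultimately show ?thesis using has_field_derivative_unique by blast
qed

text \<open>A quantity that stays zero along a run has zero velocity at the start. This is how
  algebraic facts about the coefficients are drawn from trajectories; in discrete time the step to
  time 1 suffices.\<close>

lemma evolves_tangent:
  assumes "evolves k f g" "k = CT \<Longrightarrow> continuous_on {0..} g" "\<And>t. t \<in> time_axis k \<Longrightarrow> f t = 0"
  shows "g 0 = 0"
proof (cases k)
  case CT
  then show ?thesis using assms evolves_CT_tangent by (simp add: time_axis_simps)
next
  case DT
  then have "\<forall>t\<in>\<nat>. f (t + 1) = g t" using assms(1) by (simp add: evolves_def)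
  then have "f (0 + 1) = g 0" using Nats_0 by (rule bspec)
  moreover have "f (0 + 1) = 0" using assms(3)[of "0 + 1"] DT by (simp add: time_axis_simps)
  ultimately show ?thesis by simp
qed

lemma evolves_CT_continuous_on: "evolves CT f g \<Longrightarrow> continuous_on {0..} f"
  by (rule has_integral_imp_continuous_on[of g]) (simp add: evolves_def)

text \<open>A piecewise continuous right-hand side is bounded on compact intervals, which makes
  \<open>f\<close> Lipschitz there.\<close>

lemma evolves_CT_absolutely_continuous:
  assumes ev: "evolves CT f g" and g: "piecewise_continuous g"
  shows "absolutely_continuous_upto b f"
proof -
  obtain K where K: "K \<ge> 0" "\<And>t. t \<in> {0..b} \<Longrightarrow> \<bar>g t\<bar> \<le> K"
    using piecewise_continuous_bounded[OF g] by blast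
  have lip: "\<bar>f r - f l\<bar> \<le> K * (r - l)" if "0 \<le> l" "l \<le> r" "r \<le> b" for l r
  proof -
    have "integral {0..l} g + integral {l..r} g = integral {0..r} g"
      using that piecewise_continuous_integrable[OF g] by (intro Henstock_Kurzweil_Integration.integral_combine) auto
    moreover have "integral {0..t} g = f t - f 0" if "t \<ge> 0" for t
      using ev that by (intro integral_unique) (simp add: evolves_def)
    ultimately have "f r - f l = integral {l..r} g" using that by simp
    moreover have "g integrable_on {l..r}"
      by (rule integrable_on_subinterval[OF piecewise_continuous_integrable[OF g, of r]]) (use that in auto)
    then have "norm (integral {l..r} g) \<le> integral {l..r} (\<lambda>_. K)"
      by (rule integral_norm_bound_integral) (use K that in auto)
    ultimately show ?thesis using that by (simp add: mult.commute)
  qed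
  show ?thesis
    unfolding absolutely_continuous_upto_def
  proof (intro allI impI)
    fix e :: real assume e: "e > 0"
    show "\<exists>\<delta>>0. \<forall>(N::nat) l r.
        (\<forall>j<N. 0 \<le> l j \<and> l j \<le> r j \<and> r j \<le> b) \<longrightarrow>
        disjoint_family_on (\<lambda>j. {l j<..<r j}) {..<N} \<longrightarrow>
        (\<Sum>j<N. r j - l j) < \<delta> \<longrightarrow> (\<Sum>j<N. \<bar>f (r j) - f (l j)\<bar>) < e"
    \<comment> \<open>The denominator \<open>K + 1\<close> instead of the Lipschitz constant
      \<open>K\<close> avoids a division by zero.\<close>
    proof (intro exI[of _ "e / (K + 1)"] conjI allI impI)
      fix N :: nat and l r :: "nat \<Rightarrow> real"
      assume lr: "\<forall>j<N. 0 \<le> l j \<and> l j \<le> r j \<and> r j \<le> b" and lt: "(\<Sum>j<N. r j - l j) < e / (K + 1)"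
      have "(\<Sum>j<N. \<bar>f (r j) - f (l j)\<bar>) \<le> (\<Sum>j<N. K * (r j - l j))"
        using lip lr by (intro sum_mono) auto
      also have "\<dots> \<le> (K + 1) * (\<Sum>j<N. r j - l j)"
        unfolding sum_distrib_left[symmetric] using lr K by (intro mult_right_mono sum_nonneg) auto
      also have "\<dots> < e" using lt K by (simp add: field_simps)
      finally show "(\<Sum>j<N. \<bar>f (r j) - f (l j)\<bar>) < e" .
    qed (use e K in auto)
  qed
qed

text \<open>At a continuity point of \<open>g\<close> its integral is differentiable. The remaining
  points form a countable union of finite sets, hence a null set.\<close>

lemma evolves_CT_derivative:
  assumes ev: "evolves CT f g" and g: "piecewise_continuous g"
  shows "AE t in lebesgue. t \<in> {0..} \<longrightarrow> (f has_real_derivative g t) (at t within {0..})"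
proof (rule AE_I)
  let ?N = "\<Union>b::nat. {t \<in> {0..real b}. \<not> continuous (at t within {0..}) g}"
  have "finite {t \<in> {0..real b}. \<not> continuous (at t within {0..}) g}" for b
    using g unfolding piecewise_continuous_def by blast
  then have "countable ?N"
    by (intro countable_UN[OF countableI_type] countable_finite)
  then have "?N \<in> null_sets lebesgue"
    by (intro null_sets_completionI countable_imp_null_set_lborel)
  then show "emeasure lebesgue ?N = 0" "?N \<in> sets lebesgue" by auto
  show "{t \<in> space lebesgue. \<not> (t \<in> {0..} \<longrightarrow> (f has_real_derivative g t) (at t within {0..}))} \<subseteq> ?N"
  proof (intro subsetI, rule ccontr)
    fix t assume t: "t \<in> {t \<in> space lebesgue. \<not> (t \<in> {0..} \<longrightarrow> (f has_real_derivative g t) (at t within {0..}))}" "t \<notin> ?N"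
    then have t0: "t \<ge> 0" and nd: "\<not> (f has_real_derivative g t) (at t within {0..})" by auto
    have at: "at t within {0..t + 1} = at t within {0..}"
      by (rule at_within_nhd[of _ "{..<t + 1}"]) auto
    have "t \<in> {0..real (nat \<lceil>t\<rceil>)}" using t0 by (simp add: real_nat_ceiling_ge)
    with t(2) have "continuous (at t within {0..}) g" by blast
    then have "((\<lambda>u. integral {0..u} g) has_vector_derivative g t) (at t within {0..t + 1})"
      using integral_has_vector_derivative_continuous_at[of g 0 "t + 1" t "{}"] piecewise_continuous_integrable[OF g] t0 at
      by simp
    then have "((\<lambda>u. f 0 + integral {0..u} g) has_real_derivative g t) (at t within {0..})"
      unfolding at by (auto simp: has_real_derivative_iff_has_vector_derivative intro!: derivative_eq_intros)
    moreover have "f 0 + integral {0..u} g = f u" if "u \<in> {0..}" for u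
    proof -
      have "integral {0..u} g = f u - f 0" using ev that by (intro integral_unique) (simp add: evolves_def)
      then show ?thesis by simp
    qed
    ultimately have "(f has_real_derivative g t) (at t within {0..})"
      using t0 by (auto intro: has_field_derivative_transform_within[of _ _ _ _ 1])
    with nd show False by simp
  qed
qed

section \<open>Subspaces and projections\<close>

lemma vec_eqI: "x \<in> carrier_vec n \<Longrightarrow> y \<in> carrier_vec n \<Longrightarrow> (\<And>i. i < n \<Longrightarrow> x $ i = y $ i) \<Longrightarrow> x = y"
  by (intro eq_vecI) auto

lemma mult_mat_vec_index:
  assumes "A \<in> carrier_mat r c" "x \<in> carrier_vec c" "i < r"
  shows "(A *\<^sub>v x) $ i = (\<Sum>j<c. A $$ (i, j) * x $ j)"
  using assms by (auto simp: scalar_prod_def atLeast0LessThan intro!: sum.cong)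

lemma mult_mat_index:
  assumes "A \<in> carrier_mat r k" "B \<in> carrier_mat k c" "i < r" "j < c"
  shows "(A * B) $$ (i, j) = (\<Sum>l<k. A $$ (i, l) * B $$ (l, j))"
  using assms by (auto simp: scalar_prod_def atLeast0LessThan intro!: sum.cong)

lemma mult_mat_zero_vec: "A \<in> carrier_mat r c \<Longrightarrow> A *\<^sub>v 0\<^sub>v c = (0\<^sub>v r :: real vec)"
  by (intro vec_eqI[of _ r]) (auto simp: mult_mat_vec_index[OF _ zero_carrier_vec] simp del: index_mult_mat_vec intro!: mult_mat_vec_carrier)

lemma mat_eq_if_mult_vec_eq:
  assumes A: "(A :: real mat) \<in> carrier_mat r c" and B: "B \<in> carrier_mat r c"
    and eq: "\<And>x. x \<in> carrier_vec c \<Longrightarrow> A *\<^sub>v x = B *\<^sub>v x"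
  shows "A = B"
proof (rule eq_matI)
  fix i j assume "i < dim_row B" "j < dim_col B"
  then have i: "i < r" and j: "j < c" using B by auto
  have "M $$ (i, j) = (M *\<^sub>v unit_vec c j) $ i" if "M \<in> carrier_mat r c" for M :: "real mat"
    using mult_mat_vec_index[OF that unit_vec_carrier i] j
    by (simp add: unit_vec_def if_distrib[of "\<lambda>x. _ * x"] cong: if_cong)
  then show "A $$ (i, j) = B $$ (i, j)" using A B eq[of "unit_vec c j"] by simp
qed (use A B in auto)

lemma inj_square_mat_inverse:
  assumes Y: "(Y :: real mat) \<in> carrier_mat n n"
    and inj: "\<And>x. x \<in> carrier_vec n \<Longrightarrow> Y *\<^sub>v x = 0\<^sub>v n \<Longrightarrow> x = 0\<^sub>v n"
  shows "\<exists>Z\<in>carrier_mat n n. Y * Z = 1\<^sub>m n \<and> Z * Y = 1\<^sub>m n"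
proof -
  have "det Y \<noteq> 0" using inj by (auto simp: det_0_iff_vec_prod_zero_field[OF Y])
  then have "Y \<in> Units (ring_mat TYPE(real) n ())" by (rule det_non_zero_imp_unit[OF Y])
  then show ?thesis by (auto simp: Units_def ring_mat_def)
qed

text \<open>With fewer rows than columns, padding by zero rows would give an injective square
  matrix, hence an invertible one; but a zero row stays zero in every product.\<close>

lemma inj_mat_dim_le:
  assumes Y: "(Y :: real mat) \<in> carrier_mat r c"
    and inj: "\<And>x. x \<in> carrier_vec c \<Longrightarrow> Y *\<^sub>v x = 0\<^sub>v r \<Longrightarrow> x = 0\<^sub>v c"
  shows "c \<le> r"
proof (rule ccontr)
  assume "\<not> c \<le> r"
  then have rc: "r < c" by simp
  define Y' where "Y' = mat c c (\<lambda>(i, j). if i < r then Y $$ (i, j) else 0)"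
  have Y': "Y' \<in> carrier_mat c c" by (simp add: Y'_def)
  have "x = 0\<^sub>v c" if x: "x \<in> carrier_vec c" "Y' *\<^sub>v x = 0\<^sub>v c" for x
  proof (rule inj[OF x(1)])
    show "Y *\<^sub>v x = 0\<^sub>v r"
    proof (rule vec_eqI)
      fix i assume i: "i < r"
      then have ic: "i < c" using rc by simp
      have "(Y *\<^sub>v x) $ i = (Y' *\<^sub>v x) $ i"
        using i ic by (simp only: mult_mat_vec_index[OF Y x(1) i] mult_mat_vec_index[OF Y' x(1) ic]) (simp add: Y'_def)
      then show "(Y *\<^sub>v x) $ i = 0\<^sub>v r $ i" using x(2) i ic by simp
    qed (use Y x in auto)
  qed
  then obtain Z where Z: "Z \<in> carrier_mat c c" "Y' * Z = 1\<^sub>m c"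
    using inj_square_mat_inverse[OF Y'] by blast
  \<comment> \<open>Row \<open>r\<close> is the first padded row, so the diagonal entry of the
    product is 0 there and not 1.\<close>
  have "(Y' * Z) $$ (r, r) = 0"
    using rc by (simp only: mult_mat_index[OF Y' Z(1) rc rc]) (simp add: Y'_def)
  then show False using Z(2) rc by simp
qed

definition lin_subspace :: "nat \<Rightarrow> real vec set \<Rightarrow> bool" where
  "lin_subspace n W \<longleftrightarrow> W \<subseteq> carrier_vec n \<and> 0\<^sub>v n \<in> W \<and>
     (\<forall>v\<in>W. \<forall>w\<in>W. v + w \<in> W) \<and> (\<forall>c. \<forall>v\<in>W. c \<cdot>\<^sub>v v \<in> W)"

text \<open>As \<open>F\<close> is a left inverse of \<open>E\<close>, the product
  \<open>E F\<close> projects onto an \<open>m\<close>-dimensional subspace inside \<open>W\<close>,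
  possibly smaller than \<open>W\<close>. Such matrix pairs take the place of bases.\<close>

definition partial_projection :: "nat \<Rightarrow> real vec set \<Rightarrow> nat \<Rightarrow> real mat \<Rightarrow> real mat \<Rightarrow> bool" where
  "partial_projection n W m E F \<longleftrightarrow> E \<in> carrier_mat n m \<and> F \<in> carrier_mat m n \<and> F * E = 1\<^sub>m m \<and>
     (\<forall>v\<in>carrier_vec m. E *\<^sub>v v \<in> W)"

lemma partial_projection_dim_le:
  assumes "partial_projection n W m E F"
  shows "m \<le> n"
proof (rule inj_mat_dim_le[of E])
  show "E \<in> carrier_mat n m" using assms by (simp add: partial_projection_def)
  fix x assume x: "x \<in> carrier_vec m" "E *\<^sub>v x = 0\<^sub>v n"
  have EF: "E \<in> carrier_mat n m" "F \<in> carrier_mat m n" "F * E = 1\<^sub>m m"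
    using assms by (auto simp: partial_projection_def)
  have "x = (F * E) *\<^sub>v x" using x(1) EF(3) by simp
  also have "\<dots> = F *\<^sub>v (E *\<^sub>v x)" by (rule assoc_mult_mat_vec[OF EF(2,1) x(1)])
  also have "\<dots> = 0\<^sub>v m" unfolding x(2) by (rule mult_mat_zero_vec[OF EF(2)])
  finally show "x = 0\<^sub>v m" .
qed

text \<open>If the projection \<open>E F\<close> misses some \<open>w \<in> W\<close>, then \<open>r = w - E F w\<close> and the functional
  dual to \<open>r\<close> on the kernel of the transposed projection add one more dimension.\<close>

lemma partial_projection_extend:
  assumes W: "lin_subspace n W" and P: "partial_projection n W m E F"
    and w: "w \<in> W" "E *\<^sub>v (F *\<^sub>v w) \<noteq> w"
  shows "\<exists>E' F'. partial_projection n W (Suc m) E' F'"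
proof -
  have E: "E \<in> carrier_mat n m" and F: "F \<in> carrier_mat m n" and FE: "F * E = 1\<^sub>m m"
    and EW: "\<And>v. v \<in> carrier_vec m \<Longrightarrow> E *\<^sub>v v \<in> W"
    using P by (auto simp: partial_projection_def)
  have wc: "w \<in> carrier_vec n" using w W by (auto simp: lin_subspace_def)
  have Fw: "F *\<^sub>v w \<in> carrier_vec m" using F wc by simp
  have EFw: "E *\<^sub>v (F *\<^sub>v w) \<in> carrier_vec n" using E Fw by simp
  define r where "r = w - E *\<^sub>v (F *\<^sub>v w)"
  have rc: "r \<in> carrier_vec n" unfolding r_def by (rule minus_carrier_vec[OF wc EFw])
  have r0: "r \<noteq> 0\<^sub>v n"
  proof
    assume "r = 0\<^sub>v n"
    then have "(w - E *\<^sub>v (F *\<^sub>v w)) $ i = 0" if "i < n" for i using that by (simp add: r_def)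
    then have "E *\<^sub>v (F *\<^sub>v w) = w" using EFw wc E by (intro vec_eqI[of _ n]) auto
    with w(2) show False by simp
  qed
  have rW: "r \<in> W"
  proof -
    have "r = w + (-1) \<cdot>\<^sub>v (E *\<^sub>v (F *\<^sub>v w))"
      unfolding r_def using wc EFw E by (intro vec_eqI[of _ n]) auto
    then show ?thesis using W w EW[OF Fw] by (simp add: lin_subspace_def)
  qed
  have FEx: "F *\<^sub>v (E *\<^sub>v x) = x" if "x \<in> carrier_vec m" for x
    using assoc_mult_mat_vec[OF F E that] FE that by simp
  have Fr: "F *\<^sub>v r = 0\<^sub>v m"
    unfolding r_def using mult_minus_distrib_mat_vec[OF F wc EFw] FEx[OF Fw] Fw by simp
  define N where "N = (\<Sum>k<n. r $ k * r $ k)"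
  have N: "N \<noteq> 0"
  proof
    assume "N = 0"
    then have "\<forall>k\<in>{..<n}. r $ k * r $ k = 0"
      unfolding N_def by (subst (asm) sum_nonneg_eq_0_iff) auto
    then have "r = 0\<^sub>v n" using rc by (intro vec_eqI[of _ n]) auto
    with r0 show False by simp
  qed
  \<comment> \<open>In matrix form \<open>f\<close> is the row r^T (1 - E F) divided by the squared
    length of \<open>r\<close>. It vanishes on the range of \<open>E\<close> because (1 - E F) E =
    0, and equals 1 at \<open>r\<close> because F r = 0.\<close>
  define f where "f k = (r $ k - (\<Sum>i<n. r $ i * (E * F) $$ (i, k))) / N" for k
  have EF: "E * F \<in> carrier_mat n n" using E F by simp
  have fy: "(\<Sum>k<n. f k * y $ k) = (\<Sum>k<n. r $ k * (y $ k - (E *\<^sub>v (F *\<^sub>v y)) $ k)) / N" if y: "y \<in> carrier_vec n" for y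
  proof -
    have "(\<Sum>k<n. (\<Sum>i<n. r $ i * (E * F) $$ (i, k)) * y $ k) = (\<Sum>i<n. \<Sum>k<n. r $ i * ((E * F) $$ (i, k) * y $ k))"
      by (subst sum.swap) (simp add: sum_distrib_right mult.assoc)
    also have "\<dots> = (\<Sum>i<n. r $ i * (E *\<^sub>v (F *\<^sub>v y)) $ i)"
    proof (rule sum.cong)
      fix i assume "i \<in> {..<n}"
      then have i: "i < n" by simp
      have "(E *\<^sub>v (F *\<^sub>v y)) $ i = (\<Sum>k<n. (E * F) $$ (i, k) * y $ k)"
        using mult_mat_vec_index[OF EF y i] assoc_mult_mat_vec[OF E F y] by simp
      then show "(\<Sum>k<n. r $ i * ((E * F) $$ (i, k) * y $ k)) = r $ i * (E *\<^sub>v (F *\<^sub>v y)) $ i"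
        by (simp add: sum_distrib_left)
    qed simp
    finally have "(\<Sum>k<n. (\<Sum>i<n. r $ i * (E * F) $$ (i, k)) * y $ k) = \<dots>" .
    then show ?thesis
      unfolding f_def by (simp add: sum_divide_distrib[symmetric] left_diff_distrib right_diff_distrib sum_subtractf)
  qed
  have fr: "(\<Sum>k<n. f k * r $ k) = 1"
  proof -
    have "E *\<^sub>v (F *\<^sub>v r) = 0\<^sub>v n" unfolding Fr by (rule mult_mat_zero_vec[OF E])
    then show ?thesis using fy[OF rc] N by (simp add: N_def)
  qed
  have fE: "(\<Sum>k<n. f k * (E *\<^sub>v x) $ k) = 0" if x: "x \<in> carrier_vec m" for x
  proof -
    have "E *\<^sub>v x \<in> carrier_vec n" using E x by simp
    from fy[OF this] show ?thesis by (simp add: FEx[OF x])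
  qed
  define E' where "E' = mat n (Suc m) (\<lambda>(i, j). if j < m then E $$ (i, j) else r $ i)"
  define F' where "F' = mat (Suc m) n (\<lambda>(i, j). if i < m then F $$ (i, j) else f j)"
  have E': "E' \<in> carrier_mat n (Suc m)" and F': "F' \<in> carrier_mat (Suc m) n" by (simp_all add: E'_def F'_def)
  have "F' * E' = 1\<^sub>m (Suc m)"
  proof (rule eq_matI)
    fix i j assume "i < dim_row (1\<^sub>m (Suc m))" "j < dim_col (1\<^sub>m (Suc m))"
    then have i: "i < Suc m" and j: "j < Suc m" by auto
    have E'c: "E' $$ (k, j) = (if j < m then E $$ (k, j) else r $ k)" if "k < n" for k
      using that j by (simp add: E'_def)
    have F'c: "F' $$ (i, k) = (if i < m then F $$ (i, k) else f k)" if "k < n" for k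
      using that i by (simp add: F'_def)
    have Ecol: "E $$ (k, j) = (E *\<^sub>v unit_vec m j) $ k" if "k < n" "j < m" for k
      using mult_mat_vec_index[OF E unit_vec_carrier that(1), of j] that(2)
      by (simp add: unit_vec_def if_distrib[of "\<lambda>x. _ * x"] cong: if_cong)
    have "(F' * E') $$ (i, j) = (\<Sum>k<n. (if i < m then F $$ (i, k) else f k) * (if j < m then E $$ (k, j) else r $ k))"
      unfolding mult_mat_index[OF F' E' i j] using E'c F'c by (intro sum.cong) auto
    also have "\<dots> = (if i = j then 1 else 0)"
    proof (cases "i < m"; cases "j < m")
      assume ij: "i < m" "j < m"
      then show ?thesis using mult_mat_index[OF F E ij] FE by simp
    next
      assume ij: "i < m" "\<not> j < m"
      then show ?thesis using mult_mat_vec_index[OF F rc ij(1)] Fr i j by simp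
    next
      assume ij: "\<not> i < m" "j < m"
      then show ?thesis using fE[of "unit_vec m j"] Ecol[OF _ ij(2)] i j by simp
    next
      assume ij: "\<not> i < m" "\<not> j < m"
      then show ?thesis using fr i j by simp
    qed
    finally show "(F' * E') $$ (i, j) = 1\<^sub>m (Suc m) $$ (i, j)" using i j by simp
  qed (use E' F' in auto)
  moreover have "E' *\<^sub>v v \<in> W" if v: "v \<in> carrier_vec (Suc m)" for v
  proof -
    define v1 where "v1 = vec m (\<lambda>j. v $ j)"
    have v1: "v1 \<in> carrier_vec m" by (simp add: v1_def)
    have "E' *\<^sub>v v = E *\<^sub>v v1 + v $ m \<cdot>\<^sub>v r"
    proof (rule vec_eqI[OF mult_mat_vec_carrier[OF E' v]
          add_carrier_vec[OF mult_mat_vec_carrier[OF E v1] smult_carrier_vec[THEN iffD2, OF rc]]])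
      fix i assume i: "i < n"
      have "(E' *\<^sub>v v) $ i = (\<Sum>j<m. E $$ (i, j) * v1 $ j) + r $ i * v $ m"
        unfolding mult_mat_vec_index[OF E' v i] using i by (simp add: E'_def v1_def)
      also have "\<dots> = (E *\<^sub>v v1) $ i + r $ i * v $ m" by (simp only: mult_mat_vec_index[OF E v1 i])
      finally show "(E' *\<^sub>v v) $ i = (E *\<^sub>v v1 + v $ m \<cdot>\<^sub>v r) $ i" using i carrier_vecD[OF rc] by (simp add: mult.commute del: index_mult_mat_vec)
    qed
    then show ?thesis using W EW[OF v1] rW by (simp add: lin_subspace_def)
  qed
  ultimately show ?thesis
    by (intro exI[of _ E'] exI[of _ F']) (simp add: partial_projection_def E' F')
qed

text \<open>A pair with the largest possible \<open>m\<close> reproduces every vector of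
  \<open>W\<close>, since otherwise it could be extended. If that \<open>m\<close> were
  \<open>n\<close>, the left inverse would be two-sided and \<open>W\<close> the whole
  space.\<close>

lemma subspace_projection:
  assumes W: "lin_subspace n W"
  obtains m E F where "E \<in> carrier_mat n m" "F \<in> carrier_mat m n" "F * E = 1\<^sub>m m"
    "\<And>v. v \<in> carrier_vec m \<Longrightarrow> E *\<^sub>v v \<in> W" "\<And>w. w \<in> W \<Longrightarrow> E *\<^sub>v (F *\<^sub>v w) = w"
    "W \<noteq> carrier_vec n \<Longrightarrow> m < n"
proof -
  let ?Q = "\<lambda>m. \<exists>E F. partial_projection n W m E F"
  \<comment> \<open>Empty matrices start the search for a maximal \<open>m\<close>; injectivity of
    \<open>E\<close> bounds it by \<open>n\<close>.\<close>
  have "?Q 0"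
  proof (intro exI)
    have "0\<^sub>m n 0 *\<^sub>v v = 0\<^sub>v n" if "v \<in> carrier_vec 0" for v :: "real vec"
      by (rule vec_eqI[OF mult_mat_vec_carrier[OF zero_carrier_mat that] zero_carrier_vec])
        (use that in \<open>auto simp: scalar_prod_def\<close>)
    then show "partial_projection n W 0 (0\<^sub>m n 0) (0\<^sub>m 0 n)"
      using W by (auto simp: partial_projection_def lin_subspace_def)
  qed
  moreover have bound: "m \<le> n" if "?Q m" for m
    using that by (elim exE) (rule partial_projection_dim_le)
  ultimately have greatest: "?Q (Greatest ?Q)" by (rule GreatestI_nat[of ?Q 0 n])
  define m where "m = Greatest ?Q"
  have max: "k \<le> m" if "?Q k" for k
    unfolding m_def by (rule Greatest_le_nat[of ?Q k n, OF that bound])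
  from greatest[folded m_def] obtain E F where P: "partial_projection n W m E F" by blast
  have E: "E \<in> carrier_mat n m" and F: "F \<in> carrier_mat m n" and FE: "F * E = 1\<^sub>m m"
    and EW: "\<And>v. v \<in> carrier_vec m \<Longrightarrow> E *\<^sub>v v \<in> W"
    using P by (auto simp: partial_projection_def)
  have id: "E *\<^sub>v (F *\<^sub>v w) = w" if "w \<in> W" for w
  proof (rule ccontr)
    assume "E *\<^sub>v (F *\<^sub>v w) \<noteq> w"
    then have "?Q (Suc m)" by (rule partial_projection_extend[OF W P that])
    then show False using max[of "Suc m"] by simp
  qed
  have "m < n" if "W \<noteq> carrier_vec n"
  proof (rule ccontr)
    assume "\<not> m < n"
    then have mn: "m = n" using partial_projection_dim_le[OF P] by simp
    have "E * F = 1\<^sub>m n"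
      using mat_mult_left_right_inverse[of F n E] E F FE mn by auto
    then have "v \<in> W" if "v \<in> carrier_vec n" for v
      using EW[of "F *\<^sub>v v"] assoc_mult_mat_vec[OF E F that] F that by simp
    with that W show False by (auto simp: lin_subspace_def)
  qed
  with E F FE EW id show thesis by (rule that)
qed

text \<open>If \<open>E F\<close> projects onto \<open>N\<close>, the complementary projection
  \<open>P\<close> has kernel \<open>N\<close>. Factoring \<open>P = R Q\<close> through its image
  gives the quotient map \<open>Q\<close> and a choice \<open>R\<close> of representatives.\<close>

lemma subspace_quotient:
  assumes N: "lin_subspace n N"
  obtains m Q R where "Q \<in> carrier_mat m n" "R \<in> carrier_mat n m"
    "\<And>x. x \<in> N \<Longrightarrow> Q *\<^sub>v x = 0\<^sub>v m" "\<And>x. x \<in> carrier_vec n \<Longrightarrow> R *\<^sub>v (Q *\<^sub>v x) - x \<in> N"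
    "N \<noteq> {0\<^sub>v n} \<Longrightarrow> m < n"
proof -
  obtain k E F where E: "E \<in> carrier_mat n k" and F: "F \<in> carrier_mat k n"
    and EN: "\<And>v. v \<in> carrier_vec k \<Longrightarrow> E *\<^sub>v v \<in> N" and id: "\<And>w. w \<in> N \<Longrightarrow> E *\<^sub>v (F *\<^sub>v w) = w"
    using subspace_projection[OF N] by metis
  define P where "P = 1\<^sub>m n - E * F"
  have P: "P \<in> carrier_mat n n"
    unfolding P_def by (rule minus_carrier_mat[OF mult_carrier_mat[OF E F]])
  have Px: "P *\<^sub>v x = x - E *\<^sub>v (F *\<^sub>v x)" if "x \<in> carrier_vec n" for x
    using that E F by (simp add: P_def minus_mult_distrib_mat_vec[of _ n n] assoc_mult_mat_vec[OF E F])
  have Nc: "N \<subseteq> carrier_vec n" using N by (simp add: lin_subspace_def)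
  have PN: "P *\<^sub>v x = 0\<^sub>v n" if "x \<in> N" for x
    using Px[of x] id[OF that] that Nc by auto
  have PP: "P *\<^sub>v (P *\<^sub>v x) = P *\<^sub>v x" if x: "x \<in> carrier_vec n" for x
  proof -
    have e: "E *\<^sub>v (F *\<^sub>v x) \<in> carrier_vec n" using E F x by simp
    have "E *\<^sub>v (F *\<^sub>v x) \<in> N" using F x by (intro EN) simp
    then have z: "P *\<^sub>v (E *\<^sub>v (F *\<^sub>v x)) = 0\<^sub>v n" by (rule PN)
    have "P *\<^sub>v (P *\<^sub>v x) = P *\<^sub>v (x - E *\<^sub>v (F *\<^sub>v x))" by (simp only: Px[OF x])
    also have "\<dots> = P *\<^sub>v x - 0\<^sub>v n"
      unfolding mult_minus_distrib_mat_vec[OF P x e] z ..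
    also have "\<dots> = P *\<^sub>v x"
      by (rule minus_zero_vec) (rule mult_mat_vec_carrier[OF P x])
    finally show ?thesis .
  qed
  define W where "W = (*\<^sub>v) P ` carrier_vec n"
  have W: "lin_subspace n W"
    unfolding lin_subspace_def
  proof (intro conjI ballI allI)
    show "W \<subseteq> carrier_vec n" using P by (auto simp: W_def)
    show "0\<^sub>v n \<in> W" unfolding W_def by (rule image_eqI[of _ _ "0\<^sub>v n"]) (use P in auto)
    show "v + w \<in> W" if vw: "v \<in> W" "w \<in> W" for v w
    proof -
      obtain x y where "v = P *\<^sub>v x" "w = P *\<^sub>v y" "x \<in> carrier_vec n" "y \<in> carrier_vec n"
        using vw by (auto simp: W_def)
      then show ?thesis
        using mult_add_distrib_mat_vec[OF P, of x y] by (auto simp: W_def intro!: image_eqI[of _ _ "x + y"])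
    qed
    show "c \<cdot>\<^sub>v v \<in> W" if v: "v \<in> W" for c v
    proof -
      obtain x where "v = P *\<^sub>v x" "x \<in> carrier_vec n" using v by (auto simp: W_def)
      then show ?thesis
        using mult_mat_vec[OF P, of x c] by (auto simp: W_def intro!: image_eqI[of _ _ "c \<cdot>\<^sub>v x"])
    qed
  qed
  obtain m R L where R: "R \<in> carrier_mat n m" and L: "L \<in> carrier_mat m n"
    and idW: "\<And>w. w \<in> W \<Longrightarrow> R *\<^sub>v (L *\<^sub>v w) = w"
    and mn: "W \<noteq> carrier_vec n \<Longrightarrow> m < n"
    using subspace_projection[OF W] by metis
  have LP: "L * P \<in> carrier_mat m n" using L P by simp
  show thesis
  proof (rule that[OF LP R])
    show "(L * P) *\<^sub>v x = 0\<^sub>v m" if "x \<in> N" for x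
      using assoc_mult_mat_vec[OF L P subsetD[OF Nc that]] PN[OF that] mult_mat_zero_vec[OF L] by simp
    show "R *\<^sub>v ((L * P) *\<^sub>v x) - x \<in> N" if x: "x \<in> carrier_vec n" for x
    proof -
      have "(L * P) *\<^sub>v x = L *\<^sub>v (P *\<^sub>v x)" by (rule assoc_mult_mat_vec[OF L P x])
      moreover have "P *\<^sub>v x \<in> W" using x by (simp add: W_def)
      ultimately have "R *\<^sub>v ((L * P) *\<^sub>v x) = x - E *\<^sub>v (F *\<^sub>v x)" using idW Px[OF x] by simp
      moreover have e: "E *\<^sub>v (F *\<^sub>v x) \<in> N" using F x by (intro EN) simp
      then have "x - E *\<^sub>v (F *\<^sub>v x) - x = (-1) \<cdot>\<^sub>v (E *\<^sub>v (F *\<^sub>v x))"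
        using x Nc E by (intro vec_eqI[of _ n]) auto
      ultimately show ?thesis using N e by (simp add: lin_subspace_def)
    qed
    \<comment> \<open>If the image of \<open>P\<close> were everything, idempotence would make
      \<open>P\<close> the identity, although it kills a nonzero vector of \<open>N\<close>.\<close>
    show "m < n" if nz: "N \<noteq> {0\<^sub>v n}"
    proof (rule mn)
      obtain x where x: "x \<in> N" "x \<noteq> 0\<^sub>v n" using nz N by (auto simp: lin_subspace_def)
      show "W \<noteq> carrier_vec n"
      proof
        assume "W = carrier_vec n"
        then obtain y where "x = P *\<^sub>v y" "y \<in> carrier_vec n" using x Nc by (auto simp: W_def)
        then have "P *\<^sub>v x = x" using PP by simp
        with PN[OF x(1)] x(2) show False by simp
      qed
    qed
  qed
qed

section \<open>State trajectories\<close>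

lemma affine_mat_carrier:
  "M 0 \<in> carrier_mat r c \<Longrightarrow> affine_mat n M q \<in> carrier_mat r c"
  by (auto simp: affine_mat_def)

lemma affine_mat_index:
  "M 0 \<in> carrier_mat r c \<Longrightarrow> i < r \<Longrightarrow> j < c \<Longrightarrow>
    affine_mat n M q $$ (i, j) = M 0 $$ (i, j) + (\<Sum>l=1..n. M l $$ (i, j) * q $ (l - 1))"
  by (auto simp: affine_mat_def)

definition vec_evolves :: "time_kind \<Rightarrow> nat \<Rightarrow> (real \<Rightarrow> real vec) \<Rightarrow> (real \<Rightarrow> real vec) \<Rightarrow> bool" where
  "vec_evolves k n x g \<longleftrightarrow> (\<forall>i<n. evolves k (\<lambda>t. x t $ i) (\<lambda>t. g t $ i))"

lemma vec_evolves_cong: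
  assumes "\<And>t. t \<in> time_axis k \<Longrightarrow> x t = x' t" "\<And>t. t \<in> time_axis k \<Longrightarrow> g t = g' t"
  shows "vec_evolves k n x g \<longleftrightarrow> vec_evolves k n x' g'"
proof -
  have "evolves k (\<lambda>t. x t $ i) (\<lambda>t. g t $ i) \<longleftrightarrow> evolves k (\<lambda>t. x' t $ i) (\<lambda>t. g' t $ i)" for i
    by (rule evolves_cong) (simp_all add: assms)
  then show ?thesis by (simp add: vec_evolves_def)
qed

lemma vec_evolves_add:
  assumes "vec_evolves k n x g" "vec_evolves k n x' g'"
    "\<And>t. t \<in> time_axis k \<Longrightarrow> x' t \<in> carrier_vec n" "\<And>t. t \<in> time_axis k \<Longrightarrow> g' t \<in> carrier_vec n"
  shows "vec_evolves k n (\<lambda>t. x t + x' t) (\<lambda>t. g t + g' t)"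
  unfolding vec_evolves_def
proof (intro allI impI)
  fix i assume i: "i < n"
  have "evolves k (\<lambda>t. x t $ i + x' t $ i) (\<lambda>t. g t $ i + g' t $ i)"
    using assms(1,2) i by (intro evolves_add) (auto simp: vec_evolves_def)
  moreover have "x t $ i + x' t $ i = (x t + x' t) $ i" "g t $ i + g' t $ i = (g t + g' t) $ i"
    if "t \<in> time_axis k" for t
    using carrier_vecD[OF assms(3)[OF that]] carrier_vecD[OF assms(4)[OF that]] i by simp_all
  ultimately show "evolves k (\<lambda>t. (x t + x' t) $ i) (\<lambda>t. (g t + g' t) $ i)"
    using evolves_cong[of k "\<lambda>t. x t $ i + x' t $ i" "\<lambda>t. (x t + x' t) $ i"
        "\<lambda>t. g t $ i + g' t $ i" "\<lambda>t. (g t + g' t) $ i"] by blast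
qed

lemma vec_evolves_mult:
  assumes ev: "vec_evolves k n x g" and M: "M \<in> carrier_mat m n"
    and c: "\<And>t. t \<in> time_axis k \<Longrightarrow> x t \<in> carrier_vec n" "\<And>t. t \<in> time_axis k \<Longrightarrow> g t \<in> carrier_vec n"
  shows "vec_evolves k m (\<lambda>t. M *\<^sub>v x t) (\<lambda>t. M *\<^sub>v g t)"
  unfolding vec_evolves_def
proof (intro allI impI)
  fix i assume i: "i < m"
  have "evolves k (\<lambda>t. \<Sum>j<n. M $$ (i, j) * x t $ j) (\<lambda>t. \<Sum>j<n. M $$ (i, j) * g t $ j)"
    using ev by (intro evolves_sum evolves_cmult) (auto simp: vec_evolves_def)
  moreover have "(\<Sum>j<n. M $$ (i, j) * x t $ j) = (M *\<^sub>v x t) $ i" "(\<Sum>j<n. M $$ (i, j) * g t $ j) = (M *\<^sub>v g t) $ i"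
    if "t \<in> time_axis k" for t
    by (rule mult_mat_vec_index[OF M c(1)[OF that] i, symmetric], rule mult_mat_vec_index[OF M c(2)[OF that] i, symmetric])
  ultimately show "evolves k (\<lambda>t. (M *\<^sub>v x t) $ i) (\<lambda>t. (M *\<^sub>v g t) $ i)"
    using evolves_cong[of k "\<lambda>t. \<Sum>j<n. M $$ (i, j) * x t $ j" "\<lambda>t. (M *\<^sub>v x t) $ i"
        "\<lambda>t. \<Sum>j<n. M $$ (i, j) * g t $ j" "\<lambda>t. (M *\<^sub>v g t) $ i"] by blast
qed

lemma vec_evolves_concat:
  assumes "s \<in> time_axis k" "vec_evolves k n x1 g1" "vec_evolves k n x2 g2" "x2 0 = x1 s"
  shows "vec_evolves k n (\<lambda>t. if t < s then x1 t else x2 (t - s)) (\<lambda>t. if t < s then g1 t else g2 (t - s))"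
  unfolding vec_evolves_def
proof (intro allI impI)
  fix i assume "i < n"
  then have "evolves k (\<lambda>t. if t < s then x1 t $ i else x2 (t - s) $ i) (\<lambda>t. if t < s then g1 t $ i else g2 (t - s) $ i)"
    using assms by (intro evolves_concat) (auto simp: vec_evolves_def)
  then show "evolves k (\<lambda>t. (if t < s then x1 t else x2 (t - s)) $ i) (\<lambda>t. (if t < s then g1 t else g2 (t - s)) $ i)"
    by (simp add: if_distrib[of "\<lambda>v. v $ i"])
qed

locale lpv =
  fixes S :: lpv_setting
  assumes sched_carrier: "sched S \<subseteq> carrier_vec (n_p S)"
begin

abbreviation "T \<equiv> time_axis (time S)"
abbreviation "Amat \<Sigma> \<equiv> affine_mat (n_p S) (mat_A \<Sigma>)"
abbreviation "Bmat \<Sigma> \<equiv> affine_mat (n_p S) (mat_B \<Sigma>)"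
abbreviation "Cmat \<Sigma> \<equiv> affine_mat (n_p S) (mat_C \<Sigma>)"

lemma system_carrier:
  assumes "is_lpv_ssa S \<Sigma>"
  shows "Amat \<Sigma> q \<in> carrier_mat (dim_x \<Sigma>) (dim_x \<Sigma>)"
    "Bmat \<Sigma> q \<in> carrier_mat (dim_x \<Sigma>) (n_u S)"
    "Cmat \<Sigma> q \<in> carrier_mat (n_y S) (dim_x \<Sigma>)"
proof -
  have "mat_A \<Sigma> 0 \<in> carrier_mat (dim_x \<Sigma>) (dim_x \<Sigma>)" "mat_B \<Sigma> 0 \<in> carrier_mat (dim_x \<Sigma>) (n_u S)"
    "mat_C \<Sigma> 0 \<in> carrier_mat (n_y S) (dim_x \<Sigma>)"
    using assms by (simp_all add: is_lpv_ssa_def)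
  then show "Amat \<Sigma> q \<in> carrier_mat (dim_x \<Sigma>) (dim_x \<Sigma>)" "Bmat \<Sigma> q \<in> carrier_mat (dim_x \<Sigma>) (n_u S)"
    "Cmat \<Sigma> q \<in> carrier_mat (n_y S) (dim_x \<Sigma>)"
    by (simp_all only: affine_mat_carrier)
qed

lemma input_carrier: "u \<in> inputs S \<Longrightarrow> t \<in> T \<Longrightarrow> u t \<in> carrier_vec (n_u S)"
  by (auto simp: inputs_def signals_def)

lemma scheduling_sched: "p \<in> schedulings S \<Longrightarrow> t \<in> T \<Longrightarrow> p t \<in> sched S"
  by (auto simp: schedulings_def signals_def)

lemma state_rhs_carrier:
  assumes "is_lpv_ssa S \<Sigma>" "x \<in> carrier_vec (dim_x \<Sigma>)" "u \<in> carrier_vec (n_u S)"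
  shows "state_rhs S \<Sigma> q x u \<in> carrier_vec (dim_x \<Sigma>)"
  unfolding state_rhs_def
  by (rule add_carrier_vec[OF mult_mat_vec_carrier[OF system_carrier(1)[OF assms(1)] assms(2)]
        mult_mat_vec_carrier[OF system_carrier(2)[OF assms(1)] assms(3)]])

lemma state_rhs_index:
  assumes "is_lpv_ssa S \<Sigma>" "x \<in> carrier_vec (dim_x \<Sigma>)" "u \<in> carrier_vec (n_u S)" "i < dim_x \<Sigma>"
  shows "state_rhs S \<Sigma> q x u $ i =
    (\<Sum>j<dim_x \<Sigma>. Amat \<Sigma> q $$ (i, j) * x $ j) + (\<Sum>j<n_u S. Bmat \<Sigma> q $$ (i, j) * u $ j)"
proof -
  note c = system_carrier[OF assms(1), of q]
  have "dim_vec (Bmat \<Sigma> q *\<^sub>v u) = dim_x \<Sigma>"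
    using mult_mat_vec_carrier[OF c(2) assms(3)] by (rule carrier_vecD)
  with assms(4) have "state_rhs S \<Sigma> q x u $ i = (Amat \<Sigma> q *\<^sub>v x) $ i + (Bmat \<Sigma> q *\<^sub>v u) $ i"
    unfolding state_rhs_def by (intro index_add_vec(1)) simp
  then show ?thesis
    by (simp only: mult_mat_vec_index[OF c(1) assms(2,4)] mult_mat_vec_index[OF c(2) assms(3,4)])
qed

lemma scheduling_piecewise_continuous:
  assumes "time S = CT" "p \<in> schedulings S" "M 0 \<in> carrier_mat r c" "i < r" "j < c"
  shows "piecewise_continuous (\<lambda>t. affine_mat (n_p S) M (p t) $$ (i, j))"
  unfolding affine_mat_index[where M = M, OF assms(3-5)]
  using assms(1,2)
  by (intro piecewise_continuous_add piecewise_continuous_sum piecewise_continuous_mult piecewise_continuous_const)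
    (auto simp: schedulings_def signals_def)

lemma system_piecewise_continuous:
  assumes "time S = CT" "p \<in> schedulings S" "is_lpv_ssa S \<Sigma>" "i < dim_x \<Sigma>"
  shows "j < dim_x \<Sigma> \<Longrightarrow> piecewise_continuous (\<lambda>t. Amat \<Sigma> (p t) $$ (i, j))"
    "j < n_u S \<Longrightarrow> piecewise_continuous (\<lambda>t. Bmat \<Sigma> (p t) $$ (i, j))"
proof -
  have "mat_A \<Sigma> 0 \<in> carrier_mat (dim_x \<Sigma>) (dim_x \<Sigma>)" "mat_B \<Sigma> 0 \<in> carrier_mat (dim_x \<Sigma>) (n_u S)"
    using assms(3) by (auto simp: is_lpv_ssa_def)
  note c = this
  show "piecewise_continuous (\<lambda>t. Amat \<Sigma> (p t) $$ (i, j))" if "j < dim_x \<Sigma>"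
    by (rule scheduling_piecewise_continuous[where M = "mat_A \<Sigma>", OF assms(1,2) c(1) assms(4) that])
  show "piecewise_continuous (\<lambda>t. Bmat \<Sigma> (p t) $$ (i, j))" if "j < n_u S"
    by (rule scheduling_piecewise_continuous[where M = "mat_B \<Sigma>", OF assms(1,2) c(2) assms(4) that])
qed

lemma input_piecewise_continuous:
  "time S = CT \<Longrightarrow> u \<in> inputs S \<Longrightarrow> j < n_u S \<Longrightarrow> piecewise_continuous (\<lambda>t. u t $ j)"
  by (auto simp: inputs_def signals_def)

text \<open>One direction is the integral formula for absolutely continuous functions, component by
  component. For the other, the integral equation first makes the state continuous, then the
  right-hand side piecewise continuous, and this returns absolute continuity and the derivative off
  a null set.\<close>

lemma is_state_trajectory_iff:
  assumes \<Sigma>: "is_lpv_ssa S \<Sigma>" and u: "u \<in> inputs S" and p: "p \<in> schedulings S"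
  shows "is_state_trajectory S \<Sigma> x0 u p x \<longleftrightarrow>
    x \<in> T \<rightarrow>\<^sub>E carrier_vec (dim_x \<Sigma>) \<and> x 0 = x0 \<and>
    vec_evolves (time S) (dim_x \<Sigma>) x (\<lambda>t. state_rhs S \<Sigma> (p t) (x t) (u t))"
proof (cases "x \<in> T \<rightarrow>\<^sub>E carrier_vec (dim_x \<Sigma>) \<and> x 0 = x0")
  case True
  then have xc: "x t \<in> carrier_vec (dim_x \<Sigma>)" if "t \<in> T" for t using that by auto
  let ?n = "dim_x \<Sigma>" and ?g = "\<lambda>t. state_rhs S \<Sigma> (p t) (x t) (u t)"
  show ?thesis
  proof (cases "time S")
    case CT
    have "(\<forall>i<?n. \<forall>b. absolutely_continuous_upto b (\<lambda>t. x t $ i)) \<and>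
          (AE t in lebesgue. t \<in> {0..} \<longrightarrow> (\<forall>i<?n. ((\<lambda>s. x s $ i) has_real_derivative ?g t $ i) (at t within {0..})))
        \<longleftrightarrow> vec_evolves CT ?n x ?g" (is "?AC \<and> ?AE \<longleftrightarrow> ?ev")
    proof
      assume as: "?AC \<and> ?AE"
      have "evolves CT (\<lambda>t. x t $ i) (\<lambda>t. ?g t $ i)" if i: "i < ?n" for i
        unfolding evolves_def time_kind.case
      proof (intro allI impI)
        fix b :: real assume b: "b \<ge> 0"
        have ae: "AE t in lebesgue. t \<in> {0..} \<longrightarrow> ((\<lambda>s. x s $ i) has_real_derivative ?g t $ i) (at t within {0..})"
          using conjunct2[OF as] by (rule eventually_mono) (simp add: i)
        have ac: "absolutely_continuous_upto b (\<lambda>t. x t $ i)" using conjunct1[OF as] i by simp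
        show "((\<lambda>t. ?g t $ i) has_integral (x b $ i - x 0 $ i)) {0..b}"
          by (rule absolutely_continuous_upto_has_integral[OF ac b ae])
      qed
      then show ?ev by (simp add: vec_evolves_def)
    next
      assume ev: ?ev
      have pc: "piecewise_continuous (\<lambda>t. ?g t $ i)" if i: "i < ?n" for i
      proof (rule piecewise_continuous_cong)
        have xpc: "piecewise_continuous (\<lambda>t. x t $ j)" if "j < ?n" for j
        proof -
          have "evolves CT (\<lambda>t. x t $ j) (\<lambda>t. ?g t $ j)" using ev that by (simp add: vec_evolves_def)
          then show ?thesis by (rule piecewise_continuous_continuous_on[OF evolves_CT_continuous_on])
        qed
        show "piecewise_continuous (\<lambda>t. (\<Sum>j<?n. Amat \<Sigma> (p t) $$ (i, j) * x t $ j) + (\<Sum>j<n_u S. Bmat \<Sigma> (p t) $$ (i, j) * u t $ j))"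
          by (intro piecewise_continuous_add piecewise_continuous_sum piecewise_continuous_mult
              system_piecewise_continuous[OF CT p \<Sigma> i] input_piecewise_continuous[OF CT u] xpc) simp_all
        fix t :: real assume "t \<ge> 0"
        then have "t \<in> T" using CT by (simp add: time_axis_simps)
        then show "(\<Sum>j<?n. Amat \<Sigma> (p t) $$ (i, j) * x t $ j) + (\<Sum>j<n_u S. Bmat \<Sigma> (p t) $$ (i, j) * u t $ j) = ?g t $ i"
          using state_rhs_index[OF \<Sigma> xc input_carrier[OF u] i] by simp
      qed
      have evi: "evolves CT (\<lambda>t. x t $ i) (\<lambda>t. ?g t $ i)" if "i < ?n" for i
        using ev that by (simp add: vec_evolves_def)
      \<comment> \<open>The exceptional null set depends on the component; finitely many of them are
        merged.\<close>
      have "AE t in lebesgue. \<forall>i\<in>{..<?n}. t \<in> {0..} \<longrightarrow> ((\<lambda>s. x s $ i) has_real_derivative ?g t $ i) (at t within {0..})"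
      proof (rule AE_finite_allI)
        fix i assume "i \<in> {..<?n}"
        then have "i < ?n" by simp
        then show "AE t in lebesgue. t \<in> {0..} \<longrightarrow> ((\<lambda>s. x s $ i) has_real_derivative ?g t $ i) (at t within {0..})"
          by (intro evolves_CT_derivative evi pc)
      qed simp
      then have ?AE by (rule eventually_mono) simp
      moreover have ?AC by (intro allI impI evolves_CT_absolutely_continuous[OF evi pc])
      ultimately show "?AC \<and> ?AE" by blast
    qed
    then show ?thesis using True CT by (simp add: is_state_trajectory_def)
  next
    case DT
    have "(\<forall>t\<in>\<nat>. x (t + 1) = ?g t) \<longleftrightarrow> vec_evolves DT ?n x ?g"
    proof
      assume ev: "vec_evolves DT ?n x ?g"
      show "\<forall>t\<in>\<nat>. x (t + 1) = ?g t"
      proof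
        fix t :: real assume t: "t \<in> \<nat>"
        then have tT: "t \<in> T" "t + 1 \<in> T" using DT by (auto simp: time_axis_simps)
        show "x (t + 1) = ?g t"
          by (rule vec_eqI[OF xc[OF tT(2)] state_rhs_carrier[OF \<Sigma> xc[OF tT(1)] input_carrier[OF u tT(1)]]])
            (use ev t in \<open>simp add: vec_evolves_def evolves_def\<close>)
      qed
    qed (simp add: vec_evolves_def evolves_def)
    then show ?thesis using True DT by (simp add: is_state_trajectory_def)
  qed
qed (auto simp: is_state_trajectory_def)

text \<open>This gives the \<open>THE\<close> in \<open>state_trajectory\<close> its meaning. In
  continuous time the difference of two solutions solves the homogeneous equation; extensionality
  turns agreement on the time axis into equality of functions.\<close>

lemma state_trajectory_ex1:
  assumes \<Sigma>: "is_lpv_ssa S \<Sigma>" and u: "u \<in> inputs S" and p: "p \<in> schedulings S" and x0: "x0 \<in> carrier_vec (dim_x \<Sigma>)"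
  shows "\<exists>!x. is_state_trajectory S \<Sigma> x0 u p x"
proof (cases "time S")
  case CT
  let ?n = "dim_x \<Sigma>"
  let ?a = "\<lambda>i j t. Amat \<Sigma> (p t) $$ (i, j)" and ?f = "\<lambda>i t. \<Sum>j<n_u S. Bmat \<Sigma> (p t) $$ (i, j) * u t $ j"
  have a: "piecewise_continuous (?a i j)" if "i < ?n" "j < ?n" for i j
    using system_piecewise_continuous[OF CT p \<Sigma>] that by blast
  have f: "piecewise_continuous (?f i)" if "i < ?n" for i
    using system_piecewise_continuous[OF CT p \<Sigma> that] input_piecewise_continuous[OF CT u]
    by (intro piecewise_continuous_sum piecewise_continuous_mult) auto
  have iff: "is_state_trajectory S \<Sigma> x0 u p x \<longleftrightarrow> x \<in> T \<rightarrow>\<^sub>E carrier_vec ?n \<and> x 0 = x0 \<and>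
      (\<forall>i<?n. \<forall>t\<ge>0. ((\<lambda>s. (\<Sum>j<?n. ?a i j s * x s $ j) + ?f i s) has_integral (x t $ i - x 0 $ i)) {0..t})" for x
  proof -
    have "vec_evolves CT ?n x (\<lambda>t. state_rhs S \<Sigma> (p t) (x t) (u t)) \<longleftrightarrow>
      (\<forall>i<?n. \<forall>t\<ge>0. ((\<lambda>s. (\<Sum>j<?n. ?a i j s * x s $ j) + ?f i s) has_integral (x t $ i - x 0 $ i)) {0..t})"
      if x: "x \<in> T \<rightarrow>\<^sub>E carrier_vec ?n"
    proof -
      have "((\<lambda>s. state_rhs S \<Sigma> (p s) (x s) (u s) $ i) has_integral I) {0..t} \<longleftrightarrow>
          ((\<lambda>s. (\<Sum>j<?n. ?a i j s * x s $ j) + ?f i s) has_integral I) {0..t}" if "i < ?n" for i I t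
      proof (rule has_integral_cong)
        fix s assume "s \<in> {0..t}"
        then have "s \<in> T" using CT by (simp add: time_axis_simps)
        then show "state_rhs S \<Sigma> (p s) (x s) (u s) $ i = (\<Sum>j<?n. ?a i j s * x s $ j) + ?f i s"
          using state_rhs_index[OF \<Sigma> _ input_carrier[OF u] that] x by auto
      qed
      then show ?thesis by (simp add: vec_evolves_def evolves_def)
    qed
    then show ?thesis using is_state_trajectory_iff[OF \<Sigma> u p] CT by auto
  qed
  have "\<exists>\<xi>. \<forall>i<?n. \<xi> i 0 = x0 $ i \<and>
      (\<forall>t\<ge>0. ((\<lambda>s. (\<Sum>j<?n. ?a i j s * \<xi> j s) + ?f i s) has_integral (\<xi> i t - x0 $ i)) {0..t})"
    by (rule linear_ode_exists) (erule (1) a, erule f)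
  then obtain \<xi> where \<xi>': "\<forall>i<?n. \<xi> i 0 = x0 $ i \<and>
      (\<forall>t\<ge>0. ((\<lambda>s. (\<Sum>j<?n. ?a i j s * \<xi> j s) + ?f i s) has_integral (\<xi> i t - x0 $ i)) {0..t})"
    by (elim exE) (rule that)
  have \<xi>: "\<xi> i 0 = x0 $ i"
    "t \<ge> 0 \<Longrightarrow> ((\<lambda>s. (\<Sum>j<?n. ?a i j s * \<xi> j s) + ?f i s) has_integral (\<xi> i t - x0 $ i)) {0..t}" if "i < ?n" for i t
    using \<xi>'[rule_format, OF that] by simp_all
  let ?x = "\<lambda>t\<in>T. vec ?n (\<lambda>i. \<xi> i t)"
  show ?thesis
  proof (rule ex1I)
    show "is_state_trajectory S \<Sigma> x0 u p ?x"
      unfolding iff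
    proof (intro conjI allI impI)
      show "?x \<in> T \<rightarrow>\<^sub>E carrier_vec ?n" by auto
      show "?x 0 = x0" using \<xi>(1) x0 by (intro vec_eqI[of _ ?n]) auto
      fix i and t :: real assume it: "i < ?n" "t \<ge> 0"
      have "(\<Sum>j<?n. ?a i j s * ?x s $ j) + ?f i s = (\<Sum>j<?n. ?a i j s * \<xi> j s) + ?f i s" if "s \<in> {0..t}" for s
        using that CT by (simp add: time_axis_simps)
      with \<xi>(2)[OF it] have "((\<lambda>s. (\<Sum>j<?n. ?a i j s * ?x s $ j) + ?f i s) has_integral (\<xi> i t - x0 $ i)) {0..t}"
        using has_integral_cong[of "{0..t}" "\<lambda>s. (\<Sum>j<?n. ?a i j s * ?x s $ j) + ?f i s"
            "\<lambda>s. (\<Sum>j<?n. ?a i j s * \<xi> j s) + ?f i s"] by simp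
      then show "((\<lambda>s. (\<Sum>j<?n. ?a i j s * ?x s $ j) + ?f i s) has_integral (?x t $ i - ?x 0 $ i)) {0..t}"
        using it CT \<xi>(1) by (simp add: time_axis_simps)
    qed
  next
    fix y assume "is_state_trajectory S \<Sigma> x0 u p y"
    note y' = this[unfolded iff]
    note y = y'[THEN conjunct1] y'[THEN conjunct2, THEN conjunct1]
    note yi' = y'[THEN conjunct2, THEN conjunct2]
    have yi: "((\<lambda>s. (\<Sum>j<?n. ?a i j s * y s $ j) + ?f i s) has_integral (y t $ i - x0 $ i)) {0..t}"
      if "i < ?n" "t \<ge> 0" for i t
      using yi'[rule_format, OF that] y(2) by simp
    have z: "y t $ i - \<xi> i t = 0" if "i < ?n" "t \<ge> 0" for i t
    proof (rule linear_ode_unique[where a = ?a and z = "\<lambda>i t. y t $ i - \<xi> i t", OF a _ that])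
      fix i and t :: real assume it: "i < ?n" "t \<ge> 0"
      have "((\<lambda>s. ((\<Sum>j<?n. ?a i j s * y s $ j) + ?f i s) - ((\<Sum>j<?n. ?a i j s * \<xi> j s) + ?f i s)) has_integral
          ((y t $ i - x0 $ i) - (\<xi> i t - x0 $ i))) {0..t}"
        by (intro has_integral_diff yi \<xi>(2) it)
      then show "((\<lambda>s. \<Sum>j<?n. ?a i j s * (y s $ j - \<xi> j s)) has_integral (y t $ i - \<xi> i t)) {0..t}"
        by (simp add: right_diff_distrib sum_subtractf)
    qed
    show "y = ?x"
    proof (rule PiE_ext[OF y(1)])
      show "?x \<in> T \<rightarrow>\<^sub>E carrier_vec ?n" by auto
      fix t assume t: "t \<in> T"
      then show "y t = ?x t"
        using y(1) z CT by (intro vec_eqI[of _ ?n]) (auto simp: time_axis_simps)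
    qed
  qed
next
  case DT
  let ?n = "dim_x \<Sigma>"
  have iff: "is_state_trajectory S \<Sigma> x0 u p x \<longleftrightarrow> x \<in> \<nat> \<rightarrow>\<^sub>E carrier_vec ?n \<and> x 0 = x0 \<and>
      (\<forall>t. x (real t + 1) = state_rhs S \<Sigma> (p (real t)) (x (real t)) (u (real t)))" for x
    using DT by (auto simp: is_state_trajectory_def time_axis_simps elim!: Nats_cases)
  define X where "X = rec_nat x0 (\<lambda>t x. state_rhs S \<Sigma> (p (real t)) x (u (real t)))"
  have XS: "X 0 = x0" "X (Suc t) = state_rhs S \<Sigma> (p (real t)) (X t) (u (real t))" for t
    by (simp_all add: X_def)
  have Xc: "X t \<in> carrier_vec ?n" for t
  proof (induction t)
    case (Suc t)
    have "real t \<in> T" using DT by (simp add: time_axis_simps)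
    then show ?case using state_rhs_carrier[OF \<Sigma> Suc input_carrier[OF u]] by (simp add: XS)
  qed (use x0 XS in simp)
  \<comment> \<open>The floor converts a discrete time, which is a real number, into the index of
    the recursion.\<close>
  let ?x = "\<lambda>t\<in>\<nat>. X (nat \<lfloor>t\<rfloor>)"
  show ?thesis
  proof (rule ex1I)
    show "is_state_trajectory S \<Sigma> x0 u p ?x"
      unfolding iff
    proof (intro conjI allI)
      show "?x \<in> \<nat> \<rightarrow>\<^sub>E carrier_vec ?n" using Xc by simp
      show "?x 0 = x0" by (simp add: XS)
      fix t
      have "real t + 1 = real (Suc t)" by simp
      then show "?x (real t + 1) = state_rhs S \<Sigma> (p (real t)) (?x (real t)) (u (real t))"
        by (simp only: restrict_apply if_True of_nat_in_Nats floor_of_nat nat_int XS)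
    qed
  next
    fix y assume y: "is_state_trajectory S \<Sigma> x0 u p y"
    have eq: "y (real t) = X t" for t
    proof (induction t)
      case (Suc t)
      have "y (real (Suc t)) = state_rhs S \<Sigma> (p (real t)) (y (real t)) (u (real t))"
        using y by (simp add: iff add.commute)
      then show ?case using Suc XS by simp
    qed (use y XS in \<open>simp add: iff\<close>)
    show "y = ?x"
    proof (rule PiE_ext[of _ \<nat> "\<lambda>_. carrier_vec ?n"])
      show "y \<in> \<nat> \<rightarrow>\<^sub>E carrier_vec ?n" using y by (simp add: iff)
      show "?x \<in> \<nat> \<rightarrow>\<^sub>E carrier_vec ?n" using Xc by auto
      fix t :: real assume t: "t \<in> \<nat>"
      then obtain m where "t = real m" by (rule Nats_cases)
      then show "y t = ?x t" using eq by simp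
    qed
  qed
qed

end

section \<open>Affine matrix families: products and recovery of the coefficients\<close>

lemma affine_mat_mult_left:
  assumes M: "\<And>l. l \<le> n \<Longrightarrow> M l \<in> carrier_mat r c" and K: "K \<in> carrier_mat m r"
  shows "affine_mat n (\<lambda>l. K * M l) q = K * affine_mat n M q"
proof -
  have M0: "M 0 \<in> carrier_mat r c" using M by simp
  note KM0 = mult_carrier_mat[OF K M0]
  note aM = affine_mat_carrier[where M = M, OF M0, of n q]
  note aKM = affine_mat_carrier[where M = "\<lambda>l. K * M l", OF KM0, of n q]
  show ?thesis
  proof (rule eq_matI)
    fix i j assume "i < dim_row (K * affine_mat n M q)" "j < dim_col (K * affine_mat n M q)"
    then have i: "i < m" and j: "j < c" using mult_carrier_mat[OF K aM] by auto
    have "affine_mat n (\<lambda>l. K * M l) q $$ (i, j) = (\<Sum>k<r. K $$ (i, k) * M 0 $$ (k, j)) +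
        (\<Sum>l=1..n. (\<Sum>k<r. K $$ (i, k) * M l $$ (k, j)) * q $ (l - 1))"
      unfolding affine_mat_index[where M = "\<lambda>l. K * M l", OF KM0 i j] mult_mat_index[OF K M0 i j]
      by (intro arg_cong2[where f = "(+)"] refl sum.cong) (simp add: mult_mat_index[OF K M i j])
    also have "\<dots> = (\<Sum>k<r. K $$ (i, k) * M 0 $$ (k, j)) + (\<Sum>k<r. \<Sum>l=1..n. K $$ (i, k) * (M l $$ (k, j) * q $ (l - 1)))"
      by (subst sum.swap) (simp add: sum_distrib_right mult.assoc)
    also have "\<dots> = (\<Sum>k<r. K $$ (i, k) * (M 0 $$ (k, j) + (\<Sum>l=1..n. M l $$ (k, j) * q $ (l - 1))))"
      by (simp add: sum.distrib distrib_left sum_distrib_left)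
    also have "\<dots> = (K * affine_mat n M q) $$ (i, j)"
      unfolding mult_mat_index[OF K aM i j] by (simp add: affine_mat_index[where M = M, OF M0 _ j])
    finally show "affine_mat n (\<lambda>l. K * M l) q $$ (i, j) = (K * affine_mat n M q) $$ (i, j)" .
  qed (use mult_carrier_mat[OF K aM] aKM in auto)
qed

lemma affine_mat_mult_right:
  assumes M: "\<And>l. l \<le> n \<Longrightarrow> M l \<in> carrier_mat r c" and K: "K \<in> carrier_mat c m"
  shows "affine_mat n (\<lambda>l. M l * K) q = affine_mat n M q * K"
proof -
  have M0: "M 0 \<in> carrier_mat r c" using M by simp
  note KM0 = mult_carrier_mat[OF M0 K]
  note aM = affine_mat_carrier[where M = M, OF M0, of n q]
  note aKM = affine_mat_carrier[where M = "\<lambda>l. M l * K", OF KM0, of n q]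
  show ?thesis
  proof (rule eq_matI)
    fix i j assume "i < dim_row (affine_mat n M q * K)" "j < dim_col (affine_mat n M q * K)"
    then have i: "i < r" and j: "j < m" using mult_carrier_mat[OF aM K] by auto
    have "affine_mat n (\<lambda>l. M l * K) q $$ (i, j) = (\<Sum>k<c. M 0 $$ (i, k) * K $$ (k, j)) +
        (\<Sum>l=1..n. (\<Sum>k<c. M l $$ (i, k) * K $$ (k, j)) * q $ (l - 1))"
      unfolding affine_mat_index[where M = "\<lambda>l. M l * K", OF KM0 i j] mult_mat_index[OF M0 K i j]
      by (intro arg_cong2[where f = "(+)"] refl sum.cong) (simp add: mult_mat_index[OF M K i j])
    also have "\<dots> = (\<Sum>k<c. M 0 $$ (i, k) * K $$ (k, j)) + (\<Sum>k<c. \<Sum>l=1..n. M l $$ (i, k) * q $ (l - 1) * K $$ (k, j))"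
      by (subst sum.swap) (simp add: sum_distrib_left sum_distrib_right mult_ac)
    also have "\<dots> = (\<Sum>k<c. (M 0 $$ (i, k) + (\<Sum>l=1..n. M l $$ (i, k) * q $ (l - 1))) * K $$ (k, j))"
      by (simp add: sum.distrib distrib_right sum_distrib_right)
    also have "\<dots> = (affine_mat n M q * K) $$ (i, j)"
      unfolding mult_mat_index[OF aM K i j] by (simp add: affine_mat_index[where M = M, OF M0 i])
    finally show "affine_mat n (\<lambda>l. M l * K) q $$ (i, j) = (affine_mat n M q * K) $$ (i, j)" .
  qed (use mult_carrier_mat[OF aM K] aKM in auto)
qed

text \<open>Weights with sum 1 commute with affine functions, so the function vanishes on the hull,
  that is, everywhere. Its value at 0 isolates \<open>c 0\<close>, the unit vectors isolate the
  other coefficients.\<close>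

lemma affine_hull_vanish:
  fixes c :: "nat \<Rightarrow> real"
  assumes hull: "vec_affine_hull n P = carrier_vec n"
    and c: "\<And>q. q \<in> P \<Longrightarrow> c 0 + (\<Sum>l=1..n. c l * q $ (l - 1)) = 0" and l: "l \<le> n"
  shows "c l = 0"
proof -
  have all: "c 0 + (\<Sum>l=1..n. c l * q $ (l - 1)) = 0" if q: "q \<in> carrier_vec n" for q
  proof -
    obtain F a where F: "finite F" "F \<subseteq> P" "(\<Sum>v\<in>F. a v) = 1" and qF: "q = vec n (\<lambda>i. \<Sum>v\<in>F. a v * v $ i)"
      using q unfolding hull[symmetric] vec_affine_hull_def by blast
    have "(\<Sum>l=1..n. c l * q $ (l - 1)) = (\<Sum>l=1..n. \<Sum>v\<in>F. c l * (a v * v $ (l - 1)))"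
      by (rule sum.cong) (auto simp: qF sum_distrib_left)
    also have "\<dots> = (\<Sum>v\<in>F. a v * (\<Sum>l=1..n. c l * v $ (l - 1)))"
      by (subst sum.swap) (simp add: sum_distrib_left mult_ac)
    \<comment> \<open>The total weight 1 lets the constant term join the weighted sum.\<close>
    finally have "c 0 + (\<Sum>l=1..n. c l * q $ (l - 1)) =
        (\<Sum>v\<in>F. a v) * c 0 + (\<Sum>v\<in>F. a v * (\<Sum>l=1..n. c l * v $ (l - 1)))" using F(3) by simp
    also have "\<dots> = (\<Sum>v\<in>F. a v * (c 0 + (\<Sum>l=1..n. c l * v $ (l - 1))))"
      by (simp add: sum_distrib_right sum.distrib distrib_left)
    also have "\<dots> = 0" using c F(2) by (intro sum.neutral) auto
    finally show ?thesis .
  qed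
  have "(\<Sum>k=1..n. c k * 0\<^sub>v n $ (k - 1)) = 0" by (rule sum.neutral) auto
  then have c0: "c 0 = 0" using all[OF zero_carrier_vec] by simp
  show ?thesis
  proof (cases "l = 0")
    case False
    \<comment> \<open>Coefficient \<open>l\<close> multiplies component \<open>l - 1\<close>, hence
      the shifted unit vector.\<close>
    have "(\<Sum>k=1..n. c k * unit_vec n (l - 1) $ (k - 1)) = (\<Sum>k=1..n. if k = l then c k else 0)"
    proof (rule sum.cong)
      fix k assume k: "k \<in> {1..n}"
      then have "k - 1 = l - 1 \<longleftrightarrow> k = l" using False by auto
      moreover have "k - 1 < n" "l - 1 < n" using k False l by auto
      ultimately show "c k * unit_vec n (l - 1) $ (k - 1) = (if k = l then c k else 0)" by simp
    qed simp
    also have "\<dots> = c l" using False l by simp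
    finally show ?thesis using all[OF unit_vec_carrier, of "l - 1"] c0 by simp
  qed (use c0 in simp)
qed

text \<open>Turns identities between matrices evaluated at scheduling points into the
  coefficientwise identities required of an isomorphism.\<close>

lemma affine_mat_eqD:
  assumes hull: "vec_affine_hull n P = carrier_vec n"
    and M: "\<And>l. l \<le> n \<Longrightarrow> M l \<in> carrier_mat r c" and M': "\<And>l. l \<le> n \<Longrightarrow> M' l \<in> carrier_mat r c"
    and eq: "\<And>q. q \<in> P \<Longrightarrow> affine_mat n M q = affine_mat n M' q" and l: "l \<le> n"
  shows "M l = M' l"
proof (rule eq_matI)
  have M0: "M 0 \<in> carrier_mat r c" "M' 0 \<in> carrier_mat r c" using M M' by simp_all
  fix i j assume "i < dim_row (M' l)" "j < dim_col (M' l)"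
  then have i: "i < r" and j: "j < c" using M'[OF l] by auto
  have "M l $$ (i, j) - M' l $$ (i, j) = 0"
  proof (rule affine_hull_vanish[OF hull _ l])
    fix q assume "q \<in> P"
    then have "affine_mat n M q $$ (i, j) = affine_mat n M' q $$ (i, j)" by (simp only: eq)
    then show "(M 0 $$ (i, j) - M' 0 $$ (i, j)) + (\<Sum>l=1..n. (M l $$ (i, j) - M' l $$ (i, j)) * q $ (l - 1)) = 0"
      unfolding affine_mat_index[where M = M, OF M0(1) i j] affine_mat_index[where M = M', OF M0(2) i j]
      by (simp add: left_diff_distrib sum_subtractf)
  qed
  then show "M l $$ (i, j) = M' l $$ (i, j)" by simp
qed (use M[OF l] M'[OF l] in auto)

lemma vec_add_right_commute:
  assumes "(a :: real vec) \<in> carrier_vec n" "b \<in> carrier_vec n" "c \<in> carrier_vec n"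
  shows "(a + c) + b = (a + b) + c"
  using assoc_add_vec[OF assms(1,3,2)] assoc_add_vec[OF assms] comm_add_vec[OF assms(2,3)] by simp

lemma smult_one_mat_mult_vec:
  assumes y: "(y :: real vec) \<in> carrier_vec n"
  shows "(c \<cdot>\<^sub>m 1\<^sub>m n) *\<^sub>v y = c \<cdot>\<^sub>v y"
proof (rule vec_eqI[of _ n])
  fix i assume i: "i < n"
  have "((c \<cdot>\<^sub>m 1\<^sub>m n) *\<^sub>v y) $ i = (\<Sum>j<n. (c \<cdot>\<^sub>m 1\<^sub>m n) $$ (i, j) * y $ j)"
    by (rule mult_mat_vec_index[OF smult_carrier_mat[OF one_carrier_mat] y i])
  also have "\<dots> = (\<Sum>j<n. if j = i then c * y $ i else 0)"
    by (rule sum.cong) (use i in auto)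
  also have "\<dots> = (c \<cdot>\<^sub>v y) $ i" using i y by simp
  finally show "((c \<cdot>\<^sub>m 1\<^sub>m n) *\<^sub>v y) $ i = (c \<cdot>\<^sub>v y) $ i" .
qed (use y in \<open>auto intro: mult_mat_vec_carrier[OF smult_carrier_mat[OF one_carrier_mat]]\<close>)

section \<open>Concatenation, linearity and tangents of state trajectories\<close>

context lpv
begin

lemma state_trajectory_is_state_trajectory:
  assumes "is_lpv_ssa S \<Sigma>" "u \<in> inputs S" "p \<in> schedulings S" "x0 \<in> carrier_vec (dim_x \<Sigma>)"
  shows "is_state_trajectory S \<Sigma> x0 u p (state_trajectory S \<Sigma> x0 u p)"
  unfolding state_trajectory_def by (rule theI'[OF state_trajectory_ex1[OF assms]])

lemma state_trajectory_carrier: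
  assumes "is_lpv_ssa S \<Sigma>" "u \<in> inputs S" "p \<in> schedulings S" "x0 \<in> carrier_vec (dim_x \<Sigma>)" "t \<in> T"
  shows "state_trajectory S \<Sigma> x0 u p t \<in> carrier_vec (dim_x \<Sigma>)"
  using state_trajectory_is_state_trajectory[OF assms(1-4)] assms(5)
  unfolding is_state_trajectory_iff[OF assms(1-3)] by blast

lemma state_trajectory_0:
  assumes "is_lpv_ssa S \<Sigma>" "u \<in> inputs S" "p \<in> schedulings S" "x0 \<in> carrier_vec (dim_x \<Sigma>)"
  shows "state_trajectory S \<Sigma> x0 u p 0 = x0"
  using state_trajectory_is_state_trajectory[OF assms]
  unfolding is_state_trajectory_iff[OF assms(1-3)] by blast

lemma state_trajectory_evolves:
  assumes "is_lpv_ssa S \<Sigma>" "u \<in> inputs S" "p \<in> schedulings S" "x0 \<in> carrier_vec (dim_x \<Sigma>)"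
  shows "vec_evolves (time S) (dim_x \<Sigma>) (state_trajectory S \<Sigma> x0 u p)
    (\<lambda>t. state_rhs S \<Sigma> (p t) (state_trajectory S \<Sigma> x0 u p t) (u t))"
  using state_trajectory_is_state_trajectory[OF assms]
  unfolding is_state_trajectory_iff[OF assms(1-3)] by blast

text \<open>Candidate trajectories are formulas defined on all reals; restricting them to the time
  axis supplies the extensionality under which trajectories are unique.\<close>

lemma state_trajectory_eqI:
  assumes \<Sigma>: "is_lpv_ssa S \<Sigma>" "u \<in> inputs S" "p \<in> schedulings S" and x0: "x0 \<in> carrier_vec (dim_x \<Sigma>)"
    and z: "\<And>t. t \<in> T \<Longrightarrow> z t \<in> carrier_vec (dim_x \<Sigma>)" "z 0 = x0"
      "vec_evolves (time S) (dim_x \<Sigma>) z (\<lambda>t. state_rhs S \<Sigma> (p t) (z t) (u t))"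
    and t: "t \<in> T"
  shows "state_trajectory S \<Sigma> x0 u p t = z t"
proof -
  have "is_state_trajectory S \<Sigma> x0 u p (restrict z T)"
    unfolding is_state_trajectory_iff[OF \<Sigma>]
  proof (intro conjI)
    show "restrict z T \<in> T \<rightarrow>\<^sub>E carrier_vec (dim_x \<Sigma>)" using z(1) by simp
    show "restrict z T 0 = x0" using z(2) by simp
    show "vec_evolves (time S) (dim_x \<Sigma>) (restrict z T) (\<lambda>t. state_rhs S \<Sigma> (p t) (restrict z T t) (u t))"
      by (rule vec_evolves_cong[THEN iffD1, OF _ _ z(3)]) simp_all
  qed
  then have "state_trajectory S \<Sigma> x0 u p = restrict z T"
    unfolding state_trajectory_def by (rule the1_equality[OF state_trajectory_ex1[OF \<Sigma> x0]])
  then show ?thesis using t by simp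
qed

definition concat_signal :: "real \<Rightarrow> (real \<Rightarrow> real vec) \<Rightarrow> (real \<Rightarrow> real vec) \<Rightarrow> real \<Rightarrow> real vec" where
  "concat_signal s f g = (\<lambda>t\<in>T. if t < s then f t else g (t - s))"

definition const_signal :: "real vec \<Rightarrow> real \<Rightarrow> real vec" where
  "const_signal v = (\<lambda>t\<in>T. v)"

abbreviation "no_input \<equiv> const_signal (0\<^sub>v (n_u S))"

lemma concat_signal_shift: "s \<in> T \<Longrightarrow> t \<in> T \<Longrightarrow> concat_signal s f g (s + t) = g t"
  using time_axis_add[of s "time S" t] time_axis_nonneg[of t "time S"] by (simp add: concat_signal_def)

lemma concat_const_signal: "s \<in> T \<Longrightarrow> concat_signal s (const_signal v) (const_signal v) = const_signal v"
  using time_axis_diff[of s "time S"] by (auto simp: concat_signal_def const_signal_def)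

lemma signals_concat:
  assumes f: "f \<in> signals (time S) n V" and g: "g \<in> signals (time S) n V" and s: "s \<in> T"
  shows "concat_signal s f g \<in> signals (time S) n V"
proof -
  have fV: "f t \<in> V" "g t \<in> V" if "t \<in> T" for t
    using f g that by (auto simp: signals_def)
  have "concat_signal s f g \<in> T \<rightarrow>\<^sub>E V"
    using fV time_axis_diff[OF s] by (auto simp: concat_signal_def not_less)
  moreover have "piecewise_continuous (\<lambda>t. concat_signal s f g t $ i)" if CT: "time S = CT" and i: "i < n" for i
  proof (rule piecewise_continuous_cong)
    have "piecewise_continuous (\<lambda>t. f t $ i)" "piecewise_continuous (\<lambda>t. g t $ i)"
      using f g CT i by (auto simp: signals_def)
    then show "piecewise_continuous (\<lambda>t. if t < s then f t $ i else g (t - s) $ i)"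
      using piecewise_continuous_concat time_axis_nonneg[OF s] by blast
    show "(if t < s then f t $ i else g (t - s) $ i) = concat_signal s f g t $ i" if "0 \<le> t" for t
      using that CT by (simp add: concat_signal_def time_axis_simps)
  qed
  ultimately show ?thesis by (simp add: signals_def)
qed

lemma signals_const: "v \<in> V \<Longrightarrow> const_signal v \<in> signals (time S) n V"
  unfolding signals_def const_signal_def
  by (auto simp: time_axis_simps intro!: piecewise_continuous_cong[OF piecewise_continuous_const])

lemmas inputs_concat = signals_concat[of _ "n_u S" "carrier_vec (n_u S)", folded inputs_def]
lemmas schedulings_concat = signals_concat[of _ "n_p S" "sched S", folded schedulings_def]
lemmas inputs_const = signals_const[of _ "carrier_vec (n_u S)" "n_u S", folded inputs_def]
lemmas schedulings_const = signals_const[of _ "sched S" "n_p S", folded schedulings_def]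

text \<open>The flow property: running on after time \<open>s\<close> amounts to restarting from the
  reached state. The two runs meet at \<open>s\<close>, so their concatenation solves the state
  equation for the concatenated signals, and uniqueness applies.\<close>

lemma state_trajectory_concat:
  assumes \<Sigma>: "is_lpv_ssa S \<Sigma>" and x0: "x0 \<in> carrier_vec (dim_x \<Sigma>)"
    and u: "u \<in> inputs S" "u' \<in> inputs S" and p: "p \<in> schedulings S" "p' \<in> schedulings S"
    and s: "s \<in> T" and t: "t \<in> T"
  shows "state_trajectory S \<Sigma> x0 (concat_signal s u u') (concat_signal s p p') (s + t) =
    state_trajectory S \<Sigma> (state_trajectory S \<Sigma> x0 u p s) u' p' t"
proof -
  let ?x = "state_trajectory S \<Sigma> x0 u p"
  let ?x' = "state_trajectory S \<Sigma> (?x s) u' p'"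
  let ?z = "\<lambda>t. if t < s then ?x t else ?x' (t - s)"
  note xs = state_trajectory_carrier[OF \<Sigma> u(1) p(1) x0]
  note x's = state_trajectory_carrier[OF \<Sigma> u(2) p(2) xs[OF s]]
  have s0: "s \<ge> 0" using s by (rule time_axis_nonneg)
  have x'0: "?x' 0 = ?x s" by (rule state_trajectory_0[OF \<Sigma> u(2) p(2) xs[OF s]])
  have "state_trajectory S \<Sigma> x0 (concat_signal s u u') (concat_signal s p p') (s + t) = ?z (s + t)"
  proof (rule state_trajectory_eqI[OF \<Sigma> inputs_concat[OF u s] schedulings_concat[OF p s] x0 _ _ _ time_axis_add[OF s t]])
    show "?z r \<in> carrier_vec (dim_x \<Sigma>)" if "r \<in> T" for r
      using xs[OF that] x's[OF time_axis_diff[OF s that]] by simp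
    show "?z 0 = x0"
    proof (cases "s = 0")
      case True
      then show ?thesis using x'0 state_trajectory_0[OF \<Sigma> u(1) p(1) x0] by simp
    next
      case False
      then show ?thesis using s0 state_trajectory_0[OF \<Sigma> u(1) p(1) x0] by simp
    qed
    have "vec_evolves (time S) (dim_x \<Sigma>) ?z (\<lambda>t. if t < s then state_rhs S \<Sigma> (p t) (?x t) (u t)
        else state_rhs S \<Sigma> (p' (t - s)) (?x' (t - s)) (u' (t - s)))"
      by (rule vec_evolves_concat[OF s state_trajectory_evolves[OF \<Sigma> u(1) p(1) x0]
            state_trajectory_evolves[OF \<Sigma> u(2) p(2) xs[OF s]] x'0])
    then show "vec_evolves (time S) (dim_x \<Sigma>) ?z
        (\<lambda>t. state_rhs S \<Sigma> (concat_signal s p p' t) (?z t) (concat_signal s u u' t))"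
      by (rule vec_evolves_cong[THEN iffD1, rotated 2]) (simp_all add: concat_signal_def)
  qed
  then show ?thesis using time_axis_nonneg[OF t] by simp
qed

lemma state_rhs_zero_input:
  assumes "is_lpv_ssa S \<Sigma>" "x \<in> carrier_vec (dim_x \<Sigma>)"
  shows "state_rhs S \<Sigma> q x (0\<^sub>v (n_u S)) = Amat \<Sigma> q *\<^sub>v x"
  unfolding state_rhs_def mult_mat_zero_vec[OF system_carrier(2)[OF assms(1)]]
  by (rule right_zero_vec[OF mult_mat_vec_carrier[OF system_carrier(1)[OF assms(1)] assms(2)]])

text \<open>A linear map that intertwines two vector fields carries solutions to solutions. Scaling,
  restriction to a subspace and passage to a quotient are all instances.\<close>

lemma state_trajectory_map:
  assumes \<Sigma>1: "is_lpv_ssa S \<Sigma>1" and \<Sigma>2: "is_lpv_ssa S \<Sigma>2" and M: "M \<in> carrier_mat (dim_x \<Sigma>2) (dim_x \<Sigma>1)"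
    and x: "x \<in> carrier_vec (dim_x \<Sigma>1)" and u: "u \<in> inputs S" and u': "u' \<in> inputs S" and p: "p \<in> schedulings S"
    and eq: "\<And>t y. t \<in> T \<Longrightarrow> y \<in> carrier_vec (dim_x \<Sigma>1) \<Longrightarrow>
      M *\<^sub>v state_rhs S \<Sigma>1 (p t) y (u t) = state_rhs S \<Sigma>2 (p t) (M *\<^sub>v y) (u' t)"
    and t: "t \<in> T"
  shows "state_trajectory S \<Sigma>2 (M *\<^sub>v x) u' p t = M *\<^sub>v state_trajectory S \<Sigma>1 x u p t"
proof (rule state_trajectory_eqI[OF \<Sigma>2 u' p mult_mat_vec_carrier[OF M x] _ _ _ t])
  note xs = state_trajectory_carrier[OF \<Sigma>1 u p x]
  show "M *\<^sub>v state_trajectory S \<Sigma>1 x u p s \<in> carrier_vec (dim_x \<Sigma>2)" if "s \<in> T" for s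
    by (rule mult_mat_vec_carrier[OF M xs[OF that]])
  show "M *\<^sub>v state_trajectory S \<Sigma>1 x u p 0 = M *\<^sub>v x"
    by (simp only: state_trajectory_0[OF \<Sigma>1 u p x])
  have "vec_evolves (time S) (dim_x \<Sigma>2) (\<lambda>t. M *\<^sub>v state_trajectory S \<Sigma>1 x u p t)
      (\<lambda>t. M *\<^sub>v state_rhs S \<Sigma>1 (p t) (state_trajectory S \<Sigma>1 x u p t) (u t))"
    by (rule vec_evolves_mult[OF state_trajectory_evolves[OF \<Sigma>1 u p x] M xs
          state_rhs_carrier[OF \<Sigma>1 xs input_carrier[OF u]]])
  then show "vec_evolves (time S) (dim_x \<Sigma>2) (\<lambda>t. M *\<^sub>v state_trajectory S \<Sigma>1 x u p t)
      (\<lambda>t. state_rhs S \<Sigma>2 (p t) (M *\<^sub>v state_trajectory S \<Sigma>1 x u p t) (u' t))"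
    by (rule vec_evolves_cong[THEN iffD1, rotated 2]) (simp_all only: eq xs)
qed

text \<open>Superposition: the input must enter the sum exactly once, so the second run gets
  none.\<close>

lemma state_trajectory_add:
  assumes \<Sigma>: "is_lpv_ssa S \<Sigma>" and x: "x \<in> carrier_vec (dim_x \<Sigma>)" and y: "y \<in> carrier_vec (dim_x \<Sigma>)"
    and u: "u \<in> inputs S" and p: "p \<in> schedulings S" and t: "t \<in> T"
  shows "state_trajectory S \<Sigma> (x + y) u p t =
    state_trajectory S \<Sigma> x u p t + state_trajectory S \<Sigma> y no_input p t"
proof (rule state_trajectory_eqI[OF \<Sigma> u p add_carrier_vec[OF x y] _ _ _ t])
  let ?o = "no_input"
  have z: "?o \<in> inputs S" by (rule inputs_const[OF zero_carrier_vec])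
  note xs = state_trajectory_carrier[OF \<Sigma> u p x] and ys = state_trajectory_carrier[OF \<Sigma> z p y]
  show "state_trajectory S \<Sigma> x u p s + state_trajectory S \<Sigma> y ?o p s \<in> carrier_vec (dim_x \<Sigma>)" if "s \<in> T" for s
    by (rule add_carrier_vec[OF xs[OF that] ys[OF that]])
  show "state_trajectory S \<Sigma> x u p 0 + state_trajectory S \<Sigma> y ?o p 0 = x + y"
    by (simp only: state_trajectory_0[OF \<Sigma> u p x] state_trajectory_0[OF \<Sigma> z p y])
  have "vec_evolves (time S) (dim_x \<Sigma>) (\<lambda>t. state_trajectory S \<Sigma> x u p t + state_trajectory S \<Sigma> y ?o p t)
      (\<lambda>t. state_rhs S \<Sigma> (p t) (state_trajectory S \<Sigma> x u p t) (u t) +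
        state_rhs S \<Sigma> (p t) (state_trajectory S \<Sigma> y ?o p t) (?o t))"
    by (rule vec_evolves_add[OF state_trajectory_evolves[OF \<Sigma> u p x] state_trajectory_evolves[OF \<Sigma> z p y] ys
          state_rhs_carrier[OF \<Sigma> ys input_carrier[OF z]]])
  then show "vec_evolves (time S) (dim_x \<Sigma>) (\<lambda>t. state_trajectory S \<Sigma> x u p t + state_trajectory S \<Sigma> y ?o p t)
      (\<lambda>t. state_rhs S \<Sigma> (p t) (state_trajectory S \<Sigma> x u p t + state_trajectory S \<Sigma> y ?o p t) (u t))"
  proof (rule vec_evolves_cong[THEN iffD1, rotated 2])
    fix s assume s: "s \<in> T"
    note A = system_carrier(1)[OF \<Sigma>, of "p s"] and B = system_carrier(2)[OF \<Sigma>, of "p s"]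
    let ?x = "state_trajectory S \<Sigma> x u p s" and ?y = "state_trajectory S \<Sigma> y ?o p s"
    have "state_rhs S \<Sigma> (p s) ?y (?o s) = Amat \<Sigma> (p s) *\<^sub>v ?y"
      using s state_rhs_zero_input[OF \<Sigma> ys[OF s], of "p s"] by (simp only: const_signal_def restrict_apply if_True)
    moreover have "Amat \<Sigma> (p s) *\<^sub>v (?x + ?y) = Amat \<Sigma> (p s) *\<^sub>v ?x + Amat \<Sigma> (p s) *\<^sub>v ?y"
      by (rule mult_add_distrib_mat_vec[OF A xs[OF s] ys[OF s]])
    ultimately show "state_rhs S \<Sigma> (p s) ?x (u s) + state_rhs S \<Sigma> (p s) ?y (?o s) = state_rhs S \<Sigma> (p s) (?x + ?y) (u s)"
      unfolding state_rhs_def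
      by (simp only: vec_add_right_commute[OF mult_mat_vec_carrier[OF A xs[OF s]] mult_mat_vec_carrier[OF A ys[OF s]]
            mult_mat_vec_carrier[OF B input_carrier[OF u s]]])
  qed simp
qed

lemma state_trajectory_smult:
  assumes \<Sigma>: "is_lpv_ssa S \<Sigma>" and x: "x \<in> carrier_vec (dim_x \<Sigma>)" and p: "p \<in> schedulings S" and t: "t \<in> T"
  shows "state_trajectory S \<Sigma> (c \<cdot>\<^sub>v x) no_input p t =
    c \<cdot>\<^sub>v state_trajectory S \<Sigma> x no_input p t"
proof -
  \<comment> \<open>Scaling is treated as an intertwining map, a multiple of the identity, which
    commutes with the zero-input dynamics.\<close>
  let ?o = "no_input" and ?M = "c \<cdot>\<^sub>m 1\<^sub>m (dim_x \<Sigma>)"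
  have z: "?o \<in> inputs S" by (rule inputs_const[OF zero_carrier_vec])
  have M: "?M \<in> carrier_mat (dim_x \<Sigma>) (dim_x \<Sigma>)" by simp
  have Mx: "?M *\<^sub>v y = c \<cdot>\<^sub>v y" if y: "y \<in> carrier_vec (dim_x \<Sigma>)" for y
    by (rule smult_one_mat_mult_vec[OF y])
  have "state_trajectory S \<Sigma> (?M *\<^sub>v x) ?o p t = ?M *\<^sub>v state_trajectory S \<Sigma> x ?o p t"
  proof (rule state_trajectory_map[OF \<Sigma> \<Sigma> M x z z p _ t])
    fix s and y :: "real vec" assume s: "s \<in> T" and y: "y \<in> carrier_vec (dim_x \<Sigma>)"
    note A = system_carrier(1)[OF \<Sigma>, of "p s"]
    have "state_rhs S \<Sigma> (p s) v (?o s) = Amat \<Sigma> (p s) *\<^sub>v v" if "v \<in> carrier_vec (dim_x \<Sigma>)" for v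
      using s state_rhs_zero_input[OF \<Sigma> that] by (simp add: const_signal_def)
    then show "?M *\<^sub>v state_rhs S \<Sigma> (p s) y (?o s) = state_rhs S \<Sigma> (p s) (?M *\<^sub>v y) (?o s)"
      using y mult_mat_vec[OF A y, of c] Mx[OF y] Mx[OF mult_mat_vec_carrier[OF A y]] by simp
  qed
  then show ?thesis
    by (simp only: Mx[OF x] Mx[OF state_trajectory_carrier[OF \<Sigma> z p x t]])
qed

text \<open>Differentiation at time 0, for two systems so that one statement covers both uses: with
  \<open>M2\<close> zero it gives invariance of subspaces, with \<open>M2\<close> the identity it
  shows that a map between state spaces intertwines the dynamics.\<close>

lemma state_trajectory_tangent:
  assumes \<Sigma>1: "is_lpv_ssa S \<Sigma>1" and x1: "x1 \<in> carrier_vec (dim_x \<Sigma>1)" and M1: "M1 \<in> carrier_mat m (dim_x \<Sigma>1)"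
    and \<Sigma>2: "is_lpv_ssa S \<Sigma>2" and x2: "x2 \<in> carrier_vec (dim_x \<Sigma>2)" and M2: "M2 \<in> carrier_mat m (dim_x \<Sigma>2)"
    and q: "q \<in> sched S" and v: "v \<in> carrier_vec (n_u S)"
    and eq: "\<And>t. t \<in> T \<Longrightarrow> M1 *\<^sub>v state_trajectory S \<Sigma>1 x1 (const_signal v) (const_signal q) t =
      M2 *\<^sub>v state_trajectory S \<Sigma>2 x2 (const_signal v) (const_signal q) t"
  shows "M1 *\<^sub>v state_rhs S \<Sigma>1 q x1 v = M2 *\<^sub>v state_rhs S \<Sigma>2 q x2 v"
proof -
  let ?u = "const_signal v" and ?p = "const_signal q"
  have u: "?u \<in> inputs S" and p: "?p \<in> schedulings S" using inputs_const[OF v] schedulings_const[OF q] by auto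
  define g where "g \<Sigma> x M i t = (M *\<^sub>v state_rhs S \<Sigma> q (state_trajectory S \<Sigma> x ?u ?p t) v) $ i" for \<Sigma> x M i t
  have main: "evolves (time S) (\<lambda>t. (M *\<^sub>v state_trajectory S \<Sigma> x ?u ?p t) $ i) (g \<Sigma> x M i)"
      "time S = CT \<Longrightarrow> continuous_on {0..} (g \<Sigma> x M i)"
    if \<Sigma>: "is_lpv_ssa S \<Sigma>" and x: "x \<in> carrier_vec (dim_x \<Sigma>)" and M: "M \<in> carrier_mat m (dim_x \<Sigma>)" and i: "i < m" for \<Sigma> x M i
  proof -
    let ?X = "state_trajectory S \<Sigma> x ?u ?p"
    note xs = state_trajectory_carrier[OF \<Sigma> u p x] and ev = state_trajectory_evolves[OF \<Sigma> u p x]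
    have "vec_evolves (time S) m (\<lambda>t. M *\<^sub>v ?X t) (\<lambda>t. M *\<^sub>v state_rhs S \<Sigma> (?p t) (?X t) (?u t))"
      by (rule vec_evolves_mult[OF ev M xs state_rhs_carrier[OF \<Sigma> xs input_carrier[OF u]]])
    then have "evolves (time S) (\<lambda>t. (M *\<^sub>v ?X t) $ i) (\<lambda>t. (M *\<^sub>v state_rhs S \<Sigma> (?p t) (?X t) (?u t)) $ i)"
      using i unfolding vec_evolves_def by blast
    then show "evolves (time S) (\<lambda>t. (M *\<^sub>v ?X t) $ i) (g \<Sigma> x M i)"
      by (rule evolves_cong[THEN iffD1, rotated 2]) (simp_all add: g_def const_signal_def del: index_mult_mat_vec)
    assume CT: "time S = CT"
    have c: "continuous_on {0..} (\<lambda>t. ?X t $ j)" if "j < dim_x \<Sigma>" for j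
    proof (rule evolves_CT_continuous_on)
      show "evolves CT (\<lambda>t. ?X t $ j) (\<lambda>t. state_rhs S \<Sigma> (?p t) (?X t) (?u t) $ j)"
        using ev that CT by (simp add: vec_evolves_def)
    qed
    \<comment> \<open>Under constant signals the right-hand side depends on time only through the
      continuous state; in coordinates it is a finite sum of continuous terms.\<close>
    have "continuous_on {0..} (\<lambda>t. \<Sum>k<dim_x \<Sigma>. M $$ (i, k) *
        ((\<Sum>j<dim_x \<Sigma>. Amat \<Sigma> q $$ (k, j) * ?X t $ j) + (\<Sum>j<n_u S. Bmat \<Sigma> q $$ (k, j) * v $ j)))"
      by (intro continuous_intros c) simp
    then show "continuous_on {0..} (g \<Sigma> x M i)"
    proof (rule continuous_on_eq)
      fix t :: real assume "t \<in> {0..}"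
      then have t: "t \<in> T" using CT by (simp add: time_axis_simps)
      have "g \<Sigma> x M i t = (\<Sum>k<dim_x \<Sigma>. M $$ (i, k) * state_rhs S \<Sigma> q (?X t) v $ k)"
        unfolding g_def by (rule mult_mat_vec_index[OF M state_rhs_carrier[OF \<Sigma> xs[OF t] v] i])
      also have "\<dots> = (\<Sum>k<dim_x \<Sigma>. M $$ (i, k) *
          ((\<Sum>j<dim_x \<Sigma>. Amat \<Sigma> q $$ (k, j) * ?X t $ j) + (\<Sum>j<n_u S. Bmat \<Sigma> q $$ (k, j) * v $ j)))"
        by (rule sum.cong) (simp_all add: state_rhs_index[OF \<Sigma> xs[OF t] v])
      finally show "(\<Sum>k<dim_x \<Sigma>. M $$ (i, k) *
          ((\<Sum>j<dim_x \<Sigma>. Amat \<Sigma> q $$ (k, j) * ?X t $ j) + (\<Sum>j<n_u S. Bmat \<Sigma> q $$ (k, j) * v $ j))) = g \<Sigma> x M i t" by simp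
    qed
  qed
  show ?thesis
  proof (rule vec_eqI[OF mult_mat_vec_carrier[OF M1 state_rhs_carrier[OF \<Sigma>1 x1 v]]
        mult_mat_vec_carrier[OF M2 state_rhs_carrier[OF \<Sigma>2 x2 v]]])
    fix i assume i: "i < m"
    note e1 = main[OF \<Sigma>1 x1 M1 i] and e2 = main[OF \<Sigma>2 x2 M2 i]
    have "evolves (time S) (\<lambda>t. (M1 *\<^sub>v state_trajectory S \<Sigma>1 x1 ?u ?p t) $ i + (-1) * (M2 *\<^sub>v state_trajectory S \<Sigma>2 x2 ?u ?p t) $ i)
        (\<lambda>t. g \<Sigma>1 x1 M1 i t + (-1) * g \<Sigma>2 x2 M2 i t)"
      by (rule evolves_add[OF e1(1) evolves_cmult[OF e2(1)]])
    moreover have "continuous_on {0..} (\<lambda>t. g \<Sigma>1 x1 M1 i t + (-1) * g \<Sigma>2 x2 M2 i t)" if "time S = CT"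
      by (intro continuous_intros e1(2)[OF that] e2(2)[OF that])
    moreover have "(M1 *\<^sub>v state_trajectory S \<Sigma>1 x1 ?u ?p t) $ i + (-1) * (M2 *\<^sub>v state_trajectory S \<Sigma>2 x2 ?u ?p t) $ i = 0"
      if "t \<in> T" for t
      unfolding eq[OF that] by (simp only: mult_minus1 add.right_inverse)
    ultimately have "g \<Sigma>1 x1 M1 i 0 + (-1) * g \<Sigma>2 x2 M2 i 0 = 0"
      by (rule evolves_tangent)
    then show "(M1 *\<^sub>v state_rhs S \<Sigma>1 q x1 v) $ i = (M2 *\<^sub>v state_rhs S \<Sigma>2 q x2 v) $ i"
      unfolding g_def state_trajectory_0[OF \<Sigma>1 u p x1] state_trajectory_0[OF \<Sigma>2 u p x2] by argo
  qed
qed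

end

section \<open>Reduction to smaller realizations\<close>

text \<open>Links the module-theoretic span to \<open>lin_subspace\<close>. Leastness is what
  transfers linear facts from the reachable states to their span.\<close>

lemma span_lin_subspace:
  fixes G :: "real vec set"
  assumes G: "G \<subseteq> carrier_vec n"
  defines "sp \<equiv> LinearCombinations.module.span class_ring (module_vec TYPE(real) n) G"
  shows "lin_subspace n sp" "G \<subseteq> sp" "\<And>U. lin_subspace n U \<Longrightarrow> G \<subseteq> U \<Longrightarrow> sp \<subseteq> U"
proof -
  interpret vec_space "TYPE(real)" n .
  have sub: "submodule class_ring U V \<longleftrightarrow> lin_subspace n U" for U
    unfolding submodule_def lin_subspace_def using module_axioms
    by (simp add: class_ring_simps module_vec_simps) blast
  show "lin_subspace n sp" unfolding sp_def using span_is_submodule[OF G] by (simp only: sub)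
  show "G \<subseteq> sp" unfolding sp_def by (rule in_own_span[OF G])
  show "sp \<subseteq> U" if "lin_subspace n U" "G \<subseteq> U" for U
    unfolding sp_def using span_is_subset[OF that(2)] that(1) by (simp only: sub)
qed

lemma lin_subspace_kernel:
  assumes A: "(A :: real mat) \<in> carrier_mat m n" and B: "B \<in> carrier_mat m n"
  shows "lin_subspace n {x \<in> carrier_vec n. A *\<^sub>v x = B *\<^sub>v x}"
  unfolding lin_subspace_def
proof (intro conjI ballI allI)
  show "0\<^sub>v n \<in> {x \<in> carrier_vec n. A *\<^sub>v x = B *\<^sub>v x}"
    using mult_mat_zero_vec[OF A] mult_mat_zero_vec[OF B] by simp
  fix v w and c :: real assume v: "v \<in> {x \<in> carrier_vec n. A *\<^sub>v x = B *\<^sub>v x}"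
  then have vc: "v \<in> carrier_vec n" by simp
  show "c \<cdot>\<^sub>v v \<in> {x \<in> carrier_vec n. A *\<^sub>v x = B *\<^sub>v x}"
    using v mult_mat_vec[OF A vc] mult_mat_vec[OF B vc] by simp
  assume w: "w \<in> {x \<in> carrier_vec n. A *\<^sub>v x = B *\<^sub>v x}"
  then have wc: "w \<in> carrier_vec n" by simp
  show "v + w \<in> {x \<in> carrier_vec n. A *\<^sub>v x = B *\<^sub>v x}"
    using v w mult_add_distrib_mat_vec[OF A vc wc] mult_add_distrib_mat_vec[OF B vc wc] by simp
qed auto

lemma lin_subspace_preimage:
  assumes A: "(A :: real mat) \<in> carrier_mat m n" and W: "lin_subspace m W"
  shows "lin_subspace n {x \<in> carrier_vec n. A *\<^sub>v x \<in> W}"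
  unfolding lin_subspace_def
proof (intro conjI ballI allI)
  show "0\<^sub>v n \<in> {x \<in> carrier_vec n. A *\<^sub>v x \<in> W}"
    using mult_mat_zero_vec[OF A] W by (simp add: lin_subspace_def)
  fix v w and c :: real assume v: "v \<in> {x \<in> carrier_vec n. A *\<^sub>v x \<in> W}"
  then have vc: "v \<in> carrier_vec n" by simp
  show "c \<cdot>\<^sub>v v \<in> {x \<in> carrier_vec n. A *\<^sub>v x \<in> W}"
    using v mult_mat_vec[OF A vc] W by (simp add: lin_subspace_def)
  assume w: "w \<in> {x \<in> carrier_vec n. A *\<^sub>v x \<in> W}"
  then have wc: "w \<in> carrier_vec n" by simp
  show "v + w \<in> {x \<in> carrier_vec n. A *\<^sub>v x \<in> W}"
    using v w mult_add_distrib_mat_vec[OF A vc wc] W by (simp add: lin_subspace_def)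
qed auto

lemma vec_add_cancel_left:
  assumes "(a :: real vec) \<in> carrier_vec n" "b \<in> carrier_vec n" "a + b = a"
  shows "b = 0\<^sub>v n"
proof (rule vec_eqI[OF assms(2) zero_carrier_vec])
  fix i assume i: "i < n"
  have "(a + b) $ i = a $ i + b $ i" using i assms(2) by simp
  then show "b $ i = 0\<^sub>v n $ i" using assms(3) i by simp
qed

lemma vec_add_diff_cancel_left: "(a :: real vec) \<in> carrier_vec n \<Longrightarrow> b \<in> carrier_vec n \<Longrightarrow> a + b - a = b"
  by (intro vec_eqI[of _ n]) auto

lemma zero_smult_vec: "(v :: real vec) \<in> carrier_vec n \<Longrightarrow> 0 \<cdot>\<^sub>v v = 0\<^sub>v n"
  by (intro vec_eqI[of _ n]) auto

lemma smult_zero_vec: "c \<cdot>\<^sub>v 0\<^sub>v n = (0\<^sub>v n :: real vec)"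
  by (intro vec_eqI[of _ n]) auto

lemma vec_eq_if_diff_zero:
  assumes y: "(y :: real vec) \<in> carrier_vec n" and z: "z \<in> carrier_vec n" and eq: "y + (-1) \<cdot>\<^sub>v z = 0\<^sub>v n"
  shows "y = z"
proof (rule vec_eqI[OF y z])
  fix i assume i: "i < n"
  have "(y + (-1) \<cdot>\<^sub>v z) $ i = y $ i - z $ i" using i z by simp
  then show "y $ i = z $ i" unfolding eq using i by simp
qed

lemma lin_subspace_diff:
  assumes W: "lin_subspace n W" and v: "v \<in> W" and w: "w \<in> W"
  shows "v - w \<in> W"
proof -
  have c: "v \<in> carrier_vec n" "w \<in> carrier_vec n" using assms by (auto simp: lin_subspace_def)
  have "v - w = v + (-1) \<cdot>\<^sub>v w" using c by (intro vec_eqI[of _ n]) auto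
  then show ?thesis using W v w by (simp add: lin_subspace_def)
qed

text \<open>One formula serves both reductions: with an inclusion \<open>E\<close> and a projection
  \<open>F\<close> it is the restriction to an invariant subspace, with the quotient map as
  \<open>F\<close> and representatives as \<open>E\<close> it is the induced quotient
  system.\<close>

definition compress :: "nat \<Rightarrow> real mat \<Rightarrow> real mat \<Rightarrow> lpv_ssa \<Rightarrow> lpv_ssa" where
  "compress m F E \<Sigma> = \<lparr>dim_x = m, mat_A = (\<lambda>l. F * (mat_A \<Sigma> l * E)), mat_B = (\<lambda>l. F * mat_B \<Sigma> l),
     mat_C = (\<lambda>l. mat_C \<Sigma> l * E)\<rparr>"

context lpv
begin

lemma zero_input: "no_input \<in> inputs S"
  by (rule inputs_const[OF zero_carrier_vec])

lemma coefficient_carrier: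
  assumes "is_lpv_ssa S \<Sigma>" "l \<le> n_p S"
  shows "mat_A \<Sigma> l \<in> carrier_mat (dim_x \<Sigma>) (dim_x \<Sigma>)"
    "mat_B \<Sigma> l \<in> carrier_mat (dim_x \<Sigma>) (n_u S)"
    "mat_C \<Sigma> l \<in> carrier_mat (n_y S) (dim_x \<Sigma>)"
  using assms by (auto simp: is_lpv_ssa_def)

lemma io_equal_output_iff:
  "io_equal S (output_trajectory S \<Sigma> x) (output_trajectory S \<Sigma>' x') \<longleftrightarrow>
    (\<forall>u\<in>inputs S. \<forall>p\<in>schedulings S. \<forall>t\<in>T.
      Cmat \<Sigma> (p t) *\<^sub>v state_trajectory S \<Sigma> x u p t = Cmat \<Sigma>' (p t) *\<^sub>v state_trajectory S \<Sigma>' x' u p t)"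
proof -
  have "restrict f T = restrict g T \<longleftrightarrow> (\<forall>t\<in>T. f t = g t)" for f g :: "real \<Rightarrow> real vec"
    by (metis restrict_apply restrict_ext)
  then show ?thesis by (simp add: io_equal_def output_trajectory_def)
qed

lemma io_equal_sym: "io_equal S F G \<Longrightarrow> io_equal S G F"
  by (simp add: io_equal_def)

text \<open>\<open>M\<close> may point either way between the large and the small system: the
  inclusion leads from the restricted system into the original one, the quotient map from the
  original system to the reduced one.\<close>

lemma io_equal_intertwine:
  assumes \<Sigma>1: "is_lpv_ssa S \<Sigma>1" and \<Sigma>2: "is_lpv_ssa S \<Sigma>2" and M: "M \<in> carrier_mat (dim_x \<Sigma>2) (dim_x \<Sigma>1)"
    and x: "x \<in> carrier_vec (dim_x \<Sigma>1)"
    and A: "\<And>q. q \<in> sched S \<Longrightarrow> M * Amat \<Sigma>1 q = Amat \<Sigma>2 q * M"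
    and B: "\<And>q. q \<in> sched S \<Longrightarrow> M * Bmat \<Sigma>1 q = Bmat \<Sigma>2 q"
    and C: "\<And>q. q \<in> sched S \<Longrightarrow> Cmat \<Sigma>1 q = Cmat \<Sigma>2 q * M"
  shows "io_equal S (output_trajectory S \<Sigma>1 x) (output_trajectory S \<Sigma>2 (M *\<^sub>v x))"
  unfolding io_equal_output_iff
proof (intro ballI)
  fix u p t assume u: "u \<in> inputs S" and p: "p \<in> schedulings S" and t: "t \<in> T"
  have "state_trajectory S \<Sigma>2 (M *\<^sub>v x) u p t = M *\<^sub>v state_trajectory S \<Sigma>1 x u p t"
  proof (rule state_trajectory_map[OF \<Sigma>1 \<Sigma>2 M x u u p _ t])
    fix s and y :: "real vec" assume s: "s \<in> T" and y: "y \<in> carrier_vec (dim_x \<Sigma>1)"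
    have q: "p s \<in> sched S" by (rule scheduling_sched[OF p s])
    note v = input_carrier[OF u s]
    note A1 = system_carrier(1)[OF \<Sigma>1, of "p s"] and B1 = system_carrier(2)[OF \<Sigma>1, of "p s"]
      and A2 = system_carrier(1)[OF \<Sigma>2, of "p s"]
    have "M *\<^sub>v state_rhs S \<Sigma>1 (p s) y (u s) = M *\<^sub>v (Amat \<Sigma>1 (p s) *\<^sub>v y) + M *\<^sub>v (Bmat \<Sigma>1 (p s) *\<^sub>v u s)"
      unfolding state_rhs_def
      by (rule mult_add_distrib_mat_vec[OF M mult_mat_vec_carrier[OF A1 y] mult_mat_vec_carrier[OF B1 v]])
    also have "M *\<^sub>v (Amat \<Sigma>1 (p s) *\<^sub>v y) = Amat \<Sigma>2 (p s) *\<^sub>v (M *\<^sub>v y)"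
      by (simp only: assoc_mult_mat_vec[OF M A1 y, symmetric] assoc_mult_mat_vec[OF A2 M y, symmetric] A[OF q])
    also have "M *\<^sub>v (Bmat \<Sigma>1 (p s) *\<^sub>v u s) = Bmat \<Sigma>2 (p s) *\<^sub>v u s"
      by (simp only: assoc_mult_mat_vec[OF M B1 v, symmetric] B[OF q])
    finally show "M *\<^sub>v state_rhs S \<Sigma>1 (p s) y (u s) = state_rhs S \<Sigma>2 (p s) (M *\<^sub>v y) (u s)"
      by (simp only: state_rhs_def)
  qed
  then show "Cmat \<Sigma>1 (p t) *\<^sub>v state_trajectory S \<Sigma>1 x u p t =
      Cmat \<Sigma>2 (p t) *\<^sub>v state_trajectory S \<Sigma>2 (M *\<^sub>v x) u p t"
    by (simp only: C[OF scheduling_sched[OF p t]]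
        assoc_mult_mat_vec[OF system_carrier(3)[OF \<Sigma>2] M state_trajectory_carrier[OF \<Sigma>1 u p x t]])
qed

lemma compress_properties:
  assumes \<Sigma>: "is_lpv_ssa S \<Sigma>" and E: "E \<in> carrier_mat (dim_x \<Sigma>) m" and F: "F \<in> carrier_mat m (dim_x \<Sigma>)"
  shows "is_lpv_ssa S (compress m F E \<Sigma>)" "dim_x (compress m F E \<Sigma>) = m"
    "Amat (compress m F E \<Sigma>) q = F * (Amat \<Sigma> q * E)" "Bmat (compress m F E \<Sigma>) q = F * Bmat \<Sigma> q"
    "Cmat (compress m F E \<Sigma>) q = Cmat \<Sigma> q * E"
proof -
  note c = coefficient_carrier[OF \<Sigma>]
  note AE = mult_carrier_mat[OF c(1) E]
  show "dim_x (compress m F E \<Sigma>) = m" by (simp add: compress_def)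
  show "is_lpv_ssa S (compress m F E \<Sigma>)"
    unfolding is_lpv_ssa_def compress_def lpv_ssa.simps
    by (intro allI impI conjI mult_carrier_mat[OF F AE] mult_carrier_mat[OF F c(2)] mult_carrier_mat[OF c(3) E])
  have "Amat (compress m F E \<Sigma>) q = affine_mat (n_p S) (\<lambda>l. F * (mat_A \<Sigma> l * E)) q"
    by (simp only: compress_def lpv_ssa.simps)
  also have "\<dots> = F * affine_mat (n_p S) (\<lambda>l. mat_A \<Sigma> l * E) q"
    by (rule affine_mat_mult_left[where M = "\<lambda>l. mat_A \<Sigma> l * E", OF AE F])
  also have "affine_mat (n_p S) (\<lambda>l. mat_A \<Sigma> l * E) q = Amat \<Sigma> q * E"
    by (rule affine_mat_mult_right[where M = "mat_A \<Sigma>", OF c(1) E])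
  finally show "Amat (compress m F E \<Sigma>) q = F * (Amat \<Sigma> q * E)" .
  have "Bmat (compress m F E \<Sigma>) q = affine_mat (n_p S) (\<lambda>l. F * mat_B \<Sigma> l) q"
    by (simp only: compress_def lpv_ssa.simps)
  also have "\<dots> = F * Bmat \<Sigma> q"
    by (rule affine_mat_mult_left[where M = "mat_B \<Sigma>", OF c(2) F])
  finally show "Bmat (compress m F E \<Sigma>) q = F * Bmat \<Sigma> q" .
  have "Cmat (compress m F E \<Sigma>) q = affine_mat (n_p S) (\<lambda>l. mat_C \<Sigma> l * E) q"
    by (simp only: compress_def lpv_ssa.simps)
  also have "\<dots> = Cmat \<Sigma> q * E"
    by (rule affine_mat_mult_right[where M = "mat_C \<Sigma>", OF c(3) E])
  finally show "Cmat (compress m F E \<Sigma>) q = Cmat \<Sigma> q * E" .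
qed

lemma minimal_wrt_dim_le:
  assumes "minimal_wrt S \<Sigma> x0" "is_lpv_ssa S \<Sigma>'" "x0' \<in> carrier_vec (dim_x \<Sigma>')"
    "io_equal S (output_trajectory S \<Sigma> x0) (output_trajectory S \<Sigma>' x0')"
  shows "dim_x \<Sigma> \<le> dim_x \<Sigma>'"
  using assms unfolding minimal_wrt_def is_minimal_realization_def is_realization_def by blast

definition reachable :: "lpv_ssa \<Rightarrow> real vec \<Rightarrow> real vec set" where
  "reachable \<Sigma> x0 = {state_trajectory S \<Sigma> x0 u p t | u p t. u \<in> inputs S \<and> p \<in> schedulings S \<and> t \<in> T}"

definition reachable_span :: "lpv_ssa \<Rightarrow> real vec \<Rightarrow> real vec set" where
  "reachable_span \<Sigma> x0 =
     LinearCombinations.module.span class_ring (module_vec TYPE(real) (dim_x \<Sigma>)) (reachable \<Sigma> x0)"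

lemma span_reachable_iff: "span_reachable S \<Sigma> x0 \<longleftrightarrow> reachable_span \<Sigma> x0 = carrier_vec (dim_x \<Sigma>)"
  by (simp only: span_reachable_def reachable_span_def reachable_def)

lemma reachable_carrier:
  assumes "is_lpv_ssa S \<Sigma>" "x0 \<in> carrier_vec (dim_x \<Sigma>)"
  shows "reachable \<Sigma> x0 \<subseteq> carrier_vec (dim_x \<Sigma>)"
  using state_trajectory_carrier[OF assms(1) _ _ assms(2)] by (auto simp: reachable_def)

text \<open>Membership in \<open>W\<close> is the linear equation \<open>Q x = 0\<close> for the
  quotient map of \<open>W\<close>, so the tangent argument is applied to \<open>Q\<close> and the
  zero matrix.\<close>

lemma tangent_in_subspace:
  assumes \<Sigma>: "is_lpv_ssa S \<Sigma>" and x: "x \<in> carrier_vec (dim_x \<Sigma>)" and W: "lin_subspace (dim_x \<Sigma>) W"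
    and q: "q \<in> sched S" and v: "v \<in> carrier_vec (n_u S)"
    and in_W: "\<And>t. t \<in> T \<Longrightarrow> state_trajectory S \<Sigma> x (const_signal v) (const_signal q) t \<in> W"
  shows "state_rhs S \<Sigma> q x v \<in> W"
proof -
  obtain m Q R where Q: "Q \<in> carrier_mat m (dim_x \<Sigma>)" and R: "R \<in> carrier_mat (dim_x \<Sigma>) m"
    and QW: "\<And>x. x \<in> W \<Longrightarrow> Q *\<^sub>v x = 0\<^sub>v m" and RQ: "\<And>x. x \<in> carrier_vec (dim_x \<Sigma>) \<Longrightarrow> R *\<^sub>v (Q *\<^sub>v x) - x \<in> W"
    using subspace_quotient[OF W] by metis
  note Z = zero_carrier_mat[of m "dim_x \<Sigma>"]
  have Z0: "0\<^sub>m m (dim_x \<Sigma>) *\<^sub>v y = (0\<^sub>v m :: real vec)" if "y \<in> carrier_vec (dim_x \<Sigma>)" for y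
    using that by (intro vec_eqI[OF mult_mat_vec_carrier[OF Z that] zero_carrier_vec]) simp
  note rc = state_rhs_carrier[OF \<Sigma> x v, of q]
  have "Q *\<^sub>v state_rhs S \<Sigma> q x v = 0\<^sub>m m (dim_x \<Sigma>) *\<^sub>v state_rhs S \<Sigma> q x v"
  proof (rule state_trajectory_tangent[OF \<Sigma> x Q \<Sigma> x Z q v])
    fix t assume t: "t \<in> T"
    then have "state_trajectory S \<Sigma> x (const_signal v) (const_signal q) t \<in> W" by (rule in_W)
    moreover from this have "state_trajectory S \<Sigma> x (const_signal v) (const_signal q) t \<in> carrier_vec (dim_x \<Sigma>)"
      using W by (auto simp: lin_subspace_def)
    ultimately show "Q *\<^sub>v state_trajectory S \<Sigma> x (const_signal v) (const_signal q) t =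
        0\<^sub>m m (dim_x \<Sigma>) *\<^sub>v state_trajectory S \<Sigma> x (const_signal v) (const_signal q) t"
      by (simp only: QW Z0)
  qed
  then have Q0: "Q *\<^sub>v state_rhs S \<Sigma> q x v = 0\<^sub>v m" by (simp only: Z0[OF rc])
  \<comment> \<open>The representative \<open>R (Q x)\<close> of the velocity is now 0, so 0 and the
    velocity differ by an element of \<open>W\<close>.\<close>
  have "0\<^sub>v (dim_x \<Sigma>) - state_rhs S \<Sigma> q x v \<in> W"
    using RQ[OF rc] unfolding Q0 mult_mat_zero_vec[OF R] .
  moreover have "0\<^sub>v (dim_x \<Sigma>) \<in> W" using W by (simp add: lin_subspace_def)
  ultimately have "0\<^sub>v (dim_x \<Sigma>) - (0\<^sub>v (dim_x \<Sigma>) - state_rhs S \<Sigma> q x v) \<in> W"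
    by (rule lin_subspace_diff[OF W, rotated])
  moreover have "0\<^sub>v (dim_x \<Sigma>) - (0\<^sub>v (dim_x \<Sigma>) - state_rhs S \<Sigma> q x v) = state_rhs S \<Sigma> q x v"
    using rc by (intro vec_eqI[of _ "dim_x \<Sigma>"]) auto
  ultimately show ?thesis by simp
qed

lemma minimal_imp_span_reachable:
  assumes \<Sigma>: "is_lpv_ssa S \<Sigma>" and x0: "x0 \<in> carrier_vec (dim_x \<Sigma>)" and min: "minimal_wrt S \<Sigma> x0"
    and ne: "sched S \<noteq> {}"
  shows "span_reachable S \<Sigma> x0"
proof (rule ccontr)
  assume nr: "\<not> span_reachable S \<Sigma> x0"
  let ?n = "dim_x \<Sigma>" and ?W = "reachable_span \<Sigma> x0" and ?R = "reachable \<Sigma> x0"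
  note span = span_lin_subspace[OF reachable_carrier[OF \<Sigma> x0], folded reachable_span_def]
  note W = span(1)
  obtain m E F where E: "E \<in> carrier_mat ?n m" and F: "F \<in> carrier_mat m ?n"
    and EW: "\<And>v. v \<in> carrier_vec m \<Longrightarrow> E *\<^sub>v v \<in> ?W" and id: "\<And>w. w \<in> ?W \<Longrightarrow> E *\<^sub>v (F *\<^sub>v w) = w"
    and mn: "?W \<noteq> carrier_vec ?n \<Longrightarrow> m < ?n"
    using subspace_projection[OF W] by metis
  \<comment> \<open>Continuing a run by constant signals stays in the reachable set, so the velocity
    at a reached state lies in the span.\<close>
  have rhsW: "state_rhs S \<Sigma> q x v \<in> ?W" if x: "x \<in> ?R" and q: "q \<in> sched S" and v: "v \<in> carrier_vec (n_u S)" for x q v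
  proof (rule tangent_in_subspace[OF \<Sigma> _ W q v])
    show "x \<in> carrier_vec ?n" using x reachable_carrier[OF \<Sigma> x0] by blast
    obtain u p s where s: "u \<in> inputs S" "p \<in> schedulings S" "s \<in> T" and xs: "x = state_trajectory S \<Sigma> x0 u p s"
      using x by (auto simp: reachable_def)
    fix t assume t: "t \<in> T"
    have "state_trajectory S \<Sigma> x (const_signal v) (const_signal q) t =
        state_trajectory S \<Sigma> x0 (concat_signal s u (const_signal v)) (concat_signal s p (const_signal q)) (s + t)"
      unfolding xs by (rule state_trajectory_concat[OF \<Sigma> x0 s(1) inputs_const[OF v] s(2) schedulings_const[OF q] s(3) t, symmetric])
    also have "\<dots> \<in> ?R"
      unfolding reachable_def using inputs_concat[OF s(1) inputs_const[OF v] s(3)]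
        schedulings_concat[OF s(2) schedulings_const[OF q] s(3)] time_axis_add[OF s(3) t] by blast
    finally show "state_trajectory S \<Sigma> x (const_signal v) (const_signal q) t \<in> ?W" using span(2) by blast
  qed
  \<comment> \<open>Zero input reduces the velocity to \<open>A(q) x\<close> at reachable states;
    the condition is linear in \<open>x\<close> and extends to the span.\<close>
  have AW: "Amat \<Sigma> q *\<^sub>v x \<in> ?W" if x: "x \<in> ?W" and q: "q \<in> sched S" for x q
  proof -
    have "?R \<subseteq> {x \<in> carrier_vec ?n. Amat \<Sigma> q *\<^sub>v x \<in> ?W}"
    proof
      fix y assume y: "y \<in> ?R"
      then have yc: "y \<in> carrier_vec ?n" using reachable_carrier[OF \<Sigma> x0] by blast
      have "Amat \<Sigma> q *\<^sub>v y \<in> ?W"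
        using rhsW[OF y q zero_carrier_vec] unfolding state_rhs_zero_input[OF \<Sigma> yc] .
      then show "y \<in> {x \<in> carrier_vec ?n. Amat \<Sigma> q *\<^sub>v x \<in> ?W}" using yc by simp
    qed
    then have "?W \<subseteq> {x \<in> carrier_vec ?n. Amat \<Sigma> q *\<^sub>v x \<in> ?W}"
      by (rule span(3)[OF lin_subspace_preimage[OF system_carrier(1)[OF \<Sigma>] W]])
    then show ?thesis using x by blast
  qed
  \<comment> \<open>The initial state is reached at time 0, provided that some scheduling signal
    exists.\<close>
  have x0R: "x0 \<in> ?R"
  proof -
    obtain q where q: "q \<in> sched S" using ne by blast
    have "x0 = state_trajectory S \<Sigma> x0 no_input (const_signal q) 0"
      by (rule state_trajectory_0[OF \<Sigma> zero_input schedulings_const[OF q] x0, symmetric])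
    then show ?thesis unfolding reachable_def using zero_input schedulings_const[OF q] time_axis_zero by blast
  qed
  have BW: "Bmat \<Sigma> q *\<^sub>v v \<in> ?W" if q: "q \<in> sched S" and v: "v \<in> carrier_vec (n_u S)" for q v
  proof -
    note Ax = mult_mat_vec_carrier[OF system_carrier(1)[OF \<Sigma>, of q] x0]
      and Bv = mult_mat_vec_carrier[OF system_carrier(2)[OF \<Sigma>, of q] v]
    have "state_rhs S \<Sigma> q x0 v - Amat \<Sigma> q *\<^sub>v x0 \<in> ?W"
      by (rule lin_subspace_diff[OF W rhsW[OF x0R q v] AW[OF _ q]]) (use span(2) x0R in blast)
    moreover have "state_rhs S \<Sigma> q x0 v - Amat \<Sigma> q *\<^sub>v x0 = Bmat \<Sigma> q *\<^sub>v v"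
      unfolding state_rhs_def by (rule vec_add_diff_cancel_left[OF Ax Bv])
    ultimately show ?thesis by simp
  qed
  let ?\<Sigma>' = "compress m F E \<Sigma>"
  note cp = compress_properties[OF \<Sigma> E F]
  have E': "E \<in> carrier_mat (dim_x \<Sigma>) (dim_x ?\<Sigma>')" unfolding cp(2) by (rule E)
  have Fx0: "F *\<^sub>v x0 \<in> carrier_vec (dim_x ?\<Sigma>')" unfolding cp(2) by (rule mult_mat_vec_carrier[OF F x0])
  \<comment> \<open>The inclusion \<open>E\<close> intertwines the two systems because
    \<open>E F\<close> is the identity on the span, which contains both \<open>A(q) E y\<close> and
    \<open>B(q) y\<close>.\<close>
  have "io_equal S (output_trajectory S ?\<Sigma>' (F *\<^sub>v x0)) (output_trajectory S \<Sigma> (E *\<^sub>v (F *\<^sub>v x0)))"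
  proof (rule io_equal_intertwine[OF cp(1) \<Sigma> E' Fx0])
    fix q assume q: "q \<in> sched S"
    note A = system_carrier(1)[OF \<Sigma>, of q] and B = system_carrier(2)[OF \<Sigma>, of q]
    note AE = mult_carrier_mat[OF A E]
    show "E * Amat ?\<Sigma>' q = Amat \<Sigma> q * E"
      unfolding cp(3)
    proof (rule mat_eq_if_mult_vec_eq[OF mult_carrier_mat[OF E mult_carrier_mat[OF F AE]] AE])
      fix y :: "real vec" assume y: "y \<in> carrier_vec m"
      have "(E * (F * (Amat \<Sigma> q * E))) *\<^sub>v y = E *\<^sub>v (F *\<^sub>v (Amat \<Sigma> q *\<^sub>v (E *\<^sub>v y)))"
        by (simp only: assoc_mult_mat_vec[OF E mult_carrier_mat[OF F AE] y] assoc_mult_mat_vec[OF F AE y] assoc_mult_mat_vec[OF A E y])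
      also have "\<dots> = Amat \<Sigma> q *\<^sub>v (E *\<^sub>v y)" by (rule id[OF AW[OF EW[OF y] q]])
      finally show "(E * (F * (Amat \<Sigma> q * E))) *\<^sub>v y = (Amat \<Sigma> q * E) *\<^sub>v y"
        by (simp only: assoc_mult_mat_vec[OF A E y])
    qed
    show "E * Bmat ?\<Sigma>' q = Bmat \<Sigma> q"
      unfolding cp(4)
    proof (rule mat_eq_if_mult_vec_eq[OF mult_carrier_mat[OF E mult_carrier_mat[OF F B]] B])
      fix y :: "real vec" assume y: "y \<in> carrier_vec (n_u S)"
      show "(E * (F * Bmat \<Sigma> q)) *\<^sub>v y = Bmat \<Sigma> q *\<^sub>v y"
        by (simp only: assoc_mult_mat_vec[OF E mult_carrier_mat[OF F B] y] assoc_mult_mat_vec[OF F B y] id[OF BW[OF q y]])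
    qed
    show "Cmat ?\<Sigma>' q = Cmat \<Sigma> q * E" by (rule cp(5))
  qed
  moreover have "E *\<^sub>v (F *\<^sub>v x0) = x0" by (rule id) (use span(2) x0R in blast)
  ultimately have "io_equal S (output_trajectory S \<Sigma> x0) (output_trajectory S ?\<Sigma>' (F *\<^sub>v x0))"
    by (simp add: io_equal_sym)
  then have "?n \<le> m" using minimal_wrt_dim_le[OF min cp(1) Fx0] cp(2) by simp
  with mn nr show False by (simp add: span_reachable_iff)
qed

end

section \<open>Unobservable states and the quotient system\<close>

context lpv
begin

text \<open>By superposition the input cancels when the outputs from two states are compared, so
  indistinguishability is decided by the zero-input output of their difference.\<close>

definition unobservable :: "lpv_ssa \<Rightarrow> real vec set" where
  "unobservable \<Sigma> = {x \<in> carrier_vec (dim_x \<Sigma>). \<forall>p\<in>schedulings S. \<forall>t\<in>T.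
     Cmat \<Sigma> (p t) *\<^sub>v state_trajectory S \<Sigma> x no_input p t = 0\<^sub>v (n_y S)}"

lemma output_add:
  assumes \<Sigma>: "is_lpv_ssa S \<Sigma>" and x: "x \<in> carrier_vec (dim_x \<Sigma>)" and y: "y \<in> carrier_vec (dim_x \<Sigma>)"
    and u: "u \<in> inputs S" and p: "p \<in> schedulings S" and t: "t \<in> T"
  shows "Cmat \<Sigma> (p t) *\<^sub>v state_trajectory S \<Sigma> (x + y) u p t =
    Cmat \<Sigma> (p t) *\<^sub>v state_trajectory S \<Sigma> x u p t +
    Cmat \<Sigma> (p t) *\<^sub>v state_trajectory S \<Sigma> y no_input p t"
  unfolding state_trajectory_add[OF \<Sigma> x y u p t]
  by (rule mult_add_distrib_mat_vec[OF system_carrier(3)[OF \<Sigma>] state_trajectory_carrier[OF \<Sigma> u p x t]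
        state_trajectory_carrier[OF \<Sigma> zero_input p y t]])

lemma output_smult:
  assumes \<Sigma>: "is_lpv_ssa S \<Sigma>" and x: "x \<in> carrier_vec (dim_x \<Sigma>)" and p: "p \<in> schedulings S" and t: "t \<in> T"
  shows "Cmat \<Sigma> (p t) *\<^sub>v state_trajectory S \<Sigma> (c \<cdot>\<^sub>v x) no_input p t =
    c \<cdot>\<^sub>v (Cmat \<Sigma> (p t) *\<^sub>v state_trajectory S \<Sigma> x no_input p t)"
  unfolding state_trajectory_smult[OF \<Sigma> x p t]
  by (rule mult_mat_vec[OF system_carrier(3)[OF \<Sigma>] state_trajectory_carrier[OF \<Sigma> zero_input p x t]])

lemma output_carrier:
  assumes "is_lpv_ssa S \<Sigma>" "x \<in> carrier_vec (dim_x \<Sigma>)" "u \<in> inputs S" "p \<in> schedulings S" "t \<in> T"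
  shows "Cmat \<Sigma> (p t) *\<^sub>v state_trajectory S \<Sigma> x u p t \<in> carrier_vec (n_y S)"
  by (rule mult_mat_vec_carrier[OF system_carrier(3)[OF assms(1)] state_trajectory_carrier[OF assms(1,3,4,2,5)]])

lemma zero_in_unobservable:
  assumes \<Sigma>: "is_lpv_ssa S \<Sigma>"
  shows "0\<^sub>v (dim_x \<Sigma>) \<in> unobservable \<Sigma>"
  unfolding unobservable_def
proof (intro CollectI conjI ballI)
  fix p t assume p: "p \<in> schedulings S" and t: "t \<in> T"
  let ?z = "0\<^sub>v (dim_x \<Sigma>) :: real vec"
  \<comment> \<open>Writing the zero vector as a multiple of itself reduces the claim to homogeneity
    of the output.\<close>
  have z: "?z = 0 \<cdot>\<^sub>v ?z" by (intro vec_eqI[of _ "dim_x \<Sigma>"]) auto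
  have "Cmat \<Sigma> (p t) *\<^sub>v state_trajectory S \<Sigma> (0 \<cdot>\<^sub>v ?z) no_input p t =
      0 \<cdot>\<^sub>v (Cmat \<Sigma> (p t) *\<^sub>v state_trajectory S \<Sigma> ?z no_input p t)"
    by (rule output_smult[OF \<Sigma> zero_carrier_vec p t])
  also have "\<dots> = 0\<^sub>v (n_y S)"
    by (rule zero_smult_vec[OF output_carrier[OF \<Sigma> zero_carrier_vec zero_input p t]])
  finally show "Cmat \<Sigma> (p t) *\<^sub>v state_trajectory S \<Sigma> ?z no_input p t = 0\<^sub>v (n_y S)"
    by (simp only: z[symmetric])
qed simp

lemma unobservable_lin_subspace:
  assumes \<Sigma>: "is_lpv_ssa S \<Sigma>"
  shows "lin_subspace (dim_x \<Sigma>) (unobservable \<Sigma>)"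
  unfolding lin_subspace_def
proof (intro conjI ballI allI)
  show "unobservable \<Sigma> \<subseteq> carrier_vec (dim_x \<Sigma>)" by (auto simp: unobservable_def)
  show "0\<^sub>v (dim_x \<Sigma>) \<in> unobservable \<Sigma>" by (rule zero_in_unobservable[OF \<Sigma>])
  fix v w and c :: real assume v: "v \<in> unobservable \<Sigma>"
  then have vc: "v \<in> carrier_vec (dim_x \<Sigma>)" by (simp add: unobservable_def)
  show "c \<cdot>\<^sub>v v \<in> unobservable \<Sigma>"
    using v by (simp add: unobservable_def output_smult[OF \<Sigma> vc] smult_zero_vec)
  assume w: "w \<in> unobservable \<Sigma>"
  then have wc: "w \<in> carrier_vec (dim_x \<Sigma>)" by (simp add: unobservable_def)
  show "v + w \<in> unobservable \<Sigma>"
    using v w by (simp add: unobservable_def output_add[OF \<Sigma> vc wc zero_input])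
qed

text \<open>Adding an unobservable state changes no output, whatever the input; conversely, states
  with equal outputs differ by an unobservable one.\<close>

lemma observable_iff:
  assumes \<Sigma>: "is_lpv_ssa S \<Sigma>"
  shows "observable S \<Sigma> \<longleftrightarrow> unobservable \<Sigma> = {0\<^sub>v (dim_x \<Sigma>)}"
proof
  assume obs: "observable S \<Sigma>"
  have "x = 0\<^sub>v (dim_x \<Sigma>)" if x: "x \<in> unobservable \<Sigma>" for x
  proof -
    have xc: "x \<in> carrier_vec (dim_x \<Sigma>)" using x by (simp add: unobservable_def)
    have "io_equal S (output_trajectory S \<Sigma> (0\<^sub>v (dim_x \<Sigma>) + x)) (output_trajectory S \<Sigma> (0\<^sub>v (dim_x \<Sigma>)))"
      unfolding io_equal_output_iff
    proof (intro ballI)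
      fix u p t assume u: "u \<in> inputs S" and p: "p \<in> schedulings S" and t: "t \<in> T"
      have "Cmat \<Sigma> (p t) *\<^sub>v state_trajectory S \<Sigma> x no_input p t = 0\<^sub>v (n_y S)"
        using x p t by (simp add: unobservable_def)
      then show "Cmat \<Sigma> (p t) *\<^sub>v state_trajectory S \<Sigma> (0\<^sub>v (dim_x \<Sigma>) + x) u p t =
          Cmat \<Sigma> (p t) *\<^sub>v state_trajectory S \<Sigma> (0\<^sub>v (dim_x \<Sigma>)) u p t"
        by (simp only: output_add[OF \<Sigma> zero_carrier_vec xc u p t] right_zero_vec[OF output_carrier[OF \<Sigma> zero_carrier_vec u p t]])
    qed
    then have "0\<^sub>v (dim_x \<Sigma>) + x = 0\<^sub>v (dim_x \<Sigma>)"
      using obs add_carrier_vec[OF zero_carrier_vec xc] zero_carrier_vec unfolding observable_def by blast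
    then show ?thesis using xc by simp
  qed
  then show "unobservable \<Sigma> = {0\<^sub>v (dim_x \<Sigma>)}" using zero_in_unobservable[OF \<Sigma>] by blast
next
  assume triv: "unobservable \<Sigma> = {0\<^sub>v (dim_x \<Sigma>)}"
  show "observable S \<Sigma>"
    unfolding observable_def
  proof (intro ballI impI)
    fix x y assume x: "x \<in> carrier_vec (dim_x \<Sigma>)" and y: "y \<in> carrier_vec (dim_x \<Sigma>)"
      and eq: "io_equal S (output_trajectory S \<Sigma> x) (output_trajectory S \<Sigma> y)"
    have d: "x - y \<in> carrier_vec (dim_x \<Sigma>)" by (rule minus_carrier_vec[OF x y])
    have xy: "y + (x - y) = x" using x y by (intro vec_eqI[of _ "dim_x \<Sigma>"]) auto
    have "x - y \<in> unobservable \<Sigma>"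
      unfolding unobservable_def
    proof (intro CollectI conjI ballI d)
      fix p t assume p: "p \<in> schedulings S" and t: "t \<in> T"
      have "Cmat \<Sigma> (p t) *\<^sub>v state_trajectory S \<Sigma> y no_input p t +
          Cmat \<Sigma> (p t) *\<^sub>v state_trajectory S \<Sigma> (x - y) no_input p t =
          Cmat \<Sigma> (p t) *\<^sub>v state_trajectory S \<Sigma> y no_input p t"
        using output_add[OF \<Sigma> y d zero_input p t] eq zero_input p t
        unfolding io_equal_output_iff xy by simp
      then show "Cmat \<Sigma> (p t) *\<^sub>v state_trajectory S \<Sigma> (x - y) no_input p t = 0\<^sub>v (n_y S)"
        by (rule vec_add_cancel_left[OF output_carrier[OF \<Sigma> y zero_input p t] output_carrier[OF \<Sigma> d zero_input p t]])
    qed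
    then have "x - y = 0\<^sub>v (dim_x \<Sigma>)" using triv by simp
    then show "x = y" using xy y by simp
  qed
qed

text \<open>After time \<open>s\<close> without input, the future output is a tail of the output
  from \<open>x\<close> under a concatenated scheduling, hence zero. So the run stays in the
  unobservable subspace, and its velocity lies there as well. The output at time 0 gives the claim
  on \<open>C\<close>.\<close>

lemma unobservable_invariant:
  assumes \<Sigma>: "is_lpv_ssa S \<Sigma>" and x: "x \<in> unobservable \<Sigma>" and q: "q \<in> sched S"
  shows "Amat \<Sigma> q *\<^sub>v x \<in> unobservable \<Sigma>" "Cmat \<Sigma> q *\<^sub>v x = 0\<^sub>v (n_y S)"
proof -
  let ?o = "no_input"
  have xc: "x \<in> carrier_vec (dim_x \<Sigma>)" using x by (simp add: unobservable_def)
  note p = schedulings_const[OF q]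
  have "state_rhs S \<Sigma> q x (0\<^sub>v (n_u S)) \<in> unobservable \<Sigma>"
  proof (rule tangent_in_subspace[OF \<Sigma> xc unobservable_lin_subspace[OF \<Sigma>] q zero_carrier_vec])
    fix s assume s: "s \<in> T"
    let ?y = "state_trajectory S \<Sigma> x ?o (const_signal q) s"
    show "?y \<in> unobservable \<Sigma>"
      unfolding unobservable_def
    proof (intro CollectI conjI ballI state_trajectory_carrier[OF \<Sigma> zero_input p xc s])
      fix p' t assume p': "p' \<in> schedulings S" and t: "t \<in> T"
      have "state_trajectory S \<Sigma> ?y ?o p' t =
          state_trajectory S \<Sigma> x ?o (concat_signal s (const_signal q) p') (s + t)"
        using state_trajectory_concat[OF \<Sigma> xc zero_input zero_input p p' s t]
        by (simp only: concat_const_signal[OF s])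
      moreover have "Cmat \<Sigma> (concat_signal s (const_signal q) p' (s + t)) *\<^sub>v
          state_trajectory S \<Sigma> x ?o (concat_signal s (const_signal q) p') (s + t) = 0\<^sub>v (n_y S)"
        using x schedulings_concat[OF p p' s] time_axis_add[OF s t] by (simp add: unobservable_def)
      ultimately show "Cmat \<Sigma> (p' t) *\<^sub>v state_trajectory S \<Sigma> ?y ?o p' t = 0\<^sub>v (n_y S)"
        by (simp only: concat_signal_shift[OF s t])
    qed
  qed
  then show "Amat \<Sigma> q *\<^sub>v x \<in> unobservable \<Sigma>" by (simp only: state_rhs_zero_input[OF \<Sigma> xc])
  have "Cmat \<Sigma> (const_signal q 0) *\<^sub>v state_trajectory S \<Sigma> x ?o (const_signal q) 0 = 0\<^sub>v (n_y S)"
    using x p time_axis_zero[of "time S"] unfolding unobservable_def by blast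
  then show "Cmat \<Sigma> q *\<^sub>v x = 0\<^sub>v (n_y S)"
    unfolding state_trajectory_0[OF \<Sigma> zero_input p xc] by (simp add: const_signal_def)
qed

lemma minimal_imp_observable:
  assumes \<Sigma>: "is_lpv_ssa S \<Sigma>" and x0: "x0 \<in> carrier_vec (dim_x \<Sigma>)" and min: "minimal_wrt S \<Sigma> x0"
  shows "observable S \<Sigma>"
proof (rule ccontr)
  assume no: "\<not> observable S \<Sigma>"
  let ?n = "dim_x \<Sigma>" and ?N = "unobservable \<Sigma>"
  note N = unobservable_lin_subspace[OF \<Sigma>]
  obtain m Q R where Q: "Q \<in> carrier_mat m ?n" and R: "R \<in> carrier_mat ?n m"
    and QN: "\<And>x. x \<in> ?N \<Longrightarrow> Q *\<^sub>v x = 0\<^sub>v m"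
    and RQ: "\<And>x. x \<in> carrier_vec ?n \<Longrightarrow> R *\<^sub>v (Q *\<^sub>v x) - x \<in> ?N" and mn: "?N \<noteq> {0\<^sub>v ?n} \<Longrightarrow> m < ?n"
    using subspace_quotient[OF N] by metis
  \<comment> \<open>\<open>R (Q x)\<close> differs from \<open>x\<close> by an unobservable vector,
    so a map that kills those factors through \<open>Q\<close>. This is applied to
    \<open>Q A(q)\<close> and to \<open>C(q)\<close>.\<close>
  have mod: "K *\<^sub>v (R *\<^sub>v (Q *\<^sub>v x)) = K *\<^sub>v x"
    if K: "K \<in> carrier_mat k ?n" and KN: "\<And>x. x \<in> ?N \<Longrightarrow> K *\<^sub>v x = 0\<^sub>v k" and x: "x \<in> carrier_vec ?n" for K k x
  proof -
    note RQx = mult_mat_vec_carrier[OF R mult_mat_vec_carrier[OF Q x]]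
    have eq: "x + (R *\<^sub>v (Q *\<^sub>v x) - x) = R *\<^sub>v (Q *\<^sub>v x)"
      using x RQx by (intro vec_eqI[of _ ?n]) (auto simp del: index_mult_mat_vec)
    have "K *\<^sub>v (x + (R *\<^sub>v (Q *\<^sub>v x) - x)) = K *\<^sub>v x + 0\<^sub>v k"
      unfolding mult_add_distrib_mat_vec[OF K x minus_carrier_vec[OF RQx x]] KN[OF RQ[OF x]] ..
    then show ?thesis unfolding eq by (simp only: right_zero_vec[OF mult_mat_vec_carrier[OF K x]])
  qed
  let ?\<Sigma>' = "compress m Q R \<Sigma>"
  note cp = compress_properties[OF \<Sigma> R Q]
  have Q': "Q \<in> carrier_mat (dim_x ?\<Sigma>') (dim_x \<Sigma>)" unfolding cp(2) by (rule Q)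
  have Qx0: "Q *\<^sub>v x0 \<in> carrier_vec (dim_x ?\<Sigma>')" unfolding cp(2) by (rule mult_mat_vec_carrier[OF Q x0])
  have "io_equal S (output_trajectory S \<Sigma> x0) (output_trajectory S ?\<Sigma>' (Q *\<^sub>v x0))"
  proof (rule io_equal_intertwine[OF \<Sigma> cp(1) Q' x0])
    fix q assume q: "q \<in> sched S"
    note A = system_carrier(1)[OF \<Sigma>, of q] and B = system_carrier(2)[OF \<Sigma>, of q] and C = system_carrier(3)[OF \<Sigma>, of q]
    note QA = mult_carrier_mat[OF Q A] and AR = mult_carrier_mat[OF A R] and CR = mult_carrier_mat[OF C R]
    note QAR = mult_carrier_mat[OF Q AR]
    show "Q * Amat \<Sigma> q = Amat ?\<Sigma>' q * Q"
      unfolding cp(3)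
    proof (rule mat_eq_if_mult_vec_eq[OF QA mult_carrier_mat[OF QAR Q]])
      fix y :: "real vec" assume y: "y \<in> carrier_vec ?n"
      note Qy = mult_mat_vec_carrier[OF Q y]
      have "(Q * (Amat \<Sigma> q * R) * Q) *\<^sub>v y = Q *\<^sub>v (Amat \<Sigma> q *\<^sub>v (R *\<^sub>v (Q *\<^sub>v y)))"
        by (simp only: assoc_mult_mat_vec[OF QAR Q y] assoc_mult_mat_vec[OF Q AR Qy] assoc_mult_mat_vec[OF A R Qy])
      also have "\<dots> = (Q * Amat \<Sigma> q) *\<^sub>v (R *\<^sub>v (Q *\<^sub>v y))"
        by (rule assoc_mult_mat_vec[OF Q A mult_mat_vec_carrier[OF R Qy], symmetric])
      also have "\<dots> = (Q * Amat \<Sigma> q) *\<^sub>v y"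
      proof (rule mod[OF QA _ y])
        fix x assume x: "x \<in> ?N"
        then have xc: "x \<in> carrier_vec ?n" using N by (auto simp: lin_subspace_def)
        show "(Q * Amat \<Sigma> q) *\<^sub>v x = 0\<^sub>v m"
          unfolding assoc_mult_mat_vec[OF Q A xc] by (rule QN[OF unobservable_invariant(1)[OF \<Sigma> x q]])
      qed
      finally show "(Q * Amat \<Sigma> q) *\<^sub>v y = (Q * (Amat \<Sigma> q * R) * Q) *\<^sub>v y" by (rule sym)
    qed
    show "Q * Bmat \<Sigma> q = Bmat ?\<Sigma>' q" by (rule cp(4)[symmetric])
    show "Cmat \<Sigma> q = Cmat ?\<Sigma>' q * Q"
      unfolding cp(5)
    proof (rule mat_eq_if_mult_vec_eq[OF C mult_carrier_mat[OF CR Q]])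
      fix y :: "real vec" assume y: "y \<in> carrier_vec ?n"
      note Qy = mult_mat_vec_carrier[OF Q y]
      have "(Cmat \<Sigma> q * R * Q) *\<^sub>v y = Cmat \<Sigma> q *\<^sub>v (R *\<^sub>v (Q *\<^sub>v y))"
        by (simp only: assoc_mult_mat_vec[OF CR Q y] assoc_mult_mat_vec[OF C R Qy])
      also have "\<dots> = Cmat \<Sigma> q *\<^sub>v y"
        by (rule mod[OF C unobservable_invariant(2)[OF \<Sigma> _ q] y])
      finally show "Cmat \<Sigma> q *\<^sub>v y = (Cmat \<Sigma> q * R * Q) *\<^sub>v y" by (rule sym)
    qed
  qed
  then have "?n \<le> m" using minimal_wrt_dim_le[OF min cp(1) Qx0] cp(2) by simp
  with mn no show False by (simp add: observable_iff[OF \<Sigma>])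
qed

end

section \<open>State pairs of two systems with the same input-output map\<close>

text \<open>The linear span inside the product of two state spaces, written as a closure of pairs so
  that no product space is formed. The zero pair arises by scaling a generator with 0.\<close>

inductive_set pair_span :: "(real vec \<times> real vec) set \<Rightarrow> (real vec \<times> real vec) set"
  for G :: "(real vec \<times> real vec) set" where
  base: "(x, y) \<in> G \<Longrightarrow> (x, y) \<in> pair_span G"
| add: "(x, y) \<in> pair_span G \<Longrightarrow> (x', y') \<in> pair_span G \<Longrightarrow> (x + x', y + y') \<in> pair_span G"
| smult: "(x, y) \<in> pair_span G \<Longrightarrow> (c \<cdot>\<^sub>v x, c \<cdot>\<^sub>v y) \<in> pair_span G"

locale lpv_pair = lpv +
  fixes \<Sigma> \<Sigma>' :: lpv_ssa and x0 x0' :: "real vec"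
  assumes \<Sigma>: "is_lpv_ssa S \<Sigma>" and x0: "x0 \<in> carrier_vec (dim_x \<Sigma>)"
    and \<Sigma>': "is_lpv_ssa S \<Sigma>'" and x0': "x0' \<in> carrier_vec (dim_x \<Sigma>')"
    and io: "io_equal S (output_trajectory S \<Sigma> x0) (output_trajectory S \<Sigma>' x0')"
    and sched_ne: "sched S \<noteq> {}"
begin

definition joint :: "(real vec \<times> real vec) set" where
  "joint = pair_span {(state_trajectory S \<Sigma> x0 u p t, state_trajectory S \<Sigma>' x0' u p t) | u p t.
     u \<in> inputs S \<and> p \<in> schedulings S \<and> t \<in> T}"

lemma joint_reachable:
  "u \<in> inputs S \<Longrightarrow> p \<in> schedulings S \<Longrightarrow> t \<in> T \<Longrightarrow>
    (state_trajectory S \<Sigma> x0 u p t, state_trajectory S \<Sigma>' x0' u p t) \<in> joint"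
  unfolding joint_def by (rule pair_span.base) blast

lemma joint_carrier:
  assumes "(x, y) \<in> joint"
  shows "x \<in> carrier_vec (dim_x \<Sigma>) \<and> y \<in> carrier_vec (dim_x \<Sigma>')"
  using assms unfolding joint_def
proof (induction rule: pair_span.induct)
  case (base x y)
  then show ?case using state_trajectory_carrier[OF \<Sigma> _ _ x0] state_trajectory_carrier[OF \<Sigma>' _ _ x0'] by blast
qed simp_all

text \<open>For a generator, continuing the common run without input produces a tail of two equal
  outputs. Zero-input outputs are linear in the state, so the equality survives sums and
  multiples.\<close>

lemma joint_output:
  assumes "(x, y) \<in> joint" and p: "p \<in> schedulings S" and t: "t \<in> T"
  shows "Cmat \<Sigma> (p t) *\<^sub>v state_trajectory S \<Sigma> x no_input p t =
    Cmat \<Sigma>' (p t) *\<^sub>v state_trajectory S \<Sigma>' y no_input p t"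
  using assms(1) unfolding joint_def
proof (induction rule: pair_span.induct)
  case (base x y)
  then obtain u p1 s where u: "u \<in> inputs S" and p1: "p1 \<in> schedulings S" and s: "s \<in> T"
    and x: "x = state_trajectory S \<Sigma> x0 u p1 s" and y: "y = state_trajectory S \<Sigma>' x0' u p1 s"
    by blast
  let ?u = "concat_signal s u no_input" and ?p = "concat_signal s p1 p"
  have "Cmat \<Sigma> (?p (s + t)) *\<^sub>v state_trajectory S \<Sigma> x0 ?u ?p (s + t) =
      Cmat \<Sigma>' (?p (s + t)) *\<^sub>v state_trajectory S \<Sigma>' x0' ?u ?p (s + t)"
    using io inputs_concat[OF u zero_input s] schedulings_concat[OF p1 p s] time_axis_add[OF s t]
    unfolding io_equal_output_iff by blast
  then show ?case
    unfolding x y state_trajectory_concat[OF \<Sigma> x0 u zero_input p1 p s t]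
      state_trajectory_concat[OF \<Sigma>' x0' u zero_input p1 p s t] concat_signal_shift[OF s t] .
next
  case (add x y x' y')
  then have c: "x \<in> carrier_vec (dim_x \<Sigma>)" "x' \<in> carrier_vec (dim_x \<Sigma>)"
    "y \<in> carrier_vec (dim_x \<Sigma>')" "y' \<in> carrier_vec (dim_x \<Sigma>')"
    using joint_carrier unfolding joint_def by blast+
  show ?case
    unfolding output_add[OF \<Sigma> c(1,2) zero_input p t] output_add[OF \<Sigma>' c(3,4) zero_input p t] add.IH ..
next
  case (smult x y c)
  then have c: "x \<in> carrier_vec (dim_x \<Sigma>)" "y \<in> carrier_vec (dim_x \<Sigma>')"
    using joint_carrier unfolding joint_def by blast+
  show ?case
    unfolding output_smult[OF \<Sigma> c(1) p t] output_smult[OF \<Sigma>' c(2) p t] smult.IH ..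
qed

text \<open>A partner of the zero state shares its vanishing zero-input output, hence is
  unobservable.\<close>

lemma joint_zero_right:
  assumes obs: "observable S \<Sigma>" and "(x, 0\<^sub>v (dim_x \<Sigma>')) \<in> joint"
  shows "x = 0\<^sub>v (dim_x \<Sigma>)"
proof -
  have "x \<in> unobservable \<Sigma>"
    using joint_carrier[OF assms(2)] joint_output[OF assms(2)] zero_in_unobservable[OF \<Sigma>']
    by (simp add: unobservable_def)
  then show ?thesis using obs by (simp add: observable_iff[OF \<Sigma>])
qed

lemma joint_zero_left:
  assumes obs: "observable S \<Sigma>'" and "(0\<^sub>v (dim_x \<Sigma>), y) \<in> joint"
  shows "y = 0\<^sub>v (dim_x \<Sigma>')"
proof -
  have "y \<in> unobservable \<Sigma>'"
    using joint_carrier[OF assms(2)] joint_output[OF assms(2), symmetric] zero_in_unobservable[OF \<Sigma>]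
    by (simp add: unobservable_def)
  then show ?thesis using obs by (simp add: observable_iff[OF \<Sigma>'])
qed

lemma joint_zero: "(0\<^sub>v (dim_x \<Sigma>), 0\<^sub>v (dim_x \<Sigma>')) \<in> joint"
proof -
  obtain q where q: "q \<in> sched S" using sched_ne by blast
  note p = schedulings_const[OF q]
  let ?x = "state_trajectory S \<Sigma> x0 no_input (const_signal q) 0"
    and ?y = "state_trajectory S \<Sigma>' x0' no_input (const_signal q) 0"
  have "(0 \<cdot>\<^sub>v ?x, 0 \<cdot>\<^sub>v ?y) \<in> joint"
    using pair_span.smult[OF joint_reachable[OF zero_input p time_axis_zero, unfolded joint_def]] unfolding joint_def .
  then show ?thesis
    unfolding zero_smult_vec[OF state_trajectory_carrier[OF \<Sigma> zero_input p x0 time_axis_zero]]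
      zero_smult_vec[OF state_trajectory_carrier[OF \<Sigma>' zero_input p x0' time_axis_zero]] .
qed

text \<open>The first components of joint pairs form a subspace that contains all reachable
  states.\<close>

lemma joint_total:
  assumes reach: "span_reachable S \<Sigma> x0" and x: "x \<in> carrier_vec (dim_x \<Sigma>)"
  shows "\<exists>y. (x, y) \<in> joint"
proof -
  let ?U = "{x. \<exists>y. (x, y) \<in> joint}"
  have U: "lin_subspace (dim_x \<Sigma>) ?U"
    unfolding lin_subspace_def
  proof (intro conjI ballI allI)
    show "?U \<subseteq> carrier_vec (dim_x \<Sigma>)" using joint_carrier by blast
    show "0\<^sub>v (dim_x \<Sigma>) \<in> ?U" using joint_zero by blast
    show "v + w \<in> ?U" if "v \<in> ?U" "w \<in> ?U" for v w
      using that unfolding joint_def by (blast intro: pair_span.add)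
    show "c \<cdot>\<^sub>v v \<in> ?U" if "v \<in> ?U" for c v
      using that unfolding joint_def by (blast intro: pair_span.smult)
  qed
  have "reachable \<Sigma> x0 \<subseteq> ?U" using joint_reachable by (auto simp: reachable_def)
  then have "reachable_span \<Sigma> x0 \<subseteq> ?U"
    unfolding reachable_span_def by (rule span_lin_subspace(3)[OF reachable_carrier[OF \<Sigma> x0] U])
  then show ?thesis using reach x by (auto simp: span_reachable_iff)
qed

text \<open>Partners of the unit vectors are chosen arbitrarily and become the columns of
  \<open>Y\<close>; linearity of the joint span then pairs \<open>x\<close> with \<open>Y x\<close>.
  That partners are unique is a later matter, settled by observability of
  \<open>\<Sigma>'\<close>.\<close>

lemma joint_graph:
  assumes reach: "span_reachable S \<Sigma> x0"
  obtains Y where "Y \<in> carrier_mat (dim_x \<Sigma>') (dim_x \<Sigma>)"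
    "\<And>x. x \<in> carrier_vec (dim_x \<Sigma>) \<Longrightarrow> (x, Y *\<^sub>v x) \<in> joint"
proof -
  let ?n = "dim_x \<Sigma>" and ?n' = "dim_x \<Sigma>'"
  have "\<forall>j. \<exists>y. (unit_vec ?n j, y) \<in> joint" using joint_total[OF reach unit_vec_carrier] by blast
  then obtain y where y: "\<And>j. (unit_vec ?n j, y j) \<in> joint" by metis
  have yc: "y j \<in> carrier_vec ?n'" for j using joint_carrier[OF y] by blast
  define Y where "Y = mat ?n' ?n (\<lambda>(i, j). y j $ i)"
  have Y: "Y \<in> carrier_mat ?n' ?n" by (simp add: Y_def)
  have "(x, Y *\<^sub>v x) \<in> joint" if x: "x \<in> carrier_vec ?n" for x
  proof -
    \<comment> \<open>The joint span is closed under binary sums, so the combination of unit vectors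
      is built one coordinate at a time.\<close>
    have "(vec ?n (\<lambda>i. if i < k then x $ i else 0), vec ?n' (\<lambda>i. \<Sum>j<k. x $ j * y j $ i)) \<in> joint"
      if "k \<le> ?n" for k
      using that
    proof (induction k)
      case 0
      have "vec ?n (\<lambda>i. if i < 0 then x $ i else 0) = 0\<^sub>v ?n" "vec ?n' (\<lambda>i. \<Sum>j<0. x $ j * y j $ i) = 0\<^sub>v ?n'"
        by (auto intro!: vec_eqI)
      then show ?case using joint_zero by simp
    next
      case (Suc k)
      have "vec ?n (\<lambda>i. if i < Suc k then x $ i else 0) = vec ?n (\<lambda>i. if i < k then x $ i else 0) + x $ k \<cdot>\<^sub>v unit_vec ?n k"
        by (rule vec_eqI[of _ ?n]) (use Suc.prems in \<open>auto simp: less_Suc_eq\<close>)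
      moreover have "vec ?n' (\<lambda>i. \<Sum>j<Suc k. x $ j * y j $ i) = vec ?n' (\<lambda>i. \<Sum>j<k. x $ j * y j $ i) + x $ k \<cdot>\<^sub>v y k"
        by (rule vec_eqI[of _ ?n']) (use yc[of k] in auto)
      moreover have "(vec ?n (\<lambda>i. if i < k then x $ i else 0), vec ?n' (\<lambda>i. \<Sum>j<k. x $ j * y j $ i)) \<in> joint"
        using Suc by simp
      ultimately show ?case
        using pair_span.add pair_span.smult[OF y[of k, unfolded joint_def], of "x $ k"] unfolding joint_def by simp
    qed
    from this[of ?n] have "(vec ?n (\<lambda>i. if i < ?n then x $ i else 0), vec ?n' (\<lambda>i. \<Sum>j<?n. x $ j * y j $ i)) \<in> joint" by simp
    moreover have "vec ?n (\<lambda>i. if i < ?n then x $ i else 0) = x"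
      by (rule vec_eqI[OF _ x]) auto
    moreover have "vec ?n' (\<lambda>i. \<Sum>j<?n. x $ j * y j $ i) = Y *\<^sub>v x"
    proof (rule vec_eqI[OF _ mult_mat_vec_carrier[OF Y x]])
      fix i assume i: "i < ?n'"
      show "vec ?n' (\<lambda>i. \<Sum>j<?n. x $ j * y j $ i) $ i = (Y *\<^sub>v x) $ i"
        unfolding mult_mat_vec_index[OF Y x i] using i by (simp add: Y_def mult.commute)
    qed simp
    ultimately show ?thesis by simp
  qed
  with Y show thesis by (rule that)
qed

text \<open>A kernel vector of \<open>Y\<close> is paired with 0, hence is 0 by observability; so
  \<open>Y\<close> is injective.\<close>

lemma dim_le:
  assumes reach: "span_reachable S \<Sigma> x0" and obs: "observable S \<Sigma>"
  shows "dim_x \<Sigma> \<le> dim_x \<Sigma>'"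
proof -
  obtain Y where Y: "Y \<in> carrier_mat (dim_x \<Sigma>') (dim_x \<Sigma>)"
    and joint: "\<And>x. x \<in> carrier_vec (dim_x \<Sigma>) \<Longrightarrow> (x, Y *\<^sub>v x) \<in> joint"
    using joint_graph[OF reach] by blast
  show ?thesis
  proof (rule inj_mat_dim_le[OF Y])
    fix x assume "x \<in> carrier_vec (dim_x \<Sigma>)" "Y *\<^sub>v x = 0\<^sub>v (dim_x \<Sigma>')"
    then show "x = 0\<^sub>v (dim_x \<Sigma>)" using joint[of x] joint_zero_right[OF obs] by simp
  qed
qed

lemma isomorphic_if_reachable_observable:
  assumes hull: "vec_affine_hull (n_p S) (sched S) = carrier_vec (n_p S)"
    and reach: "span_reachable S \<Sigma> x0" and obs: "observable S \<Sigma>" and obs': "observable S \<Sigma>'"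
    and dim: "dim_x \<Sigma> = dim_x \<Sigma>'"
  shows "isomorphic S \<Sigma> \<Sigma>'"
proof -
  let ?n = "dim_x \<Sigma>"
  obtain Y where Y': "Y \<in> carrier_mat (dim_x \<Sigma>') ?n"
    and joint: "\<And>x. x \<in> carrier_vec ?n \<Longrightarrow> (x, Y *\<^sub>v x) \<in> joint"
    using joint_graph[OF reach] by blast
  have Y: "Y \<in> carrier_mat ?n ?n" using Y' dim by simp
  obtain Z where Z: "Z \<in> carrier_mat ?n ?n" "Y * Z = 1\<^sub>m ?n" "Z * Y = 1\<^sub>m ?n"
  proof -
    have "x = 0\<^sub>v ?n" if "x \<in> carrier_vec ?n" "Y *\<^sub>v x = 0\<^sub>v ?n" for x
      using joint[OF that(1)] that(2) joint_zero_right[OF obs] dim by simp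
    then show thesis using inj_square_mat_inverse[OF Y] that by blast
  qed
  have inv: "invertible_mat Y"
    unfolding invertible_mat_def inverts_mat_def using Y Z by auto
  \<comment> \<open>Subtracting the pair \<open>(x, Y x)\<close> leaves a pair with first component
    0, whose second component vanishes by observability of \<open>\<Sigma>'\<close>.\<close>
  have graph: "y = Y *\<^sub>v x" if xy: "(x, y) \<in> joint" for x y
  proof -
    have xc: "x \<in> carrier_vec ?n" and yc: "y \<in> carrier_vec (dim_x \<Sigma>')" using joint_carrier[OF xy] by auto
    note Yx = mult_mat_vec_carrier[OF Y' xc]
    have "(x + (-1) \<cdot>\<^sub>v x, y + (-1) \<cdot>\<^sub>v (Y *\<^sub>v x)) \<in> joint"
      using pair_span.add[OF xy[unfolded joint_def] pair_span.smult[OF joint[OF xc, unfolded joint_def]]]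
      unfolding joint_def .
    moreover have "x + (-1) \<cdot>\<^sub>v x = 0\<^sub>v ?n" using xc by (intro vec_eqI[of _ ?n]) auto
    ultimately have "y + (-1) \<cdot>\<^sub>v (Y *\<^sub>v x) = 0\<^sub>v (dim_x \<Sigma>')" using joint_zero_left[OF obs'] by simp
    then show ?thesis by (rule vec_eq_if_diff_zero[OF yc Yx])
  qed
  \<comment> \<open>Both runs, continued with the same constants, form joint pairs, so
    \<open>Y\<close> maps one continuation to the other; differentiating at time 0 relates the
    vector fields.\<close>
  have rhs: "Y *\<^sub>v state_rhs S \<Sigma> q x v = state_rhs S \<Sigma>' q (Y *\<^sub>v x) v"
    if x: "x \<in> reachable \<Sigma> x0" and q: "q \<in> sched S" and v: "v \<in> carrier_vec (n_u S)" for x q v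
  proof -
    obtain u p s where u: "u \<in> inputs S" and p: "p \<in> schedulings S" and s: "s \<in> T"
      and xs: "x = state_trajectory S \<Sigma> x0 u p s"
      using x by (auto simp: reachable_def)
    have xc: "x \<in> carrier_vec ?n" using x reachable_carrier[OF \<Sigma> x0] by blast
    note Yx = mult_mat_vec_carrier[OF Y' xc]
    have Yxs: "Y *\<^sub>v x = state_trajectory S \<Sigma>' x0' u p s"
      unfolding xs by (rule graph[OF joint_reachable[OF u p s], symmetric])
    note I = one_carrier_mat[of "dim_x \<Sigma>'"]
    have "Y *\<^sub>v state_rhs S \<Sigma> q x v = 1\<^sub>m (dim_x \<Sigma>') *\<^sub>v state_rhs S \<Sigma>' q (Y *\<^sub>v x) v"
    proof (rule state_trajectory_tangent[OF \<Sigma> xc Y' \<Sigma>' Yx I q v])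
      fix t assume t: "t \<in> T"
      let ?u = "concat_signal s u (const_signal v)" and ?p = "concat_signal s p (const_signal q)"
      have "state_trajectory S \<Sigma>' x0' ?u ?p (s + t) = Y *\<^sub>v state_trajectory S \<Sigma> x0 ?u ?p (s + t)"
        by (rule graph[OF joint_reachable[OF inputs_concat[OF u inputs_const[OF v] s]
                schedulings_concat[OF p schedulings_const[OF q] s] time_axis_add[OF s t]]])
      then have e: "state_trajectory S \<Sigma>' (Y *\<^sub>v x) (const_signal v) (const_signal q) t =
          Y *\<^sub>v state_trajectory S \<Sigma> x (const_signal v) (const_signal q) t"
        unfolding state_trajectory_concat[OF \<Sigma> x0 u inputs_const[OF v] p schedulings_const[OF q] s t]
          state_trajectory_concat[OF \<Sigma>' x0' u inputs_const[OF v] p schedulings_const[OF q] s t] xs[symmetric] Yxs[symmetric] .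
      show "Y *\<^sub>v state_trajectory S \<Sigma> x (const_signal v) (const_signal q) t =
          1\<^sub>m (dim_x \<Sigma>') *\<^sub>v state_trajectory S \<Sigma>' (Y *\<^sub>v x) (const_signal v) (const_signal q) t"
        unfolding one_mult_mat_vec[OF state_trajectory_carrier[OF \<Sigma>' inputs_const[OF v] schedulings_const[OF q] Yx t]]
        by (rule e[symmetric])
    qed
    then show ?thesis by (simp only: one_mult_mat_vec[OF state_rhs_carrier[OF \<Sigma>' Yx v]])
  qed
  have A: "Y * Amat \<Sigma> q = Amat \<Sigma>' q * Y" if q: "q \<in> sched S" for q
  proof -
    note YA = mult_carrier_mat[OF Y' system_carrier(1)[OF \<Sigma>, of q]]
      and AY = mult_carrier_mat[OF system_carrier(1)[OF \<Sigma>', of q] Y']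
    show ?thesis
    proof (rule mat_eq_if_mult_vec_eq[OF YA AY])
      fix x :: "real vec" assume x: "x \<in> carrier_vec ?n"
      \<comment> \<open>The vectors on which two matrices agree form a subspace, so agreement at
        reachable states gives agreement everywhere.\<close>
      have "reachable \<Sigma> x0 \<subseteq> {x \<in> carrier_vec ?n. (Y * Amat \<Sigma> q) *\<^sub>v x = (Amat \<Sigma>' q * Y) *\<^sub>v x}"
      proof
        fix y assume y: "y \<in> reachable \<Sigma> x0"
        then have yc: "y \<in> carrier_vec ?n" using reachable_carrier[OF \<Sigma> x0] by blast
        have "(Y * Amat \<Sigma> q) *\<^sub>v y = (Amat \<Sigma>' q * Y) *\<^sub>v y"
          using rhs[OF y q zero_carrier_vec]
          unfolding state_rhs_zero_input[OF \<Sigma> yc] state_rhs_zero_input[OF \<Sigma>' mult_mat_vec_carrier[OF Y' yc]]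
            assoc_mult_mat_vec[OF Y' system_carrier(1)[OF \<Sigma>] yc] assoc_mult_mat_vec[OF system_carrier(1)[OF \<Sigma>'] Y' yc] .
        then show "y \<in> {x \<in> carrier_vec ?n. (Y * Amat \<Sigma> q) *\<^sub>v x = (Amat \<Sigma>' q * Y) *\<^sub>v x}" using yc by simp
      qed
      then have "reachable_span \<Sigma> x0 \<subseteq> {x \<in> carrier_vec ?n. (Y * Amat \<Sigma> q) *\<^sub>v x = (Amat \<Sigma>' q * Y) *\<^sub>v x}"
        unfolding reachable_span_def
        by (rule span_lin_subspace(3)[OF reachable_carrier[OF \<Sigma> x0] lin_subspace_kernel[OF YA AY]])
      then show "(Y * Amat \<Sigma> q) *\<^sub>v x = (Amat \<Sigma>' q * Y) *\<^sub>v x"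
        using x reach unfolding span_reachable_iff by blast
    qed
  qed
  have B: "Bmat \<Sigma>' q = Y * Bmat \<Sigma> q" if q: "q \<in> sched S" for q
  proof -
    note B1 = system_carrier(2)[OF \<Sigma>, of q] and B2 = system_carrier(2)[OF \<Sigma>', of q]
      and A1 = system_carrier(1)[OF \<Sigma>, of q] and A2 = system_carrier(1)[OF \<Sigma>', of q]
    have x0R: "x0 \<in> reachable \<Sigma> x0"
    proof -
      have "x0 = state_trajectory S \<Sigma> x0 no_input (const_signal q) 0"
        by (rule state_trajectory_0[OF \<Sigma> zero_input schedulings_const[OF q] x0, symmetric])
      then show ?thesis unfolding reachable_def using zero_input schedulings_const[OF q] time_axis_zero by blast
    qed
    show ?thesis
    proof (rule mat_eq_if_mult_vec_eq[OF B2 mult_carrier_mat[OF Y' B1]])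
      fix v :: "real vec" assume v: "v \<in> carrier_vec (n_u S)"
      note Ax = mult_mat_vec_carrier[OF A1 x0] and Bv = mult_mat_vec_carrier[OF B1 v]
        and Yx = mult_mat_vec_carrier[OF Y' x0]
      note YAx = mult_mat_vec_carrier[OF Y' Ax] and YBv = mult_mat_vec_carrier[OF Y' Bv]
        and AYx = mult_mat_vec_carrier[OF A2 Yx] and Bv' = mult_mat_vec_carrier[OF B2 v]
      have "Y *\<^sub>v (Amat \<Sigma> q *\<^sub>v x0) = (Y * Amat \<Sigma> q) *\<^sub>v x0" by (rule assoc_mult_mat_vec[OF Y' A1 x0, symmetric])
      also have "\<dots> = Amat \<Sigma>' q *\<^sub>v (Y *\<^sub>v x0)" unfolding A[OF q] by (rule assoc_mult_mat_vec[OF A2 Y' x0])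
      finally have YA: "Y *\<^sub>v (Amat \<Sigma> q *\<^sub>v x0) = Amat \<Sigma>' q *\<^sub>v (Y *\<^sub>v x0)" .
      \<comment> \<open>The drift terms at \<open>x0\<close> are already known to agree; cancelling
        them leaves the input terms.\<close>
      have "Y *\<^sub>v (Amat \<Sigma> q *\<^sub>v x0) + Y *\<^sub>v (Bmat \<Sigma> q *\<^sub>v v) = Amat \<Sigma>' q *\<^sub>v (Y *\<^sub>v x0) + Bmat \<Sigma>' q *\<^sub>v v"
        using rhs[OF x0R q v] unfolding state_rhs_def mult_add_distrib_mat_vec[OF Y' Ax Bv] .
      then have "Y *\<^sub>v (Amat \<Sigma> q *\<^sub>v x0) + Y *\<^sub>v (Bmat \<Sigma> q *\<^sub>v v) - Y *\<^sub>v (Amat \<Sigma> q *\<^sub>v x0) =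
          Amat \<Sigma>' q *\<^sub>v (Y *\<^sub>v x0) + Bmat \<Sigma>' q *\<^sub>v v - Amat \<Sigma>' q *\<^sub>v (Y *\<^sub>v x0)"
        by (simp only: YA)
      then have "Y *\<^sub>v (Bmat \<Sigma> q *\<^sub>v v) = Bmat \<Sigma>' q *\<^sub>v v"
        unfolding vec_add_diff_cancel_left[OF YAx YBv] vec_add_diff_cancel_left[OF AYx Bv'] .
      then show "Bmat \<Sigma>' q *\<^sub>v v = (Y * Bmat \<Sigma> q) *\<^sub>v v"
        unfolding assoc_mult_mat_vec[OF Y' B1 v] by (rule sym)
    qed
  qed
  have C: "Cmat \<Sigma>' q * Y = Cmat \<Sigma> q" if q: "q \<in> sched S" for q
  proof -
    note C1 = system_carrier(3)[OF \<Sigma>, of q] and C2 = system_carrier(3)[OF \<Sigma>', of q]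
    note p = schedulings_const[OF q]
    show ?thesis
    proof (rule mat_eq_if_mult_vec_eq[OF mult_carrier_mat[OF C2 Y'] C1])
      fix x :: "real vec" assume x: "x \<in> carrier_vec ?n"
      note Yx = mult_mat_vec_carrier[OF Y' x]
      have q0: "const_signal q 0 = q" by (simp add: const_signal_def)
      \<comment> \<open>The equal outputs of a joint pair, taken at time 0 under the constant
        scheduling \<open>q\<close>, read off \<open>C(q)\<close>.\<close>
      have "Cmat \<Sigma> q *\<^sub>v x = Cmat \<Sigma>' q *\<^sub>v (Y *\<^sub>v x)"
        using joint_output[OF joint[OF x] p time_axis_zero]
        unfolding q0 state_trajectory_0[OF \<Sigma> zero_input p x] state_trajectory_0[OF \<Sigma>' zero_input p Yx] .
      then show "(Cmat \<Sigma>' q * Y) *\<^sub>v x = Cmat \<Sigma> q *\<^sub>v x"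
        unfolding assoc_mult_mat_vec[OF C2 Y' x] by (rule sym)
    qed
  qed
  note c = coefficient_carrier[OF \<Sigma>] and c' = coefficient_carrier[OF \<Sigma>']
  have affine: "affine_mat (n_p S) (\<lambda>l. mat_A \<Sigma>' l * Y) q = Amat \<Sigma>' q * Y"
    "affine_mat (n_p S) (\<lambda>l. Y * mat_A \<Sigma> l) q = Y * Amat \<Sigma> q"
    "affine_mat (n_p S) (\<lambda>l. Y * mat_B \<Sigma> l) q = Y * Bmat \<Sigma> q"
    "affine_mat (n_p S) (\<lambda>l. mat_C \<Sigma>' l * Y) q = Cmat \<Sigma>' q * Y" for q
    by (rule affine_mat_mult_right[where M = "mat_A \<Sigma>'", OF c'(1) Y']
        affine_mat_mult_left[where M = "mat_A \<Sigma>", OF c(1) Y']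
        affine_mat_mult_left[where M = "mat_B \<Sigma>", OF c(2) Y']
        affine_mat_mult_right[where M = "mat_C \<Sigma>'", OF c'(3) Y'], assumption)+
  show ?thesis
    unfolding isomorphic_def
  proof (intro conjI dim bexI[OF _ Y] inv allI impI)
    fix l assume l: "l \<le> n_p S"
    show "mat_A \<Sigma>' l * Y = Y * mat_A \<Sigma> l"
      by (rule affine_mat_eqD[where M = "\<lambda>l. mat_A \<Sigma>' l * Y" and M' = "\<lambda>l. Y * mat_A \<Sigma> l",
            OF hull mult_carrier_mat[OF c'(1) Y'] mult_carrier_mat[OF Y' c(1)] _ l])
        (simp_all only: affine A)
    show "mat_B \<Sigma>' l = Y * mat_B \<Sigma> l"
      by (rule affine_mat_eqD[where M = "mat_B \<Sigma>'" and M' = "\<lambda>l. Y * mat_B \<Sigma> l",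
            OF hull c'(2) mult_carrier_mat[OF Y' c(2)] _ l])
        (simp_all only: affine B)
    show "mat_C \<Sigma>' l * Y = mat_C \<Sigma> l"
      by (rule affine_mat_eqD[where M = "\<lambda>l. mat_C \<Sigma>' l * Y" and M' = "mat_C \<Sigma>",
            OF hull mult_carrier_mat[OF c'(3) Y'] c(3) _ l])
        (simp_all only: affine C)
  qed
qed

end

theorem theorem1:
  fixes S :: lpv_setting
  assumes "sched S \<subseteq> carrier_vec (n_p S)"
    and "vec_affine_hull (n_p S) (sched S) = carrier_vec (n_p S)"
  shows
    "(\<forall>\<Sigma> x0. is_lpv_ssa S \<Sigma> \<and> x0 \<in> carrier_vec (dim_x \<Sigma>) \<longrightarrow>
        (minimal_wrt S \<Sigma> x0 \<longleftrightarrow> span_reachable S \<Sigma> x0 \<and> observable S \<Sigma>)) \<and>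
     (\<forall>\<Sigma> x0 \<Sigma>' x0'.
        is_lpv_ssa S \<Sigma> \<and> x0 \<in> carrier_vec (dim_x \<Sigma>) \<and>
        is_lpv_ssa S \<Sigma>' \<and> x0' \<in> carrier_vec (dim_x \<Sigma>') \<and>
        minimal_wrt S \<Sigma> x0 \<and> minimal_wrt S \<Sigma>' x0' \<and>
        weakly_io_equivalent S \<Sigma> x0 \<Sigma>' x0' \<longrightarrow> isomorphic S \<Sigma> \<Sigma>')"
proof -
  interpret lpv S by standard (rule assms(1))
  \<comment> \<open>Weights over the empty set sum to 0 and not to 1, so an empty scheduling set has
    an empty hull.\<close>
  have ne: "sched S \<noteq> {}"
  proof
    assume "sched S = {}"
    then have "vec_affine_hull (n_p S) (sched S) = {}" by (auto simp: vec_affine_hull_def)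
    then show False using assms(2) zero_carrier_vec by blast
  qed
  have char: "minimal_wrt S \<Sigma> x0 \<longleftrightarrow> span_reachable S \<Sigma> x0 \<and> observable S \<Sigma>"
    if \<Sigma>: "is_lpv_ssa S \<Sigma>" and x0: "x0 \<in> carrier_vec (dim_x \<Sigma>)" for \<Sigma> x0
  proof
    assume "minimal_wrt S \<Sigma> x0"
    then show "span_reachable S \<Sigma> x0 \<and> observable S \<Sigma>"
      using minimal_imp_span_reachable[OF \<Sigma> x0 _ ne] minimal_imp_observable[OF \<Sigma> x0] by blast
  next
    assume ro: "span_reachable S \<Sigma> x0 \<and> observable S \<Sigma>"
    have "is_realization S \<Sigma> (output_trajectory S \<Sigma> x0)"
      unfolding is_realization_def using \<Sigma> x0 by (auto simp: io_equal_def)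
    moreover have "dim_x \<Sigma> \<le> dim_x \<Sigma>'" if real: "is_realization S \<Sigma>' (output_trajectory S \<Sigma> x0)" for \<Sigma>'
    proof -
      obtain x0' where \<Sigma>': "is_lpv_ssa S \<Sigma>'" and x0': "x0' \<in> carrier_vec (dim_x \<Sigma>')"
        and io: "io_equal S (output_trajectory S \<Sigma> x0) (output_trajectory S \<Sigma>' x0')"
        using real unfolding is_realization_def by blast
      interpret lpv_pair S \<Sigma> \<Sigma>' x0 x0' by standard (fact \<Sigma> x0 \<Sigma>' x0' io ne)+
      show ?thesis using dim_le ro by blast
    qed
    ultimately show "minimal_wrt S \<Sigma> x0"
      unfolding minimal_wrt_def is_minimal_realization_def by blast
  qed
  have iso: "isomorphic S \<Sigma> \<Sigma>'"
    if \<Sigma>: "is_lpv_ssa S \<Sigma>" and x0: "x0 \<in> carrier_vec (dim_x \<Sigma>)"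
      and \<Sigma>': "is_lpv_ssa S \<Sigma>'" and x0': "x0' \<in> carrier_vec (dim_x \<Sigma>')"
      and min: "minimal_wrt S \<Sigma> x0" and min': "minimal_wrt S \<Sigma>' x0'"
      and io: "io_equal S (output_trajectory S \<Sigma> x0) (output_trajectory S \<Sigma>' x0')" for \<Sigma> x0 \<Sigma>' x0'
  proof -
    interpret lpv_pair S \<Sigma> \<Sigma>' x0 x0' by standard (fact \<Sigma> x0 \<Sigma>' x0' io ne)+
    \<comment> \<open>Each system realizes the input-output map of the other, so minimality bounds
      the dimensions both ways.\<close>
    have "dim_x \<Sigma> = dim_x \<Sigma>'"
      using minimal_wrt_dim_le[OF min \<Sigma>' x0' io] minimal_wrt_dim_le[OF min' \<Sigma> x0 io_equal_sym[OF io]] by simp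
    then show ?thesis
      using isomorphic_if_reachable_observable[OF assms(2)] char[OF \<Sigma> x0] char[OF \<Sigma>' x0'] min min' by blast
  qed
  show ?thesis using char iso unfolding weakly_io_equivalent_def by blast
qed

end
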